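(* Let $\mathbb{B}$ be a separable Banach space with dual $\mathbb{B}^*$ and duality pairing $\langle\cdot,\cdot\rangle$. Let $X=\{X_{\mathbf t},\ \mathbf t\in\mathbb{Z}^m\}$ be a centered Gaussian process with values in $\mathbb{B}$ such that $X_{\mathbf t}$ has the same distribution $\mathcal P$ for every $\mathbf t$, and let $\mathcal E$ be the concentration ellipsoid of $\mathcal P$. Let $(T_n)$ be an increasing sequence ($T_n\subset T_{n+1}$) of finite subsets of $\mathbb{Z}^m$ with $\nu_n=\operatorname{card}(T_n)\to\infty$, and put $W_n=\operatorname{conv}\{X_{\mathbf t},\ \mathbf t\in T_n\}$. Suppose that for every $x^*\in\mathbb{B}^*$, $$E\langle X_{\mathbf t},x^*\rangle\langle X_{\mathbf s},x^*\rangle\to 0\quad\text{as } |\mathbf t-\mathbf s|\to\infty.$$ Then, almost surely, $\frac{1}{b(\nu_n)}W_n\to\mathcal E$ as $n\to\infty$ in the Hausdorff distance.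
   Context: For $\mathbf t=(t_1,\dots,t_m),\mathbf s=(s_1,\dots,s_m)$, $|\mathbf t-\mathbf s|=\max_{1\le k\le m}|t_k-s_k|$. $\operatorname{conv}\{A\}$ denotes the closed convex hull of $A\subset\mathbb{B}$. $b(t)=\sqrt{2\ln(t\vee 2)}$. The concentration ellipsoid $\mathcal E$ of the centered Gaussian measure $\mathcal P$ on $\mathbb{B}$ is the closed unit ball of the reproducing kernel Hilbert space $\mathrm H\subset\mathbb{B}$ of $\mathcal P$ (a compact subset of $\mathbb{B}$). The Hausdorff distance between nonempty compact sets $A,B\subset\mathbb{B}$ is $\rho_{\mathbb{B}}(A,B)=\max\{\inf\{\epsilon: A\subset B^\epsilon\},\inf\{\epsilon: B\subset A^\epsilon\}\}$, where $A^\epsilon$ is the open $\epsilon$-neighbourhood of $A$. *)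

theory Defs
  imports "HOL-Analysis.Analysis" "HOL-Probability.Probability"
begin

definition maxdist :: "int ^ 'm \<Rightarrow> int ^ 'm \<Rightarrow> int" where
  "maxdist t s = Max (range (\<lambda>k. \<bar>t $ k - s $ k\<bar>))"

definition bfun :: "real \<Rightarrow> real" where
  "bfun t = sqrt (2 * ln (max t 2))"

definition dual_elem :: "('b::real_normed_vector \<Rightarrow> real) \<Rightarrow> bool" where
  "dual_elem f \<longleftrightarrow> bounded_linear f"

definition centered_gaussian_rv :: "'a measure \<Rightarrow> ('a \<Rightarrow> real) \<Rightarrow> bool" where
  "centered_gaussian_rv M Y \<longleftrightarrow> Y \<in> borel_measurable M \<and>
     (distr M borel Y = return borel 0 \<or>
      (\<exists>\<sigma>>0. distributed M lborel Y (normal_density 0 \<sigma>)))"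

definition centered_gaussian_process ::
    "'a measure \<Rightarrow> ('i \<Rightarrow> 'a \<Rightarrow> 'b::real_normed_vector) \<Rightarrow> bool" where
  "centered_gaussian_process M X \<longleftrightarrow> prob_space M \<and>
     (\<forall>t. X t \<in> borel_measurable M) \<and>
     (\<forall>F c. finite F \<longrightarrow> (\<forall>t\<in>F. dual_elem (c t)) \<longrightarrow>
        centered_gaussian_rv M (\<lambda>\<omega>. \<Sum>t\<in>F. c t (X t \<omega>)))"

definition L2_dual_closure :: "'b::real_normed_vector measure \<Rightarrow> ('b \<Rightarrow> real) set" where
  "L2_dual_closure P = {\<xi>. \<xi> \<in> borel_measurable P \<and> integrable P (\<lambda>x. (\<xi> x)\<^sup>2) \<and>
     (\<exists>f :: nat \<Rightarrow> 'b \<Rightarrow> real. (\<forall>n. dual_elem (f n)) \<and>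
        (\<lambda>n. \<integral>x. (\<xi> x - f n x)\<^sup>2 \<partial>P) \<longlonglongrightarrow> 0)}"

text \<open>Concentration ellipsoid: closed unit ball of the RKHS H of P, where
  H = { \<integral> \<xi>(x) x dP(x) : \<xi> \<in> H_P } with norm \<parallel>\<xi>\<parallel>_{L^2(P)}.\<close>
definition conc_ellipsoid :: "'b::{banach, second_countable_topology} measure \<Rightarrow> 'b set" where
  "conc_ellipsoid P = {(\<integral>x. \<xi> x *\<^sub>R x \<partial>P) | \<xi>.
      \<xi> \<in> L2_dual_closure P \<and> (\<integral>x. (\<xi> x)\<^sup>2 \<partial>P) \<le> 1}"

definition eps_nbhd :: "'b::metric_space set \<Rightarrow> real \<Rightarrow> 'b set" where
  "eps_nbhd A e = {x. \<exists>a\<in>A. dist x a < e}"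

definition hausdorff_dist :: "'b::metric_space set \<Rightarrow> 'b set \<Rightarrow> real" where
  "hausdorff_dist A B = max (Inf {e. e > 0 \<and> A \<subseteq> eps_nbhd B e})
                            (Inf {e. e > 0 \<and> B \<subseteq> eps_nbhd A e})"

end

theory Submission
  imports Defs "HOL-Real_Asymp.Real_Asymp"
begin

text \<open>
  Hausdorff convergence of convex sets inside multiples of a totally bounded set \<open>K\<close> reduces, by
  Hahn--Banach separation, to convergence of support functions on finitely many functionals. The
  support function of the ellipsoid at \<open>f\<close> is the standard deviation \<open>\<sigma>(f)\<close> of \<open>f\<close> under \<open>P\<close>, so it
  suffices that almost surely \<open>max\<^sub>t f(X\<^sub>t) / b(\<nu>\<^sub>n)\<close> tends to \<open>\<sigma>(f)\<close> for each \<open>f\<close> and that all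
  \<open>X\<^sub>t / b(\<nu>\<^sub>n)\<close> eventually lie in a fixed multiple of \<open>K\<close>.

  The central tool is a concentration inequality for the maximum \<open>F\<close> of a Gaussian vector with
  variances at most \<open>s\<close>: \<open>Pr(F > u) Pr(F \<le> v) \<le> exp (- 2 (u - v)\<^sup>2 / (\<pi>\<^sup>2 s))\<close>. It is proved by rotating
  the vector into an independent copy in many small steps. Applied to functionals in the polar of a
  symmetric convex set \<open>K\<close> with \<open>P(K) \<ge> 1/2\<close>, it gives Gaussian tails for the gauge of \<open>K\<close>. For the
  lower bound on the maximum, a second moment argument on the number of exceedances of level
  \<open>(1 - \<epsilon>) b(n)\<close> only yields a probability of at least \<open>n\<close> to a small negative power, because the
  covariances merely tend to \<open>0\<close>; concentration upgrades this to probability close to \<open>1\<close>.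
  Borel--Cantelli is applied along the dyadic blocks \<open>2\<^sup>j \<le> \<nu>\<^sub>n < 2\<^sup>j\<^sup>+\<^sup>1\<close>.
\<close>

section \<open>Hahn--Banach separation\<close>

text \<open>The maximum is not differentiable, so the classical continuous rotation argument
  (differentiate along the rotation, then average) is replaced by a telescoping sum over
  \<open>J\<close> equal angles. The law of one step is the same at every angle; this is why
  uniqueness of joint characteristic functions is established beforehand. Jensen's inequality deals
  with the dependence between steps. The bound for one step has a factor depending on the number of
  coordinates, but this factor tends to \<open>1\<close> as \<open>J\<close> grows, so the resulting
  inequality is free of dimension; its constant \<open>pi\<^sup>2\<close> comes from the total angle
  \<open>pi / 2\<close>.

  Stating concentration as a product of two probabilities avoids medians and means: a lower bound on
  either factor, however poor, becomes an upper bound on the other. It is used with a factor at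
  least \<open>1/2\<close>, for convex bodies, and with a factor as small as \<open>n\<close> to the
  power \<open>- e\<^sup>2 / 5\<close>, for the lower bound on the maximum, where the product decays
  at least like \<open>n\<close> to the power \<open>- e\<^sup>2 / 4\<close>.\<close>

definition sublinear :: "('b::real_vector \<Rightarrow> real) \<Rightarrow> bool" where
  "sublinear p \<longleftrightarrow> (\<forall>x y. p (x + y) \<le> p x + p y) \<and> (\<forall>r\<ge>0. \<forall>x. p (r *\<^sub>R x) \<le> r * p x)"

lemma sublinear_zero:
  assumes "sublinear p" shows "p 0 = 0"
proof -
  have "p (0 *\<^sub>R 0) \<le> 0 * p 0" using assms unfolding sublinear_def by blast
  moreover have "p (0 + 0) \<le> p 0 + p 0" using assms unfolding sublinear_def by blast
  ultimately show ?thesis by simp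
qed

lemma sublinear_scale:
  assumes "sublinear p" "r \<ge> 0" shows "p (r *\<^sub>R x) = r * p x"
proof (cases "r = 0")
  case True then show ?thesis using sublinear_zero[OF assms(1)] by simp
next
  case False
  then have r: "r > 0" using assms by simp
  have "p ((1/r) *\<^sub>R (r *\<^sub>R x)) \<le> (1/r) * p (r *\<^sub>R x)"
    using assms r unfolding sublinear_def by (meson divide_nonneg_pos less_eq_real_def zero_less_one)
  then have "r * p x \<le> p (r *\<^sub>R x)" using r by (simp add: field_simps)
  moreover have "p (r *\<^sub>R x) \<le> r * p x" using assms unfolding sublinear_def by blast
  ultimately show ?thesis by simp
qed

lemma sublinear_minus_ge:
  assumes "sublinear p" shows "- p (- x) \<le> p x"
proof -
  have "p (x + - x) \<le> p x + p (- x)" using assms unfolding sublinear_def by blast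
  then show ?thesis using sublinear_zero[OF assms] by simp
qed

text \<open>The infimum \<open>q\<close> is the largest sublinear function under \<open>p\<close>
  that is at most \<open>- e\<close> at every \<open>- c\<close>: subadditivity puts any such
  function below each term. The hypothesis on \<open>C\<close> keeps the infimum finite. A single
  point yields oddness of minimal functionals, a reflected translate of a convex set yields
  separation.\<close>

lemma sublinear_push_down:
  fixes p :: "'b::real_vector \<Rightarrow> real"
  assumes p: "sublinear p" and C: "convex C" and ne: "C \<noteq> {}"
    and e: "\<And>c. c \<in> C \<Longrightarrow> e \<le> p c"
  shows "\<exists>q. sublinear q \<and> (\<forall>x. q x \<le> p x) \<and> (\<forall>c\<in>C. q (- c) \<le> - e)"
proof -
  define S where "S y = {p (y + t *\<^sub>R c) - t * e | t c. t \<ge> 0 \<and> c \<in> C}" for y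
  define q where "q y = Inf (S y)" for y
  obtain c0 where c0: "c0 \<in> C" using ne by blast
  have sub: "p (x + y) \<le> p x + p y" for x y using p unfolding sublinear_def by blast
  \<comment> \<open>A bound for the whole family makes the infimum finite: \<open>t * e\<close> is
    at most \<open>p\<close> at \<open>t c\<close>, and \<open>t c\<close> is split as
    \<open>(y + t c) + (- y)\<close>.\<close>
  have lb: "- p (- y) \<le> s" if s: "s \<in> S y" for s y
  proof -
    obtain t c where tc: "s = p (y + t *\<^sub>R c) - t * e" "t \<ge> 0" "c \<in> C" using s unfolding S_def by blast
    have "t * e \<le> t * p c" using e tc by (simp add: mult_left_mono)
    also have "\<dots> = p (t *\<^sub>R c)" using sublinear_scale[OF p] tc by simp
    also have "\<dots> \<le> p (y + t *\<^sub>R c) + p (- y)" using sub[of "y + t *\<^sub>R c" "- y"] by simp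
    finally show ?thesis using tc by simp
  qed
  have neS: "S y \<noteq> {}" for y using c0 unfolding S_def by force
  have bdd: "bdd_below (S y)" for y using lb by (meson bdd_belowI)
  have qle: "q y \<le> p (y + t *\<^sub>R c) - t * e" if "t \<ge> 0" "c \<in> C" for y t c
    unfolding q_def by (rule cInf_lower[OF _ bdd]) (use that in \<open>auto simp: S_def\<close>)
  have qle': "q y \<le> s" if "s \<in> S y" for y s using cInf_lower[OF that bdd] by (simp add: q_def)
  have qge: "u \<le> q y" if "\<And>s. s \<in> S y \<Longrightarrow> u \<le> s" for u y
    unfolding q_def by (rule cInf_greatest[OF neS]) (use that in auto)
  have add: "q (y1 + y2) \<le> q y1 + q y2" for y1 y2
  proof -
    have *: "q (y1 + y2) \<le> s1 + s2" if s1: "s1 \<in> S y1" and s2: "s2 \<in> S y2" for s1 s2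
    proof -
      obtain t1 c1 where 1: "s1 = p (y1 + t1 *\<^sub>R c1) - t1 * e" "t1 \<ge> 0" "c1 \<in> C"
        using s1 unfolding S_def by blast
      obtain t2 c2 where 2: "s2 = p (y2 + t2 *\<^sub>R c2) - t2 * e" "t2 \<ge> 0" "c2 \<in> C"
        using s2 unfolding S_def by blast
      \<comment> \<open>Convexity enters here: two nonnegative multiples of points of
        \<open>C\<close> add up to one multiple. If both multipliers vanish, any point of
        \<open>C\<close> serves.\<close>
      have "\<exists>c\<in>C. t1 *\<^sub>R c1 + t2 *\<^sub>R c2 = (t1 + t2) *\<^sub>R c"
      proof (cases "t1 + t2 = 0")
        case True then have "t1 = 0" "t2 = 0" using 1 2 by auto
        then show ?thesis using c0 by auto
      next
        case False
        have "(t1/(t1+t2)) *\<^sub>R c1 + (t2/(t1+t2)) *\<^sub>R c2 \<in> C"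
          by (rule convexD[OF C]) (use 1 2 False in \<open>auto simp: add_divide_distrib[symmetric]\<close>)
        then show ?thesis using False
          by (intro bexI[of _ "(t1/(t1+t2)) *\<^sub>R c1 + (t2/(t1+t2)) *\<^sub>R c2"]) (auto simp: scaleR_add_right)
      qed
      then obtain c where c: "c \<in> C" "t1 *\<^sub>R c1 + t2 *\<^sub>R c2 = (t1 + t2) *\<^sub>R c" by blast
      have "q (y1 + y2) \<le> p (y1 + y2 + (t1 + t2) *\<^sub>R c) - (t1 + t2) * e"
        using qle 1 2 c by simp
      also have "y1 + y2 + (t1 + t2) *\<^sub>R c = (y1 + t1 *\<^sub>R c1) + (y2 + t2 *\<^sub>R c2)"
        unfolding c(2)[symmetric] by (simp add: algebra_simps)
      also have "p \<dots> - (t1 + t2) * e \<le> s1 + s2"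
        using sub[of "y1 + t1 *\<^sub>R c1" "y2 + t2 *\<^sub>R c2"] 1 2 by (simp add: algebra_simps)
      finally show ?thesis .
    qed
    have "q (y1 + y2) - s1 \<le> q y2" if "s1 \<in> S y1" for s1
      by (rule qge) (use *[OF that] in \<open>simp add: algebra_simps\<close>)
    then have "q (y1 + y2) - q y2 \<le> q y1"
      by (intro qge) (simp add: algebra_simps)
    then show ?thesis by simp
  qed
  have scale: "q (r *\<^sub>R y) \<le> r * q y" if "r > 0" for r y
  proof -
    have "q (r *\<^sub>R y) / r \<le> q y"
    proof (rule qge)
      fix s assume "s \<in> S y"
      then obtain t c where tc: "s = p (y + t *\<^sub>R c) - t * e" "t \<ge> 0" "c \<in> C" unfolding S_def by blast
      have "q (r *\<^sub>R y) \<le> p (r *\<^sub>R y + (r * t) *\<^sub>R c) - (r * t) * e"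
        using qle[of "r * t" c] tc that by simp
      also have "r *\<^sub>R y + (r * t) *\<^sub>R c = r *\<^sub>R (y + t *\<^sub>R c)" by (simp add: algebra_simps)
      also have "p \<dots> - (r * t) * e = r * s"
        using sublinear_scale[OF p, of r "y + t *\<^sub>R c"] that tc by (simp add: right_diff_distrib)
      finally show "q (r *\<^sub>R y) / r \<le> s" using that by (simp add: field_simps)
    qed
    then show ?thesis using that by (simp add: field_simps)
  qed
  have qp: "q y \<le> p y" for y using qle[of 0 c0 y] c0 by simp
  have "sublinear q"
    unfolding sublinear_def
  proof (intro conjI allI impI)
    show "q (x + y) \<le> q x + q y" for x y by (rule add)
    show "q (r *\<^sub>R x) \<le> r * q x" if "0 \<le> r" for r x
    proof (cases "r = 0")
      case True then show ?thesis using qp[of 0] sublinear_zero[OF p] by simp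
    next
      case False then show ?thesis using scale that by simp
    qed
  qed
  moreover have "q (- c) \<le> - e" if "c \<in> C" for c
    using qle[of 1 c "- c"] that sublinear_zero[OF p] by simp
  ultimately show ?thesis using qp by blast
qed

text \<open>Hahn--Banach in the form: a minimal sublinear functional is odd, hence linear.\<close>

lemma sublinear_dominates_linear:
  fixes p :: "'b::real_vector \<Rightarrow> real"
  assumes p: "sublinear p"
  shows "\<exists>f. linear f \<and> (\<forall>x. f x \<le> p x)"
proof -
  define A where "A = {q. sublinear q \<and> (\<forall>x. q x \<le> p x)}"
  have pA: "p \<in> A" using p by (auto simp: A_def)
  \<comment> \<open>The order is reversed, so that Zorn's lemma yields a minimal element.\<close>
  have "\<exists>m\<in>A. \<forall>a\<in>A. m \<ge> a \<longrightarrow> a = m"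
  proof (rule predicate_Zorn)
    show "partial_order_on A (relation_of (\<ge>) A)"
      by (auto simp: partial_order_on_def preorder_on_def refl_on_def trans_def antisym_def relation_of_def)
    fix Q assume Q: "Q \<in> Chains (relation_of (\<ge>) A)"
    then have QA: "Q \<subseteq> A" and ch: "\<And>a b. a \<in> Q \<Longrightarrow> b \<in> Q \<Longrightarrow> a \<le> b \<or> b \<le> a"
      unfolding Chains_def relation_of_def by auto
    show "\<exists>u\<in>A. \<forall>a\<in>Q. u \<le> a"
    proof (cases "Q = {}")
      case True then show ?thesis using pA by auto
    next
      case False
      define u where "u x = Inf ((\<lambda>q. q x) ` Q)" for x
      have lb: "- p (- x) \<le> q x" if "q \<in> Q" for q x
        using sublinear_minus_ge[of q x] QA that unfolding A_def by (smt (verit) mem_Collect_eq subsetD)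
      have bdd: "bdd_below ((\<lambda>q. q x) ` Q)" for x using lb by (meson bdd_belowI2)
      have ule: "u x \<le> q x" if "q \<in> Q" for q x
        unfolding u_def by (rule cInf_lower[OF _ bdd]) (use that in auto)
      have uge: "c \<le> u x" if "\<And>q. q \<in> Q \<Longrightarrow> c \<le> q x" for c x
        unfolding u_def by (rule cInf_greatest) (use that False in auto)
      have sl: "sublinear q" if "q \<in> Q" for q using that QA by (auto simp: A_def)
      have "u (x + y) \<le> u x + u y" for x y
      proof -
        \<comment> \<open>A pointwise infimum of sublinear functions need not be subadditive; in a
          chain the smaller of \<open>q1\<close> and \<open>q2\<close> bounds both terms.\<close>
        have *: "u (x + y) \<le> q1 x + q2 y" if q: "q1 \<in> Q" "q2 \<in> Q" for q1 q2
        proof -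
          obtain q where q': "q \<in> Q" "q \<le> q1" "q \<le> q2" using ch q by (metis order_refl)
          have "u (x + y) \<le> q (x + y)" using ule q' by blast
          also have "\<dots> \<le> q x + q y" using sl[OF q'(1)] unfolding sublinear_def by blast
          also have "\<dots> \<le> q1 x + q2 y" using q' by (intro add_mono) (auto simp: le_fun_def)
          finally show ?thesis .
        qed
        have "u (x + y) - q1 x \<le> u y" if "q1 \<in> Q" for q1
          by (rule uge) (use *[OF that] in \<open>simp add: algebra_simps\<close>)
        then have "u (x + y) - u y \<le> u x"
          by (intro uge) (simp add: algebra_simps)
        then show ?thesis by simp
      qed
      moreover have "u (r *\<^sub>R x) \<le> r * u x" if "r \<ge> 0" for r x
      proof (cases "r = 0")
        case True
        obtain q where "q \<in> Q" using False by blast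
        then have "u 0 \<le> 0" using ule[of q 0] sublinear_zero[OF sl[of q]] by simp
        then show ?thesis using True by simp
      next
        case r: False
        have "u (r *\<^sub>R x) / r \<le> u x"
        proof (rule uge)
          fix q assume q: "q \<in> Q"
          have "u (r *\<^sub>R x) \<le> r * q x" using ule[OF q, of "r *\<^sub>R x"] sublinear_scale[OF sl[OF q] that] by simp
          then show "u (r *\<^sub>R x) / r \<le> q x" using that r by (simp add: field_simps)
        qed
        then show ?thesis using that r by (simp add: field_simps)
      qed
      ultimately have "sublinear u" unfolding sublinear_def by blast
      moreover have "u x \<le> p x" for x
      proof -
        obtain q where "q \<in> Q" using False by blast
        then show ?thesis using ule[of q x] QA unfolding A_def by (smt (verit) mem_Collect_eq subsetD)
      qed
      ultimately show ?thesis using ule by (intro bexI[of _ u]) (auto simp: A_def le_fun_def)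
    qed
  qed
  then obtain m where mA: "m \<in> A" and min: "\<And>a. a \<in> A \<Longrightarrow> a \<le> m \<Longrightarrow> a = m" by blast
  have m: "sublinear m" "\<And>x. m x \<le> p x" using mA by (auto simp: A_def)
  have odd: "m (- y) = - m y" for y
  proof -
    \<comment> \<open>Pushing \<open>m\<close> down at the single point \<open>y\<close>, to the
      level \<open>m y\<close>, cannot lead below the minimal \<open>m\<close>, so \<open>m\<close>
      itself satisfies the bound at \<open>- y\<close>.\<close>
    obtain q where q: "sublinear q" "\<forall>x. q x \<le> m x" "q (- y) \<le> - m y"
      using sublinear_push_down[OF m(1), of "{y}" "m y"] by auto
    have "q \<in> A" using q m unfolding A_def by (auto intro: order_trans)
    then have "q = m" using min q by (auto simp: le_fun_def)
    then show ?thesis using q(3) sublinear_minus_ge[OF m(1), of y] by simp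
  qed
  have "linear m"
  proof (rule linearI)
    fix x y
    have "m (x + y) \<le> m x + m y" using m(1) unfolding sublinear_def by blast
    moreover have "m (- x + - y) \<le> m (- x) + m (- y)" using m(1) unfolding sublinear_def by blast
    moreover have "m (- x + - y) = - m (x + y)" using odd[of "x + y"] by (simp add: add.commute)
    ultimately show "m (x + y) = m x + m y" using odd[of x] odd[of y] by simp
  next
    fix r :: real and x
    show "m (r *\<^sub>R x) = r *\<^sub>R m x"
    proof (cases "r \<ge> 0")
      case True then show ?thesis using sublinear_scale[OF m(1)] by simp
    next
      case False
      then have "m ((-r) *\<^sub>R x) = (-r) * m x" using sublinear_scale[OF m(1), of "-r" x] by simp
      then show ?thesis using odd[of "r *\<^sub>R x"] by simp
    qed
  qed
  then show ?thesis using m by blast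
qed

text \<open>The norm is pushed down along the vectors \<open>x - a\<close>, whose norms are at least
  \<open>e\<close>. A linear functional under the result has dual norm at most one and still
  separates by the full distance, so distances to convex sets can be read off from support
  functions.\<close>

lemma dual_separation:
  fixes x :: "'b::real_normed_vector"
  assumes C: "convex C" "C \<noteq> {}" and d: "\<And>a. a \<in> C \<Longrightarrow> e \<le> dist x a"
  shows "\<exists>f. bounded_linear f \<and> (\<forall>y. \<bar>f y\<bar> \<le> norm y) \<and> (\<forall>a\<in>C. f a + e \<le> f x)"
proof -
  have "sublinear (norm :: 'b \<Rightarrow> real)" unfolding sublinear_def by (auto simp: norm_triangle_ineq)
  moreover have "convex ((\<lambda>a. x - a) ` C)"
    using convex_affinity[OF C(1), of x "- 1"] by (simp add: image_image)
  moreover have "e \<le> norm c" if "c \<in> (\<lambda>a. x - a) ` C" for c using that d by (auto simp: dist_norm)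
  ultimately obtain q where q: "sublinear q" "\<forall>y. q y \<le> norm y" "\<forall>c\<in>(\<lambda>a. x - a) ` C. q (- c) \<le> - e"
    using sublinear_push_down[of norm "(\<lambda>a. x - a) ` C" e] C(2) by auto
  obtain f where f: "linear f" "\<forall>x. f x \<le> q x" using sublinear_dominates_linear[OF q(1)] by blast
  have le: "f y \<le> norm y" for y using f q by (meson order_trans)
  have ab: "\<bar>f y\<bar> \<le> norm y" for y
    using le[of y] le[of "- y"] linear_neg[OF f(1), of y] by (simp add: abs_le_iff)
  have "bounded_linear f"
    using f(1) ab by (intro bounded_linear_intro[where K = 1]) (auto simp: linear_add linear_scale)
  moreover have "f a + e \<le> f x" if "a \<in> C" for a
  proof -
    have "f (- (x - a)) \<le> - e" using f q(3) that by (meson imageI order_trans)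
    then show ?thesis using linear_diff[OF f(1), of a x] by simp
  qed
  ultimately show ?thesis using ab by blast
qed

section \<open>Uniqueness of joint characteristic functions\<close>

text \<open>A bounded nonnegative weight divided by its mass is a probability density, so Levy's
  uniqueness theorem applies to the reweighted laws. The weights will carry the information about
  the other coordinates of a vector.\<close>

lemma weighted_char_unique:
  fixes Y :: "'a \<Rightarrow> real" and Z :: "'c \<Rightarrow> real"
  assumes M: "prob_space M" and N: "prob_space N"
    and Y[measurable]: "Y \<in> borel_measurable M" and Z[measurable]: "Z \<in> borel_measurable N"
    and g[measurable]: "g \<in> borel_measurable M" and h[measurable]: "h \<in> borel_measurable N"
    and gb: "\<And>\<omega>. 0 \<le> g \<omega>" "\<And>\<omega>. g \<omega> \<le> G" and hb: "\<And>\<omega>. 0 \<le> h \<omega>" "\<And>\<omega>. h \<omega> \<le> H"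
    and eq: "\<And>t. (CLINT \<omega>|M. of_real (g \<omega>) * iexp (t * Y \<omega>)) = (CLINT \<omega>|N. of_real (h \<omega>) * iexp (t * Z \<omega>))"
    and B[measurable]: "B \<in> sets borel"
  shows "(LINT \<omega>|M. g \<omega> * indicator B (Y \<omega>)) = (LINT \<omega>|N. h \<omega> * indicator B (Z \<omega>))"
proof -
  interpret M: prob_space M by (rule M)
  interpret N: prob_space N by (rule N)
  have ig: "integrable M g" by (rule M.integrable_const_bound[of _ G]) (use gb in auto)
  have ih: "integrable N h" by (rule N.integrable_const_bound[of _ H]) (use hb in auto)
  define m where "m = (LINT \<omega>|M. g \<omega>)"
  \<comment> \<open>The transform at \<open>t = 0\<close> is the mass, hence both weights have the
    same normalising constant.\<close>
  have m2: "m = (LINT \<omega>|N. h \<omega>)"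
    using eq[of 0] unfolding m_def by (simp del: of_real_eq_iff flip: of_real_eq_iff[where 'a = complex])
  have m0: "m \<ge> 0" unfolding m_def by (rule integral_nonneg_AE) (use gb in auto)
  show ?thesis
  proof (cases "m = 0")
    case True
    have "AE \<omega> in M. g \<omega> = 0" using integral_nonneg_eq_0_iff_AE[OF ig] gb True unfolding m_def by auto
    then have 1: "(LINT \<omega>|M. g \<omega> * indicator B (Y \<omega>)) = 0" by (intro integral_eq_zero_AE) auto
    have "AE \<omega> in N. h \<omega> = 0" using integral_nonneg_eq_0_iff_AE[OF ih] hb True unfolding m2 by auto
    then have 2: "(LINT \<omega>|N. h \<omega> * indicator B (Z \<omega>)) = 0" by (intro integral_eq_zero_AE) auto
    show ?thesis using 1 2 by simp
  next
    case False
    then have m: "m > 0" using m0 by simp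
    define M' where "M' = density M (\<lambda>\<omega>. ennreal (g \<omega> / m))"
    define N' where "N' = density N (\<lambda>\<omega>. ennreal (h \<omega> / m))"
    have sets'[measurable_cong]: "sets M' = sets M" "sets N' = sets N" by (auto simp: M'_def N'_def)
    have M': "prob_space M'"
    proof
      have "emeasure M' (space M') = (\<integral>\<^sup>+\<omega>. ennreal (g \<omega> / m) \<partial>M)"
        by (auto simp: M'_def emeasure_density intro!: nn_integral_cong)
      also have "\<dots> = ennreal (LINT \<omega>|M. g \<omega> / m)"
        by (rule nn_integral_eq_integral) (use ig gb m in auto)
      also have "\<dots> = 1" using m by (simp add: m_def)
      finally show "emeasure M' (space M') = 1" .
    qed
    have N': "prob_space N'"
    proof
      have "emeasure N' (space N') = (\<integral>\<^sup>+\<omega>. ennreal (h \<omega> / m) \<partial>N)"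
        by (auto simp: N'_def emeasure_density intro!: nn_integral_cong)
      also have "\<dots> = ennreal (LINT \<omega>|N. h \<omega> / m)"
        by (rule nn_integral_eq_integral) (use ih hb m in auto)
      also have "\<dots> = 1" using m by (simp add: m2)
      finally show "emeasure N' (space N') = 1" .
    qed
    interpret M': prob_space M' by (rule M')
    interpret N': prob_space N' by (rule N')
    have YM': "Y \<in> borel_measurable M'" and ZN': "Z \<in> borel_measurable N'" by measurable
    have rd: "real_distribution (distr M' borel Y)" "real_distribution (distr N' borel Z)"
      using M'.prob_space_distr[OF YM'] N'.prob_space_distr[OF ZN']
      by (auto simp: real_distribution_def real_distribution_axioms_def)
    have "char (distr M' borel Y) t = char (distr N' borel Z) t" for t
    proof -
      have "char (distr M' borel Y) t = (CLINT \<omega>|M'. iexp (t * Y \<omega>))"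
        unfolding char_def by (rule integral_distr) measurable
      also have "\<dots> = (CLINT \<omega>|M. (g \<omega> / m) *\<^sub>R iexp (t * Y \<omega>))"
        unfolding M'_def by (rule integral_density) (use gb m in auto)
      also have "\<dots> = (CLINT \<omega>|M. (1 / m) *\<^sub>R (of_real (g \<omega>) * iexp (t * Y \<omega>)))"
        by (intro Bochner_Integration.integral_cong refl) (simp add: scaleR_conv_of_real)
      also have "\<dots> = (1 / m) *\<^sub>R (CLINT \<omega>|M. of_real (g \<omega>) * iexp (t * Y \<omega>))"
        by simp
      also have "\<dots> = (1 / m) *\<^sub>R (CLINT \<omega>|N. of_real (h \<omega>) * iexp (t * Z \<omega>))" unfolding eq ..
      also have "\<dots> = (CLINT \<omega>|N. (1 / m) *\<^sub>R (of_real (h \<omega>) * iexp (t * Z \<omega>)))" by simp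
      also have "\<dots> = (CLINT \<omega>|N. (h \<omega> / m) *\<^sub>R iexp (t * Z \<omega>))"
        by (intro Bochner_Integration.integral_cong refl) (simp add: scaleR_conv_of_real)
      also have "\<dots> = (CLINT \<omega>|N'. iexp (t * Z \<omega>))"
        unfolding N'_def by (rule integral_density[symmetric]) (use hb m in auto)
      also have "\<dots> = char (distr N' borel Z) t"
        unfolding char_def by (rule integral_distr[symmetric]) measurable
      finally show ?thesis .
    qed
    then have D: "distr M' borel Y = distr N' borel Z" using Levy_uniqueness[OF rd] by blast
    have "(LINT x|distr M' borel Y. indicator B x :: real) = (LINT \<omega>|M'. indicator B (Y \<omega>))"
      by (rule integral_distr) measurable
    also have "\<dots> = (LINT \<omega>|M. (g \<omega> / m) *\<^sub>R indicator B (Y \<omega>))"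
      unfolding M'_def by (rule integral_density) (use gb m in auto)
    finally have 1: "(LINT x|distr M' borel Y. indicator B x :: real) = (LINT \<omega>|M. g \<omega> * indicator B (Y \<omega>)) / m"
      by simp
    have "(LINT x|distr N' borel Z. indicator B x :: real) = (LINT \<omega>|N'. indicator B (Z \<omega>))"
      by (rule integral_distr) measurable
    also have "\<dots> = (LINT \<omega>|N. (h \<omega> / m) *\<^sub>R indicator B (Z \<omega>))"
      unfolding N'_def by (rule integral_density) (use hb m in auto)
    finally have 2: "(LINT x|distr N' borel Z. indicator B x :: real) = (LINT \<omega>|N. h \<omega> * indicator B (Z \<omega>)) / m"
      by simp
    show ?thesis using 1 2 D m by simp
  qed
qed

text \<open>Multiplication by \<open>1 + cos S\<close> or \<open>1 + sin S\<close> only adds terms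
  with phase shifted by \<open>S\<close> and \<open>- S\<close>. Equality of transforms for all
  phases therefore survives the insertion of these nonnegative weights.\<close>

lemma (in prob_space) weighted_iexp_trig:
  fixes g S Y :: "'a \<Rightarrow> real"
  assumes [measurable]: "g \<in> borel_measurable M" "S \<in> borel_measurable M" "Y \<in> borel_measurable M"
    and g: "\<And>\<omega>. \<bar>g \<omega>\<bar> \<le> G"
  shows "(CLINT \<omega>|M. of_real (g \<omega> * (1 + cos (S \<omega>))) * iexp (Y \<omega>))
      = (CLINT \<omega>|M. of_real (g \<omega>) * iexp (Y \<omega>)) + ((CLINT \<omega>|M. of_real (g \<omega>) * iexp (Y \<omega> + S \<omega>)) + (CLINT \<omega>|M. of_real (g \<omega>) * iexp (Y \<omega> - S \<omega>))) / 2" (is ?cos)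
    and "(CLINT \<omega>|M. of_real (g \<omega> * (1 + sin (S \<omega>))) * iexp (Y \<omega>))
      = (CLINT \<omega>|M. of_real (g \<omega>) * iexp (Y \<omega>)) + ((CLINT \<omega>|M. of_real (g \<omega>) * iexp (Y \<omega> + S \<omega>)) - (CLINT \<omega>|M. of_real (g \<omega>) * iexp (Y \<omega> - S \<omega>))) / (2 * \<i>)" (is ?sin)
proof -
  have e: "iexp y * complex_of_real (cos s) = (iexp (y + s) + iexp (y - s)) / 2"
          "iexp y * complex_of_real (sin s) = (iexp (y + s) - iexp (y - s)) / (2 * \<i>)" for y s :: real
    unfolding cis_conv_exp[symmetric]
    by (auto simp: complex_eq_iff cos_add cos_diff sin_add sin_diff Re_divide Im_divide power2_eq_square field_simps)
  have e1: "complex_of_real (a * (1 + cos s)) * iexp y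
        = of_real a * iexp y + (of_real a * iexp (y + s) + of_real a * iexp (y - s)) / 2" for a y s :: real
  proof -
    have "complex_of_real (a * (1 + cos s)) * iexp y = of_real a * iexp y + of_real a * (iexp y * of_real (cos s))"
      by (simp add: algebra_simps)
    then show ?thesis unfolding e(1) by (simp add: distrib_left)
  qed
  have e2: "complex_of_real (a * (1 + sin s)) * iexp y
        = of_real a * iexp y + (of_real a * iexp (y + s) - of_real a * iexp (y - s)) / (2 * \<i>)" for a y s :: real
  proof -
    have "complex_of_real (a * (1 + sin s)) * iexp y = of_real a * iexp y + of_real a * (iexp y * of_real (sin s))"
      by (simp add: algebra_simps)
    then show ?thesis unfolding e(2) by (simp add: right_diff_distrib)
  qed
  have i: "integrable M (\<lambda>\<omega>. complex_of_real (g \<omega>) * iexp (f \<omega>))" if [measurable]: "f \<in> borel_measurable M" for f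
    by (rule integrable_const_bound[of _ G]) (use g in \<open>auto simp: norm_mult\<close>)
  have lin: "(CLINT \<omega>|M. a \<omega> + (b \<omega> + c \<omega>) / d) = (CLINT \<omega>|M. a \<omega>) + ((CLINT \<omega>|M. b \<omega>) + (CLINT \<omega>|M. c \<omega>)) / d"
      "(CLINT \<omega>|M. a \<omega> + (b \<omega> - c \<omega>) / d) = (CLINT \<omega>|M. a \<omega>) + ((CLINT \<omega>|M. b \<omega>) - (CLINT \<omega>|M. c \<omega>)) / d"
    if "integrable M a" "integrable M b" "integrable M c" for a b c :: "'a \<Rightarrow> complex" and d
    using that by simp_all
  show ?cos unfolding e1 by (intro lin(1) i) measurable
  show ?sin unfolding e2 by (intro lin(2) i) measurable
qed

text \<open>The way back: a complex phase is recovered from the masses of the nonnegative weights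
  \<open>g\<close>, \<open>g * (1 + cos S)\<close> and \<open>g * (1 + sin S)\<close>, each
  accessible to the one-dimensional theorem.\<close>

lemma (in prob_space) weighted_iexp_decompose:
  fixes g S :: "'a \<Rightarrow> real"
  assumes [measurable]: "g \<in> borel_measurable M" "S \<in> borel_measurable M" and g: "\<And>\<omega>. \<bar>g \<omega>\<bar> \<le> G"
  shows "(CLINT \<omega>|M. of_real (g \<omega>) * iexp (S \<omega>))
    = of_real ((LINT \<omega>|M. g \<omega> * (1 + cos (S \<omega>))) - (LINT \<omega>|M. g \<omega>))
      + \<i> * of_real ((LINT \<omega>|M. g \<omega> * (1 + sin (S \<omega>))) - (LINT \<omega>|M. g \<omega>))"
proof -
  have i: "integrable M (\<lambda>\<omega>. g \<omega> * f \<omega>)" if [measurable]: "f \<in> borel_measurable M" and f: "\<And>\<omega>. \<bar>f \<omega>\<bar> \<le> 1" for f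
  proof (rule integrable_const_bound[of _ "G * 1"])
    have "\<bar>g \<omega>\<bar> * \<bar>f \<omega>\<bar> \<le> G * 1" for \<omega>
      using g f order_trans[OF abs_ge_zero g] by (intro mult_mono) auto
    then show "AE \<omega> in M. norm (g \<omega> * f \<omega>) \<le> G * 1" by (simp add: abs_mult)
  qed measurable
  have ig: "integrable M g" using i[of "\<lambda>_. 1"] by simp
  have ic: "integrable M (\<lambda>\<omega>. g \<omega> * cos (S \<omega>))" and isn: "integrable M (\<lambda>\<omega>. g \<omega> * sin (S \<omega>))"
    by (intro i; simp)+
  have "(CLINT \<omega>|M. of_real (g \<omega>) * iexp (S \<omega>))
      = (CLINT \<omega>|M. of_real (g \<omega> * cos (S \<omega>)) + \<i> * of_real (g \<omega> * sin (S \<omega>)))"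
    by (intro Bochner_Integration.integral_cong refl) (simp add: cis_conv_exp[symmetric] complex_eq_iff)
  also have "\<dots> = of_real (LINT \<omega>|M. g \<omega> * cos (S \<omega>)) + \<i> * of_real (LINT \<omega>|M. g \<omega> * sin (S \<omega>))"
    using ic isn by (subst Bochner_Integration.integral_add) (auto intro!: integrable_of_real integrable_mult_right simp del: of_real_mult)
  finally show ?thesis using ig ic isn by (simp add: distrib_left)
qed

text \<open>The weights \<open>1 + cos S\<close> and \<open>1 + sin S\<close> are nonnegative, so the one-dimensional
  uniqueness theorem applies to them one coordinate at a time.\<close>

lemma weighted_joint_char_unique:
  fixes Y :: "'i \<Rightarrow> 'a \<Rightarrow> real" and Z :: "'i \<Rightarrow> 'c \<Rightarrow> real"
  assumes fin: "finite I" and M: "prob_space M" and N: "prob_space N"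
    and Y: "\<And>i. i \<in> I \<Longrightarrow> Y i \<in> borel_measurable M" and Z: "\<And>i. i \<in> I \<Longrightarrow> Z i \<in> borel_measurable N"
    and g[measurable]: "g \<in> borel_measurable M" and h[measurable]: "h \<in> borel_measurable N"
    and gb: "\<And>\<omega>. 0 \<le> g \<omega>" "\<And>\<omega>. g \<omega> \<le> G" and hb: "\<And>\<omega>. 0 \<le> h \<omega>" "\<And>\<omega>. h \<omega> \<le> H"
    and eq: "\<And>c. (CLINT \<omega>|M. of_real (g \<omega>) * iexp (\<Sum>i\<in>I. c i * Y i \<omega>))
               = (CLINT \<omega>|N. of_real (h \<omega>) * iexp (\<Sum>i\<in>I. c i * Z i \<omega>))"
    and B: "\<And>i. i \<in> I \<Longrightarrow> B i \<in> sets borel"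
  shows "(LINT \<omega>|M. g \<omega> * (\<Prod>i\<in>I. indicator (B i) (Y i \<omega>)))
       = (LINT \<omega>|N. h \<omega> * (\<Prod>i\<in>I. indicator (B i) (Z i \<omega>)))"
  using fin Y Z g h gb hb eq B
proof (induction I arbitrary: g h rule: finite_induct)
  case empty
  have "complex_of_real (LINT \<omega>|M. g \<omega>) = of_real (LINT \<omega>|N. h \<omega>)"
    using empty(9) by (simp del: of_real_eq_iff)
  then show ?case by simp
next
  case (insert j I)
  interpret M: prob_space M by (rule M)
  interpret N: prob_space N by (rule N)
  note [measurable] = insert.prems(3,4)
  have Yj[measurable]: "Y j \<in> borel_measurable M" and Zj[measurable]: "Z j \<in> borel_measurable N"
    and Bj[measurable]: "B j \<in> sets borel" using insert.prems by auto
  have YI[measurable]: "\<And>i. i \<in> I \<Longrightarrow> Y i \<in> borel_measurable M"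
    and ZI[measurable]: "\<And>i. i \<in> I \<Longrightarrow> Z i \<in> borel_measurable N" using insert.prems by auto
  have gG: "\<bar>g \<omega>\<bar> \<le> G" for \<omega> using insert.prems(5,6)[of \<omega>] by simp
  have hH: "\<bar>h \<omega>\<bar> \<le> H" for \<omega> using insert.prems(7,8)[of \<omega>] by simp
  have key: "(CLINT \<omega>|M. of_real (g \<omega>) * iexp (t * Y j \<omega> + (\<Sum>i\<in>I. c i * Y i \<omega>)))
           = (CLINT \<omega>|N. of_real (h \<omega>) * iexp (t * Z j \<omega> + (\<Sum>i\<in>I. c i * Z i \<omega>)))" for t c
  proof -
    have *: "(\<Sum>i\<in>insert j I. (if i = j then t else c i) * f i) = t * f j + (\<Sum>i\<in>I. c i * f i)" for f :: "'i \<Rightarrow> real"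
    proof -
      have "(\<Sum>i\<in>I. (if i = j then t else c i) * f i) = (\<Sum>i\<in>I. c i * f i)"
        by (rule sum.cong) (use insert.hyps in auto)
      then show ?thesis using insert.hyps by simp
    qed
    show ?thesis using insert.prems(9)[of "\<lambda>i. if i = j then t else c i"] unfolding * .
  qed
  \<comment> \<open>The induction hypothesis requires the transforms over \<open>I\<close> to agree
    after the indicator of coordinate \<open>j\<close> has moved into the weight. \<open>S\<close>
    and \<open>R\<close> collect the remaining phase on the two spaces.\<close>
  have step: "(CLINT \<omega>|M. of_real (g \<omega> * indicator (B j) (Y j \<omega>)) * iexp (\<Sum>i\<in>I. c i * Y i \<omega>))
            = (CLINT \<omega>|N. of_real (h \<omega> * indicator (B j) (Z j \<omega>)) * iexp (\<Sum>i\<in>I. c i * Z i \<omega>))" for c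
  proof -
    define S where "S \<omega> = (\<Sum>i\<in>I. c i * Y i \<omega>)" for \<omega>
    define R where "R \<omega> = (\<Sum>i\<in>I. c i * Z i \<omega>)" for \<omega>
    have [measurable]: "S \<in> borel_measurable M" "R \<in> borel_measurable N"
      unfolding S_def R_def by measurable
    have k0: "(CLINT \<omega>|M. of_real (g \<omega>) * iexp (t * Y j \<omega>)) = (CLINT \<omega>|N. of_real (h \<omega>) * iexp (t * Z j \<omega>))" for t
      using key[of t "\<lambda>_. 0"] by simp
    have kp: "(CLINT \<omega>|M. of_real (g \<omega>) * iexp (t * Y j \<omega> + S \<omega>)) = (CLINT \<omega>|N. of_real (h \<omega>) * iexp (t * Z j \<omega> + R \<omega>))" for t
      using key[of t c] unfolding S_def R_def .
    \<comment> \<open>Negating the coefficients on \<open>I\<close> alone reverses that part of the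
      phase and keeps the part of coordinate \<open>j\<close>.\<close>
    have km: "(CLINT \<omega>|M. of_real (g \<omega>) * iexp (t * Y j \<omega> - S \<omega>)) = (CLINT \<omega>|N. of_real (h \<omega>) * iexp (t * Z j \<omega> - R \<omega>))" for t
      using key[of t "\<lambda>i. - c i"] unfolding S_def R_def by (simp add: sum_negf)
    have C: "(LINT \<omega>|M. (g \<omega> * (1 + cos (S \<omega>))) * indicator (B j) (Y j \<omega>))
           = (LINT \<omega>|N. (h \<omega> * (1 + cos (R \<omega>))) * indicator (B j) (Z j \<omega>))"
    proof (rule weighted_char_unique[OF M N])
      show "(CLINT \<omega>|M. of_real (g \<omega> * (1 + cos (S \<omega>))) * iexp (t * Y j \<omega>))
          = (CLINT \<omega>|N. of_real (h \<omega> * (1 + cos (R \<omega>))) * iexp (t * Z j \<omega>))" for t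
        by (subst M.weighted_iexp_trig(1)[OF _ _ _ gG], measurable, subst N.weighted_iexp_trig(1)[OF _ _ _ hH], measurable)
           (simp only: k0 kp km)
    next
      show "0 \<le> g \<omega> * (1 + cos (S \<omega>))" for \<omega> using insert.prems(5)[of \<omega>] cos_ge_minus_one[of "S \<omega>"] by (intro mult_nonneg_nonneg) linarith+
      show "g \<omega> * (1 + cos (S \<omega>)) \<le> G * 2" for \<omega>
        using insert.prems(5,6)[of \<omega>] cos_ge_minus_one[of "S \<omega>"] cos_le_one[of "S \<omega>"] by (intro mult_mono) linarith+
      show "0 \<le> h \<omega> * (1 + cos (R \<omega>))" for \<omega> using insert.prems(7)[of \<omega>] cos_ge_minus_one[of "R \<omega>"] by (intro mult_nonneg_nonneg) linarith+
      show "h \<omega> * (1 + cos (R \<omega>)) \<le> H * 2" for \<omega>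
        using insert.prems(7,8)[of \<omega>] cos_ge_minus_one[of "R \<omega>"] cos_le_one[of "R \<omega>"] by (intro mult_mono) linarith+
    qed measurable
    have Sn: "(LINT \<omega>|M. (g \<omega> * (1 + sin (S \<omega>))) * indicator (B j) (Y j \<omega>))
           = (LINT \<omega>|N. (h \<omega> * (1 + sin (R \<omega>))) * indicator (B j) (Z j \<omega>))"
    proof (rule weighted_char_unique[OF M N])
      show "(CLINT \<omega>|M. of_real (g \<omega> * (1 + sin (S \<omega>))) * iexp (t * Y j \<omega>))
          = (CLINT \<omega>|N. of_real (h \<omega> * (1 + sin (R \<omega>))) * iexp (t * Z j \<omega>))" for t
        by (subst M.weighted_iexp_trig(2)[OF _ _ _ gG], measurable, subst N.weighted_iexp_trig(2)[OF _ _ _ hH], measurable)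
           (simp only: k0 kp km)
    next
      show "0 \<le> g \<omega> * (1 + sin (S \<omega>))" for \<omega> using insert.prems(5)[of \<omega>] sin_ge_minus_one[of "S \<omega>"] by (intro mult_nonneg_nonneg) linarith+
      show "g \<omega> * (1 + sin (S \<omega>)) \<le> G * 2" for \<omega>
        using insert.prems(5,6)[of \<omega>] sin_ge_minus_one[of "S \<omega>"] sin_le_one[of "S \<omega>"] by (intro mult_mono) linarith+
      show "0 \<le> h \<omega> * (1 + sin (R \<omega>))" for \<omega> using insert.prems(7)[of \<omega>] sin_ge_minus_one[of "R \<omega>"] by (intro mult_nonneg_nonneg) linarith+
      show "h \<omega> * (1 + sin (R \<omega>)) \<le> H * 2" for \<omega>
        using insert.prems(7,8)[of \<omega>] sin_ge_minus_one[of "R \<omega>"] sin_le_one[of "R \<omega>"] by (intro mult_mono) linarith+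
    qed measurable
    have O: "(LINT \<omega>|M. g \<omega> * indicator (B j) (Y j \<omega>)) = (LINT \<omega>|N. h \<omega> * indicator (B j) (Z j \<omega>))"
      by (rule weighted_char_unique[OF M N _ _ _ _ _ _ _ _ k0]) (use insert.prems(5-8) in auto)
    have gI: "\<bar>g \<omega> * indicator (B j) (Y j \<omega>)\<bar> \<le> G" for \<omega>
      using gG[of \<omega>] insert.prems(5)[of \<omega>] by (auto split: split_indicator)
    have hI: "\<bar>h \<omega> * indicator (B j) (Z j \<omega>)\<bar> \<le> H" for \<omega>
      using hH[of \<omega>] insert.prems(7)[of \<omega>] by (auto split: split_indicator)
    have *: "g \<omega> * indicator (B j) (Y j \<omega>) * x = g \<omega> * x * indicator (B j) (Y j \<omega>)"
        "h \<omega>' * indicator (B j) (Z j \<omega>') * x = h \<omega>' * x * indicator (B j) (Z j \<omega>')" for \<omega> \<omega>' x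
      by simp_all
    have "(CLINT \<omega>|M. of_real (g \<omega> * indicator (B j) (Y j \<omega>)) * iexp (S \<omega>))
        = (CLINT \<omega>|N. of_real (h \<omega> * indicator (B j) (Z j \<omega>)) * iexp (R \<omega>))"
      by (subst M.weighted_iexp_decompose[OF _ _ gI], measurable, subst N.weighted_iexp_decompose[OF _ _ hI], measurable)
         (simp only: * C Sn O)
    then show ?thesis unfolding S_def R_def .
  qed
  have "(LINT \<omega>|M. (g \<omega> * indicator (B j) (Y j \<omega>)) * (\<Prod>i\<in>I. indicator (B i) (Y i \<omega>)))
       = (LINT \<omega>|N. (h \<omega> * indicator (B j) (Z j \<omega>)) * (\<Prod>i\<in>I. indicator (B i) (Z i \<omega>)))"
  proof (rule insert.IH)
    show "g \<omega> * indicator (B j) (Y j \<omega>) \<le> G" for \<omega>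
      using gG[of \<omega>] insert.prems(5)[of \<omega>] by (auto split: split_indicator)
    show "h \<omega> * indicator (B j) (Z j \<omega>) \<le> H" for \<omega>
      using hH[of \<omega>] insert.prems(7)[of \<omega>] by (auto split: split_indicator)
    show "B i \<in> sets borel" if "i \<in> I" for i using that insert.prems(10) by auto
    show "0 \<le> g \<omega> * indicator (B j) (Y j \<omega>)" for \<omega> using insert.prems(5) by simp
    show "0 \<le> h \<omega> * indicator (B j) (Z j \<omega>)" for \<omega> using insert.prems(7) by simp
  qed (use step YI ZI in auto)
  then show ?case using insert.hyps by (simp add: mult.assoc)
qed

lemma (in prob_space) prob_PiE_vimage:
  assumes fin: "finite I"
  shows "prob ((\<lambda>\<omega>. \<lambda>i\<in>I. Y i \<omega>) -` Pi\<^sub>E I A \<inter> space M) = (LINT \<omega>|M. 1 * (\<Prod>i\<in>I. indicator (A i) (Y i \<omega>)))"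
proof -
  have "(LINT \<omega>|M. 1 * (\<Prod>i\<in>I. indicator (A i) (Y i \<omega>)))
      = (LINT \<omega>|M. indicator ((\<lambda>\<omega>. \<lambda>i\<in>I. Y i \<omega>) -` Pi\<^sub>E I A \<inter> space M) \<omega> :: real)"
    by (intro Bochner_Integration.integral_cong refl)
       (use fin in \<open>auto simp: indicator_def prod_eq_1_iff restrict_PiE_iff prod_zero_iff intro!: prod.neutral\<close>)
  then show ?thesis by simp
qed

text \<open>With weight one the probabilities of all rectangles coincide, and rectangles generate
  the product sigma-algebra.\<close>

lemma joint_char_unique:
  fixes Y :: "'i \<Rightarrow> 'a \<Rightarrow> real" and Z :: "'i \<Rightarrow> 'c \<Rightarrow> real"
  assumes fin: "finite I" and M: "prob_space M" and N: "prob_space N"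
    and Y[measurable]: "\<And>i. i \<in> I \<Longrightarrow> Y i \<in> borel_measurable M"
    and Z[measurable]: "\<And>i. i \<in> I \<Longrightarrow> Z i \<in> borel_measurable N"
    and eq: "\<And>c. (CLINT \<omega>|M. iexp (\<Sum>i\<in>I. c i * Y i \<omega>)) = (CLINT \<omega>|N. iexp (\<Sum>i\<in>I. c i * Z i \<omega>))"
  shows "distr M (PiM I (\<lambda>_. borel)) (\<lambda>\<omega>. \<lambda>i\<in>I. Y i \<omega>) = distr N (PiM I (\<lambda>_. borel)) (\<lambda>\<omega>. \<lambda>i\<in>I. Z i \<omega>)"
proof -
  interpret M: prob_space M by (rule M)
  interpret N: prob_space N by (rule N)
  interpret DM: prob_space "distr M (PiM I (\<lambda>_. borel)) (\<lambda>\<omega>. \<lambda>i\<in>I. Y i \<omega>)"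
    by (rule M.prob_space_distr) measurable
  show ?thesis
  proof (rule measure_eqI_PiM_finite[OF fin, where A = "\<lambda>_. space (PiM I (\<lambda>_. borel))"])
    fix A assume A: "\<And>i. i \<in> I \<Longrightarrow> A i \<in> sets (borel :: real measure)"
    have "(LINT \<omega>|M. 1 * (\<Prod>i\<in>I. indicator (A i) (Y i \<omega>))) = (LINT \<omega>|N. 1 * (\<Prod>i\<in>I. indicator (A i) (Z i \<omega>)) :: real)"
      by (rule weighted_joint_char_unique[OF fin M N Y Z, where G = 1 and H = 1]) (use eq A in auto)
    moreover have "Pi\<^sub>E I A \<in> sets (PiM I (\<lambda>_. borel))"
      by (rule sets_PiM_I_finite) (use A fin in auto)
    ultimately show "emeasure (distr M (PiM I (\<lambda>_. borel)) (\<lambda>\<omega>. \<lambda>i\<in>I. Y i \<omega>)) (Pi\<^sub>E I A)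
        = emeasure (distr N (PiM I (\<lambda>_. borel)) (\<lambda>\<omega>. \<lambda>i\<in>I. Z i \<omega>)) (Pi\<^sub>E I A)"
      using M.prob_PiE_vimage[OF fin, of Y A] N.prob_PiE_vimage[OF fin, of Z A]
      by (simp add: emeasure_distr M.emeasure_eq_measure N.emeasure_eq_measure)
  next
    show "range (\<lambda>_::nat. space (PiM I (\<lambda>_. borel))) \<subseteq> prod_algebra I (\<lambda>_. borel :: real measure)"
      using fin by (auto simp: space_PiM intro!: prod_algebraI_finite)
  qed (auto)
qed

section \<open>Centered Gaussian variables\<close>

context prob_space
begin

lemma centered_gaussian_cases:
  assumes "centered_gaussian_rv M Y"
  obtains "AE \<omega> in M. Y \<omega> = 0"
  | \<sigma> where "\<sigma> > 0" "distributed M lborel Y (normal_density 0 \<sigma>)"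
proof -
  have [measurable]: "Y \<in> borel_measurable M" using assms by (simp add: centered_gaussian_rv_def)
  have "AE \<omega> in M. Y \<omega> = 0" if "distr M borel Y = return borel 0"
  proof -
    have "AE x in distr M borel Y. x = 0" unfolding that by (subst AE_return) auto
    then show ?thesis by (subst (asm) AE_distr_iff) auto
  qed
  then show thesis using assms that unfolding centered_gaussian_rv_def by blast
qed

lemma normal_square_integral:
  assumes "\<sigma> > 0" "distributed M lborel Y (normal_density 0 \<sigma>)"
  shows "integrable M (\<lambda>\<omega>. (Y \<omega>)\<^sup>2)" "(\<integral>\<omega>. (Y \<omega>)\<^sup>2 \<partial>M) = \<sigma>\<^sup>2"
proof -
  have "integrable lborel (\<lambda>x. normal_density 0 \<sigma> x * x\<^sup>2)"
    using integrable_normal_moment[of \<sigma> 0 2] assms by simp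
  then show "integrable M (\<lambda>\<omega>. (Y \<omega>)\<^sup>2)"
    using distributed_integrable[OF assms(2), of "\<lambda>x. x\<^sup>2"] by simp
  show "(\<integral>\<omega>. (Y \<omega>)\<^sup>2 \<partial>M) = \<sigma>\<^sup>2"
    using normal_distributed_variance[OF assms] normal_distributed_expectation[OF assms] by simp
qed

lemma gaussian_square_integrable:
  assumes "centered_gaussian_rv M Y" shows "integrable M (\<lambda>\<omega>. (Y \<omega>)\<^sup>2)"
  using assms
proof (cases rule: centered_gaussian_cases)
  case 1
  have [measurable]: "Y \<in> borel_measurable M" using assms by (simp add: centered_gaussian_rv_def)
  show ?thesis by (rule integrable_cong_AE_imp[OF integrable_zero]) (use 1 in auto)
next
  case (2 \<sigma>) then show ?thesis using normal_square_integral by blast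
qed

text \<open>The nonnegative integral lets the formula enter upper bounds without a separate
  integrability argument. The degenerate law is the case of variance zero.\<close>

lemma gaussian_mgf:
  assumes "centered_gaussian_rv M Y"
  shows "(\<integral>\<^sup>+\<omega>. ennreal (exp (a * Y \<omega>)) \<partial>M) = ennreal (exp (a\<^sup>2 * (\<integral>\<omega>. (Y \<omega>)\<^sup>2 \<partial>M) / 2))"
  using assms
proof (cases rule: centered_gaussian_cases)
  case 1
  have [measurable]: "Y \<in> borel_measurable M" using assms by (simp add: centered_gaussian_rv_def)
  have "(\<integral>\<omega>. (Y \<omega>)\<^sup>2 \<partial>M) = 0" by (rule integral_eq_zero_AE) (use 1 in auto)
  moreover have "(\<integral>\<^sup>+\<omega>. ennreal (exp (a * Y \<omega>)) \<partial>M) = (\<integral>\<^sup>+\<omega>. 1 \<partial>M)"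
    by (rule nn_integral_cong_AE) (use 1 in auto)
  ultimately show ?thesis by (simp add: emeasure_space_1)
next
  case (2 \<sigma>)
  \<comment> \<open>Completing the square turns the tilted density into a normal density with mean
    \<open>a * \<sigma>\<^sup>2\<close>.\<close>
  have eq: "normal_density 0 \<sigma> x * exp (a * x) = exp (a\<^sup>2 * \<sigma>\<^sup>2 / 2) * normal_density (a * \<sigma>\<^sup>2) \<sigma> x" for x
  proof -
    have "- x\<^sup>2 / (2 * \<sigma>\<^sup>2) + a * x = a\<^sup>2 * \<sigma>\<^sup>2 / 2 + - (x - a * \<sigma>\<^sup>2)\<^sup>2 / (2 * \<sigma>\<^sup>2)"
      using 2(1) by (simp add: field_simps power2_eq_square)
    then have "exp (- x\<^sup>2 / (2 * \<sigma>\<^sup>2)) * exp (a * x) = exp (a\<^sup>2 * \<sigma>\<^sup>2 / 2) * exp (- (x - a * \<sigma>\<^sup>2)\<^sup>2 / (2 * \<sigma>\<^sup>2))"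
      by (simp only: exp_add[symmetric])
    then show ?thesis by (simp add: normal_density_def)
  qed
  have "(\<integral>\<^sup>+\<omega>. ennreal (exp (a * Y \<omega>)) \<partial>M) = (\<integral>\<^sup>+x. ennreal (normal_density 0 \<sigma> x) * ennreal (exp (a * x)) \<partial>lborel)"
    by (rule distributed_nn_integral[OF 2(2), symmetric]) measurable
  also have "\<dots> = (\<integral>\<^sup>+x. ennreal (exp (a\<^sup>2 * \<sigma>\<^sup>2 / 2)) * ennreal (normal_density (a * \<sigma>\<^sup>2) \<sigma> x) \<partial>lborel)"
    by (intro nn_integral_cong) (simp add: ennreal_mult'[symmetric] eq)
  also have "\<dots> = ennreal (exp (a\<^sup>2 * \<sigma>\<^sup>2 / 2)) * (\<integral>\<^sup>+x. ennreal (normal_density (a * \<sigma>\<^sup>2) \<sigma> x) \<partial>lborel)"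
    by (rule nn_integral_cmult) measurable
  also have "(\<integral>\<^sup>+x. ennreal (normal_density (a * \<sigma>\<^sup>2) \<sigma> x) \<partial>lborel) = 1"
    using 2(1) by (subst nn_integral_eq_integral) auto
  finally show ?thesis using normal_square_integral[OF 2] by simp
qed

lemma gaussian_char:
  assumes "centered_gaussian_rv M Y"
  shows "(CLINT \<omega>|M. iexp (Y \<omega>)) = of_real (exp (- (\<integral>\<omega>. (Y \<omega>)\<^sup>2 \<partial>M) / 2))"
  using assms
proof (cases rule: centered_gaussian_cases)
  case 1
  have [measurable]: "Y \<in> borel_measurable M" using assms by (simp add: centered_gaussian_rv_def)
  have "(\<integral>\<omega>. (Y \<omega>)\<^sup>2 \<partial>M) = 0" by (rule integral_eq_zero_AE) (use 1 in auto)
  moreover have "(CLINT \<omega>|M. iexp (Y \<omega>)) = (CLINT \<omega>|M. 1)"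
    by (rule integral_cong_AE) (use 1 in auto)
  ultimately show ?thesis by (simp add: prob_space)
next
  case (2 \<sigma>)
  have [measurable]: "Y \<in> borel_measurable M" using assms by (simp add: centered_gaussian_rv_def)
  have "distributed M lborel (\<lambda>\<omega>. Y \<omega> / \<sigma>) std_normal_density"
    using normal_standard_normal_convert[OF 2(1), of Y 0] 2(2) by simp
  then have "distr M lborel (\<lambda>\<omega>. Y \<omega> / \<sigma>) = std_normal_distribution"
    by (simp add: distributed_def)
  then have "char (distr M lborel (\<lambda>\<omega>. Y \<omega> / \<sigma>)) \<sigma> = of_real (exp (- \<sigma>\<^sup>2 / 2))"
    by (simp add: char_std_normal_distribution)
  also have "char (distr M lborel (\<lambda>\<omega>. Y \<omega> / \<sigma>)) \<sigma> = (CLINT \<omega>|M. iexp (\<sigma> * (Y \<omega> / \<sigma>)))"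
    unfolding char_def by (rule integral_distr) measurable
  finally show ?thesis using normal_square_integral[OF 2] 2(1) by simp
qed

lemma gaussian_tail:
  assumes "centered_gaussian_rv M Y" and s: "(\<integral>\<omega>. (Y \<omega>)\<^sup>2 \<partial>M) \<le> s" "s > 0" and u: "u \<ge> 0"
  shows "prob {\<omega>\<in>space M. Y \<omega> > u} \<le> exp (- u\<^sup>2 / (2 * s))"
proof -
  have [measurable]: "Y \<in> borel_measurable M" using assms by (simp add: centered_gaussian_rv_def)
  \<comment> \<open>Minimises \<open>- a * u + a\<^sup>2 * s / 2\<close>, the exponent of the
    Chernoff bound.\<close>
  define a where "a = u / s"
  have a: "a \<ge> 0" using u s by (simp add: a_def)
  have "emeasure M {\<omega>\<in>space M. Y \<omega> > u} = (\<integral>\<^sup>+\<omega>. indicator {\<omega>\<in>space M. Y \<omega> > u} \<omega> \<partial>M)" by simp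
  also have "\<dots> \<le> (\<integral>\<^sup>+\<omega>. ennreal (exp (- a * u)) * ennreal (exp (a * Y \<omega>)) \<partial>M)"
  proof (rule nn_integral_mono)
    fix \<omega>
    have "1 \<le> exp (- a * u) * exp (a * Y \<omega>)" if "Y \<omega> > u"
    proof -
      have "a * u \<le> a * Y \<omega>" using a that by (intro mult_left_mono) auto
      then show ?thesis unfolding exp_add[symmetric] by simp
    qed
    then show "indicator {\<omega>\<in>space M. Y \<omega> > u} \<omega> \<le> ennreal (exp (- a * u)) * ennreal (exp (a * Y \<omega>))"
      by (auto simp: indicator_def ennreal_mult'[symmetric])
  qed
  also have "\<dots> = ennreal (exp (- a * u)) * (\<integral>\<^sup>+\<omega>. ennreal (exp (a * Y \<omega>)) \<partial>M)"
    by (rule nn_integral_cmult) measurable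
  also have "\<dots> = ennreal (exp (- a * u) * exp (a\<^sup>2 * (\<integral>\<omega>. (Y \<omega>)\<^sup>2 \<partial>M) / 2))"
    unfolding gaussian_mgf[OF assms(1)] by (simp add: ennreal_mult')
  also have "\<dots> \<le> ennreal (exp (- a * u) * exp (a\<^sup>2 * s / 2))"
    by (intro ennreal_leI mult_left_mono) (use s in \<open>auto intro!: mult_left_mono\<close>)
  also have "exp (- a * u) * exp (a\<^sup>2 * s / 2) = exp (- u\<^sup>2 / (2 * s))"
    unfolding exp_add[symmetric] a_def using s by (simp add: field_simps power2_eq_square)
  finally show ?thesis by (simp add: emeasure_eq_measure)
qed

text \<open>On an interval of length one beyond \<open>u\<close> the density is at least its value
  at \<open>u + 1\<close>. The loss against the true tail is roughly a factor
  \<open>exp (- u)\<close>, negligible compared with powers of \<open>n\<close> when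
  \<open>u\<close> is of order \<open>bfun n\<close>.\<close>

lemma gaussian_tail_lower:
  assumes "centered_gaussian_rv M Y" and v: "(\<integral>\<omega>. (Y \<omega>)\<^sup>2 \<partial>M) = 1" and u: "u \<ge> 0"
  shows "exp (- (u + 1)\<^sup>2 / 2) / sqrt (2 * pi) \<le> prob {\<omega>\<in>space M. Y \<omega> > u}"
  using assms(1)
proof (cases rule: centered_gaussian_cases)
  case 1
  then have "(\<integral>\<omega>. (Y \<omega>)\<^sup>2 \<partial>M) = 0" by (intro integral_eq_zero_AE) auto
  then show ?thesis using v by simp
next
  case (2 \<sigma>)
  have "\<sigma> = 1" using normal_square_integral[OF 2] v 2(1) by (simp add: power2_eq_1_iff)
  then have D: "distributed M lborel Y std_normal_density" using 2 by simp
  let ?c = "exp (- (u + 1)\<^sup>2 / 2) / sqrt (2 * pi)"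
  have "ennreal ?c = (\<integral>\<^sup>+x. ennreal ?c * indicator {u<..u+1} x \<partial>lborel)"
    by (subst nn_integral_cmult_indicator) auto
  also have "\<dots> \<le> (\<integral>\<^sup>+x. ennreal (std_normal_density x) * indicator {u<..} x \<partial>lborel)"
  proof (rule nn_integral_mono)
    fix x :: real
    have "?c \<le> std_normal_density x" if "u < x" "x \<le> u + 1"
    proof -
      have "x\<^sup>2 \<le> (u + 1)\<^sup>2" using that u by (intro power_mono) auto
      then show ?thesis by (simp add: std_normal_density_def divide_right_mono)
    qed
    then show "ennreal ?c * indicator {u<..u+1} x \<le> ennreal (std_normal_density x) * indicator {u<..} x"
      by (auto simp: indicator_def intro!: ennreal_leI)
  qed
  also have "\<dots> = emeasure M (Y -` {u<..} \<inter> space M)"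
    by (rule distributed_emeasure[OF D, symmetric]) simp
  also have "Y -` {u<..} \<inter> space M = {\<omega>\<in>space M. Y \<omega> > u}" by auto
  finally show ?thesis by (simp add: emeasure_eq_measure)
qed

text \<open>The density never exceeds \<open>1 / (\<sigma> * sqrt (2 * pi))\<close>, so an interval
  of length two can have mass \<open>1/2\<close> only if \<open>\<sigma>\<close> is at most
  \<open>4 / sqrt (2 * pi)\<close>, which is below \<open>2\<close>.\<close>

lemma gaussian_variance_le:
  assumes "centered_gaussian_rv M Y" and p: "1/2 \<le> prob {\<omega>\<in>space M. \<bar>Y \<omega>\<bar> \<le> 1}"
  shows "(\<integral>\<omega>. (Y \<omega>)\<^sup>2 \<partial>M) \<le> 4"
  using assms(1)
proof (cases rule: centered_gaussian_cases)
  case 1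
  then have "(\<integral>\<omega>. (Y \<omega>)\<^sup>2 \<partial>M) = 0" by (intro integral_eq_zero_AE) auto
  then show ?thesis by simp
next
  case (2 \<sigma>)
  let ?c = "1 / sqrt (2 * pi * \<sigma>\<^sup>2)"
  have "emeasure M {\<omega>\<in>space M. \<bar>Y \<omega>\<bar> \<le> 1} = emeasure M (Y -` {-1..1} \<inter> space M)"
    by (rule arg_cong[where f = "emeasure M"]) auto
  also have "\<dots> = (\<integral>\<^sup>+x. ennreal (normal_density 0 \<sigma> x) * indicator {-1..1} x \<partial>lborel)"
    by (rule distributed_emeasure[OF 2(2)]) simp
  also have "\<dots> \<le> (\<integral>\<^sup>+x. ennreal ?c * indicator {-1..1::real} x \<partial>lborel)"
  proof (rule nn_integral_mono)
    fix x :: real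
    have "normal_density 0 \<sigma> x \<le> ?c * 1"
      unfolding normal_density_def by (intro mult_left_mono) auto
    then show "ennreal (normal_density 0 \<sigma> x) * indicator {-1..1} x \<le> ennreal ?c * indicator {-1..1} x"
      by (auto simp: indicator_def intro!: ennreal_leI)
  qed
  also have "\<dots> = ennreal ?c * 2"
    by (subst nn_integral_cmult_indicator) auto
  also have "\<dots> = ennreal (?c * 2)" by (simp only: ennreal_mult''[of 2 ?c] ennreal_numeral)
  finally have "1/2 \<le> ?c * 2" using p by (simp add: emeasure_eq_measure)
  moreover have "2 * \<sigma> < sqrt (2 * pi * \<sigma>\<^sup>2)"
  proof (rule real_less_rsqrt)
    have "(4 :: real) < 2 * pi" using pi_gt3 by simp
    then have "4 * \<sigma>\<^sup>2 < 2 * pi * \<sigma>\<^sup>2" using 2(1) by (intro mult_strict_right_mono) auto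
    then show "(2 * \<sigma>)\<^sup>2 < 2 * pi * \<sigma>\<^sup>2" by (simp add: power_mult_distrib)
  qed
  ultimately have "\<sigma> \<le> 2" using 2(1) by (simp add: field_simps)
  then have "\<sigma>\<^sup>2 \<le> 2\<^sup>2" using 2(1) by (intro power_mono) auto
  then show ?thesis using normal_square_integral[OF 2] by simp
qed

end

section \<open>Concentration of Gaussian maxima\<close>

text \<open>Linear combinations characterise joint normality and cover degenerate vectors, which
  have no joint density.\<close>

definition jointly_gaussian :: "'a measure \<Rightarrow> 'i set \<Rightarrow> ('i \<Rightarrow> 'a \<Rightarrow> real) \<Rightarrow> bool" where
  "jointly_gaussian M I Y \<longleftrightarrow> (\<forall>c. centered_gaussian_rv M (\<lambda>\<omega>. \<Sum>i\<in>I. c i * Y i \<omega>))"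

lemma jointly_gaussian_component:
  assumes "jointly_gaussian M I Y" "finite I" "i \<in> I"
  shows "centered_gaussian_rv M (Y i)"
proof -
  have "(\<Sum>j\<in>I. (if j = i then 1 else 0) * Y j \<omega>) = Y i \<omega>" for \<omega>
  proof -
    have "(\<Sum>j\<in>I. (if j = i then 1 else 0) * Y j \<omega>) = (\<Sum>j\<in>I. if j = i then Y j \<omega> else 0)"
      by (intro sum.cong) auto
    then show ?thesis using assms by simp
  qed
  moreover have "centered_gaussian_rv M (\<lambda>\<omega>. \<Sum>j\<in>I. (if j = i then 1 else 0) * Y j \<omega>)"
    using assms(1) unfolding jointly_gaussian_def by (rule spec)
  ultimately show ?thesis by simp
qed

text \<open>Jensen's inequality for the exponential, from its tangent at the mean. The increments of
  the rotation are dependent, so the exponential moment of their sum is bounded by the average of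
  the single moments at \<open>J\<close> times the parameter.\<close>

lemma exp_average_le:
  fixes x :: "nat \<Rightarrow> real"
  assumes J: "J > 0"
  shows "exp (\<Sum>j<J. x j) \<le> (\<Sum>j<J. exp (real J * x j)) / J"
proof -
  define m where "m = (\<Sum>j<J. x j)"
  have "exp m * (1 + (J * x j - m)) \<le> exp (J * x j)" for j
  proof -
    have "exp m * (1 + (J * x j - m)) \<le> exp m * exp (J * x j - m)"
      by (intro mult_left_mono exp_ge_add_one_self) auto
    then show ?thesis by (simp add: exp_diff)
  qed
  then have "(\<Sum>j<J. exp m * (1 + (J * x j - m))) \<le> (\<Sum>j<J. exp (J * x j))" by (intro sum_mono)
  also have "(\<Sum>j<J. exp m * (1 + (J * x j - m))) = exp m * J"
  proof -
    have "(\<Sum>j<J. 1 + (J * x j - m)) = J"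
      by (simp add: sum.distrib sum_subtractf sum_distrib_left[symmetric] m_def)
    then show ?thesis by (simp add: sum_distrib_left[symmetric])
  qed
  finally show ?thesis using J by (simp add: m_def field_simps)
qed

text \<open>Convexity of the exponential between \<open>0\<close> and \<open>x\<close>, with
  \<open>1 - a\<close> relaxed to \<open>1\<close>. It shows that for small \<open>a\<close> an
  exponential moment exceeds one by at most a multiple of \<open>a\<close>.\<close>

lemma exp_scale_le:
  fixes a x :: real
  assumes "0 \<le> a" "a \<le> 1" shows "exp (a * x) \<le> 1 + a * exp x"
proof -
  have 1: "exp (a * x) * (1 + (x - a * x)) \<le> exp x"
  proof -
    have "exp (a * x) * (1 + (x - a * x)) \<le> exp (a * x) * exp (x - a * x)"
      by (intro mult_left_mono exp_ge_add_one_self) auto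
    then show ?thesis by (simp add: exp_add[symmetric])
  qed
  have 2: "exp (a * x) * (1 + (0 - a * x)) \<le> 1"
  proof -
    have "exp (a * x) * (1 + (0 - a * x)) \<le> exp (a * x) * exp (0 - a * x)"
      by (intro mult_left_mono exp_ge_add_one_self) auto
    then show ?thesis by (simp add: exp_add[symmetric])
  qed
  have "exp (a * x) = a * (exp (a * x) * (1 + (x - a * x))) + (1 - a) * (exp (a * x) * (1 + (0 - a * x)))"
    by (simp add: algebra_simps)
  also have "\<dots> \<le> a * exp x + (1 - a) * 1"
    by (intro add_mono mult_left_mono 1 2) (use assms in auto)
  finally show ?thesis using assms by simp
qed

lemma one_minus_cos_le: "1 - cos h \<le> h\<^sup>2 / (2::real)"
proof -
  have "1 - cos h = 2 * (sin (h/2))\<^sup>2" using cos_double_sin[of "h/2"] by simp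
  moreover have "(sin (h/2))\<^sup>2 \<le> (h/2)\<^sup>2"
    using abs_sin_x_le_abs_x[of "h/2"] by (simp only: abs_le_square_iff)
  ultimately show ?thesis by (simp add: power_divide)
qed

lemma abs_mult_le_sum_squares: "\<bar>a * b\<bar> \<le> a\<^sup>2 + (b::real)\<^sup>2"
proof -
  have "2 * \<bar>a * b\<bar> \<le> a\<^sup>2 + b\<^sup>2" using sum_squares_bound[of "\<bar>a\<bar>" "\<bar>b\<bar>"] by (simp add: abs_mult)
  then show ?thesis using abs_ge_zero[of "a * b"] by linarith
qed

section \<open>Rotation of a Gaussian vector into an independent copy\<close>

locale gaussian_vector = prob_space M for M :: "'a measure" +
  fixes I :: "'i set" and Y :: "'i \<Rightarrow> 'a \<Rightarrow> real" and s :: real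
  assumes finI: "finite I" and neI: "I \<noteq> {}" and jg: "jointly_gaussian M I Y"
    and var_le: "\<And>i. i \<in> I \<Longrightarrow> (\<integral>\<omega>. (Y i \<omega>)\<^sup>2 \<partial>M) \<le> s"
begin

sublocale pp: pair_prob_space M M ..

abbreviation MM where "MM \<equiv> M \<Otimes>\<^sub>M M"

lemma Y_gauss: "i \<in> I \<Longrightarrow> centered_gaussian_rv M (Y i)"
  using jointly_gaussian_component[OF jg finI] .

lemma Y_meas[measurable]: "i \<in> I \<Longrightarrow> Y i \<in> borel_measurable M"
  using Y_gauss by (auto simp: centered_gaussian_rv_def)

definition comb :: "('i \<Rightarrow> real) \<Rightarrow> 'a \<Rightarrow> real" where
  "comb c \<omega> = (\<Sum>i\<in>I. c i * Y i \<omega>)"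

lemma comb_gauss: "centered_gaussian_rv M (comb c)"
  using jg unfolding jointly_gaussian_def comb_def by blast

lemma comb_meas[measurable]: "comb c \<in> borel_measurable M"
  using comb_gauss by (auto simp: centered_gaussian_rv_def)

lemma comb_sq: "integrable M (\<lambda>\<omega>. (comb c \<omega>)\<^sup>2)"
  using gaussian_square_integrable[OF comb_gauss] .

lemma comb_prod: "integrable M (\<lambda>\<omega>. comb c \<omega> * comb d \<omega>)"
proof (rule Bochner_Integration.integrable_bound)
  show "integrable M (\<lambda>\<omega>. (comb c \<omega>)\<^sup>2 + (comb d \<omega>)\<^sup>2)" using comb_sq by simp
  show "AE \<omega> in M. norm (comb c \<omega> * comb d \<omega>) \<le> norm ((comb c \<omega>)\<^sup>2 + (comb d \<omega>)\<^sup>2)"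
    using abs_mult_le_sum_squares by auto
qed measurable

abbreviation cv :: "('i \<Rightarrow> real) \<Rightarrow> real" where
  "cv c \<equiv> \<integral>\<omega>. (comb c \<omega>)\<^sup>2 \<partial>M"

lemma comb_sq_expand:
  "cv (\<lambda>i. a * c i + b * d i)
    = a\<^sup>2 * cv c + b\<^sup>2 * cv d + 2 * a * b * (\<integral>\<omega>. comb c \<omega> * comb d \<omega> \<partial>M)"
proof -
  have "comb (\<lambda>i. a * c i + b * d i) \<omega> = a * comb c \<omega> + b * comb d \<omega>" for \<omega>
    unfolding comb_def by (simp add: sum.distrib sum_distrib_left algebra_simps)
  then have "(comb (\<lambda>i. a * c i + b * d i) \<omega>)\<^sup>2 = a\<^sup>2 * (comb c \<omega>)\<^sup>2 + b\<^sup>2 * (comb d \<omega>)\<^sup>2 + 2 * a * b * (comb c \<omega> * comb d \<omega>)" for \<omega>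
    by (simp add: power2_eq_square algebra_simps)
  then show ?thesis using comb_sq comb_prod by simp
qed

text \<open>Angle \<open>0\<close> gives the first copy of the vector, angle \<open>pi / 2\<close>
  the second, independent one.\<close>

definition rot :: "real \<Rightarrow> 'i \<Rightarrow> 'a \<times> 'a \<Rightarrow> real" where
  "rot \<theta> i p = cos \<theta> * Y i (fst p) + sin \<theta> * Y i (snd p)"

lemma rot_meas[measurable]: "i \<in> I \<Longrightarrow> rot \<theta> i \<in> borel_measurable MM"
  unfolding rot_def by measurable

lemma char_pair_comb:
  "(CLINT p|MM. iexp (comb c (fst p) + comb d (snd p)))
    = of_real (exp (- (cv c + cv d) / 2))"
proof -
  have "integrable MM (\<lambda>p. iexp (comb c (fst p) + comb d (snd p)))"
    by (rule pp.P.integrable_const_bound[of _ 1]) auto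
  then have "(CLINT p|MM. iexp (comb c (fst p) + comb d (snd p)))
      = (CLINT x|M. (CLINT y|M. iexp (comb c x + comb d y)))"
    by (subst pp.integral_fst'[symmetric]) auto
  also have "\<dots> = (CLINT x|M. (CLINT y|M. iexp (comb c x) * iexp (comb d y)))"
    by (simp add: distrib_left exp_add)
  also have "\<dots> = (CLINT x|M. iexp (comb c x)) * (CLINT y|M. iexp (comb d y))"
    by simp
  also have "\<dots> = of_real (exp (- cv c / 2) * exp (- cv d / 2))"
    unfolding gaussian_char[OF comb_gauss] by simp
  also have "exp (- cv c / 2) * exp (- cv d / 2) = exp (- (cv c + cv d) / 2)"
    unfolding exp_add[symmetric] by (simp add: field_simps)
  finally show ?thesis .
qed

text \<open>The Boolean tag merges the vectors at the two angles into one vector, so that their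
  joint law is compared. In the variance of a combination \<open>\<theta>\<close> occurs only
  through the sum of squares of sine and cosine and through the addition formula for
  \<open>cos h\<close>, so the characteristic function does not depend on
  \<open>\<theta>\<close>.\<close>

lemma rot_law:
  fixes h \<theta> :: real
  defines "W \<equiv> \<lambda>\<theta> k. rot (if snd k then \<theta> + h else \<theta>) (fst k)"
  shows "distr MM (PiM (I \<times> UNIV) (\<lambda>_. borel)) (\<lambda>p. \<lambda>k\<in>I \<times> UNIV. W \<theta> k p)
       = distr MM (PiM (I \<times> UNIV) (\<lambda>_. borel)) (\<lambda>p. \<lambda>k\<in>I \<times> UNIV. W 0 k p)"
proof (rule joint_char_unique)
  show "finite (I \<times> (UNIV :: bool set))" using finI by simp
  show "prob_space MM" "prob_space MM" by (rule pp.prob_space_axioms)+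
  show "W \<theta> k \<in> borel_measurable MM" "W 0 k \<in> borel_measurable MM" if "k \<in> I \<times> UNIV" for k
    using that by (auto simp: W_def)
  fix c :: "'i \<times> bool \<Rightarrow> real"
  have quad: "x\<^sup>2 * A + y\<^sup>2 * B + 2 * x * y * C + (z\<^sup>2 * A + w\<^sup>2 * B + 2 * z * w * C)
      = (x\<^sup>2 + z\<^sup>2) * A + (y\<^sup>2 + w\<^sup>2) * B + 2 * (y * x + w * z) * C" for x y z w A B C :: real
    by (simp add: algebra_simps)
  have *: "(CLINT p|MM. iexp (\<Sum>k\<in>I \<times> UNIV. c k * W \<theta> k p))
     = of_real (exp (- (cv (\<lambda>i. c (i, False)) + cv (\<lambda>i. c (i, True))
         + 2 * cos h * (\<integral>\<omega>. comb (\<lambda>i. c (i, False)) \<omega> * comb (\<lambda>i. c (i, True)) \<omega> \<partial>M)) / 2))" for \<theta>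
  proof -
    let ?F = "\<lambda>i. c (i, False)" and ?T = "\<lambda>i. c (i, True)"
    have "(\<Sum>k\<in>I \<times> UNIV. c k * W \<theta> k p) = comb (\<lambda>i. cos \<theta> * ?F i + cos (\<theta> + h) * ?T i) (fst p)
        + comb (\<lambda>i. sin \<theta> * ?F i + sin (\<theta> + h) * ?T i) (snd p)" for p
    proof -
      have "(\<Sum>k\<in>I \<times> UNIV. c k * W \<theta> k p) = (\<Sum>i\<in>I. \<Sum>b\<in>UNIV. c (i, b) * W \<theta> (i, b) p)"
        unfolding sum.cartesian_product by (rule sum.cong) auto
      also have "\<dots> = comb (\<lambda>i. cos \<theta> * ?F i + cos (\<theta> + h) * ?T i) (fst p)
        + comb (\<lambda>i. sin \<theta> * ?F i + sin (\<theta> + h) * ?T i) (snd p)"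
        unfolding comb_def sum.distrib[symmetric]
        by (intro sum.cong refl) (simp add: UNIV_bool W_def rot_def algebra_simps)
      finally show ?thesis .
    qed
    then have "(CLINT p|MM. iexp (\<Sum>k\<in>I \<times> UNIV. c k * W \<theta> k p))
      = of_real (exp (- (cv (\<lambda>i. cos \<theta> * ?F i + cos (\<theta> + h) * ?T i)
          + cv (\<lambda>i. sin \<theta> * ?F i + sin (\<theta> + h) * ?T i)) / 2))"
      by (simp only: char_pair_comb)
    also have "cv (\<lambda>i. cos \<theta> * ?F i + cos (\<theta> + h) * ?T i)
          + cv (\<lambda>i. sin \<theta> * ?F i + sin (\<theta> + h) * ?T i)
        = ((cos \<theta>)\<^sup>2 + (sin \<theta>)\<^sup>2) * cv ?F + ((cos (\<theta> + h))\<^sup>2 + (sin (\<theta> + h))\<^sup>2) * cv ?T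
          + 2 * (cos (\<theta> + h) * cos \<theta> + sin (\<theta> + h) * sin \<theta>) * (\<integral>\<omega>. comb ?F \<omega> * comb ?T \<omega> \<partial>M)"
      unfolding comb_sq_expand by (rule quad)
    also have "cos (\<theta> + h) * cos \<theta> + sin (\<theta> + h) * sin \<theta> = cos h"
      using cos_diff[of "\<theta> + h" \<theta>] by simp
    finally show ?thesis by (simp only: sin_cos_squared_add2 mult_1)
  qed
  show "(CLINT p|MM. iexp (\<Sum>k\<in>I \<times> UNIV. c k * W \<theta> k p)) = (CLINT p|MM. iexp (\<Sum>k\<in>I \<times> UNIV. c k * W 0 k p))"
    unfolding * ..
qed

section \<open>Exponential moments of the maximum along the rotation\<close>

definition mx :: "('i \<Rightarrow> 'c \<Rightarrow> real) \<Rightarrow> 'c \<Rightarrow> real" where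
  "mx Z p = Max ((\<lambda>i. Z i p) ` I)"

lemma mx_meas: "(\<And>i. i \<in> I \<Longrightarrow> Z i \<in> borel_measurable N) \<Longrightarrow> mx Z \<in> borel_measurable N"
  unfolding mx_def by (rule borel_measurable_Max[OF finI])

lemma mx_Y_meas[measurable]: "mx Y \<in> borel_measurable M"
  by (rule mx_meas) (rule Y_meas)

lemma mx_rot_meas[measurable]: "mx (rot \<theta>) \<in> borel_measurable MM"
  by (rule mx_meas) (rule rot_meas)

text \<open>Every step has the law of the first one, whose starting point is simply the first
  copy.\<close>

lemma rot_step_stationary:
  "(\<integral>\<^sup>+p. ennreal (exp (l * (mx (rot \<theta>) p - mx (rot (\<theta> + h)) p))) \<partial>MM)
    = (\<integral>\<^sup>+p. ennreal (exp (l * (mx (rot 0) p - mx (rot h) p))) \<partial>MM)"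
proof -
  define W where "W = (\<lambda>\<theta> k. rot (if snd k then \<theta> + h else \<theta>) (fst k))"
  define \<Phi> where "\<Phi> w = ennreal (exp (l * (mx (\<lambda>i w. w (i, False)) w - mx (\<lambda>i w. w (i, True)) w)))" for w :: "'i \<times> bool \<Rightarrow> real"
  have [measurable]: "mx (\<lambda>i w. w (i, b)) \<in> borel_measurable (PiM (I \<times> UNIV) (\<lambda>_. borel))" for b :: bool
    by (rule mx_meas) (rule measurable_component_singleton, simp)
  have \<Phi>m[measurable]: "\<Phi> \<in> borel_measurable (PiM (I \<times> UNIV) (\<lambda>_. borel))"
    unfolding \<Phi>_def by measurable
  have Wm[measurable]: "k \<in> I \<times> UNIV \<Longrightarrow> W \<theta> k \<in> borel_measurable MM" for k \<theta>
    by (auto simp: W_def)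
  have "(\<integral>\<^sup>+p. ennreal (exp (l * (mx (rot \<theta>) p - mx (rot (\<theta> + h)) p))) \<partial>MM)
     = (\<integral>\<^sup>+w. \<Phi> w \<partial>(distr MM (PiM (I \<times> UNIV) (\<lambda>_. borel)) (\<lambda>p. \<lambda>k\<in>I \<times> UNIV. W \<theta> k p)))" for \<theta>
  proof -
    have "\<Phi> (\<lambda>k\<in>I \<times> UNIV. W \<theta> k p) = ennreal (exp (l * (mx (rot \<theta>) p - mx (rot (\<theta> + h)) p)))" for p
      unfolding \<Phi>_def mx_def W_def by simp
    then show ?thesis by (subst nn_integral_distr) auto
  qed
  note * = this
  show ?thesis unfolding *[of \<theta>] using *[of 0] rot_law[of \<theta> h] unfolding W_def by simp
qed

lemma mx_attained: "\<exists>k\<in>I. mx Z p = Z k p"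
proof -
  have "Max ((\<lambda>i. Z i p) ` I) \<in> (\<lambda>i. Z i p) ` I" using finI neI by (intro Max_in) auto
  then show ?thesis unfolding mx_def by auto
qed

lemma mx_ge: "i \<in> I \<Longrightarrow> Z i p \<le> mx Z p"
  unfolding mx_def using finI by (intro Max_ge) auto

lemma mgf_Y_le:
  assumes "i \<in> I"
  shows "(\<integral>\<^sup>+\<omega>. ennreal (exp (a * Y i \<omega>)) \<partial>M) \<le> ennreal (exp (a\<^sup>2 * s / 2))"
  unfolding gaussian_mgf[OF Y_gauss[OF assms]]
  by (intro ennreal_leI exp_le_cancel_iff[THEN iffD2] divide_right_mono mult_left_mono var_le[OF assms]) auto

text \<open>With \<open>k\<close> the index of the maximum at the starting point, the loss in one rotation step is
  at most \<open>(1 - cos h) Y\<^sub>k - sin h Y\<^sub>k'\<close>, where \<open>k\<close> is independent of the second copy.\<close>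

lemma rot_step_mgf:
  assumes l: "l \<ge> 0"
  shows "(\<integral>\<^sup>+p. ennreal (exp (l * (mx (rot 0) p - mx (rot h) p))) \<partial>MM)
    \<le> (\<integral>\<^sup>+\<omega>. ennreal (exp (l * (1 - cos h) * mx Y \<omega>)) \<partial>M) * ennreal (exp ((l * sin h)\<^sup>2 * s / 2))"
proof -
  have "(\<integral>\<^sup>+p. ennreal (exp (l * (mx (rot 0) p - mx (rot h) p))) \<partial>MM)
     = (\<integral>\<^sup>+x. \<integral>\<^sup>+y. ennreal (exp (l * (mx (rot 0) (x, y) - mx (rot h) (x, y)))) \<partial>M \<partial>M)"
    by (rule nn_integral_fst[symmetric]) measurable
  also have "\<dots> \<le> (\<integral>\<^sup>+x. ennreal (exp (l * (1 - cos h) * mx Y x)) * ennreal (exp ((l * sin h)\<^sup>2 * s / 2)) \<partial>M)"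
  proof (rule nn_integral_mono)
    fix x
    obtain k where k: "k \<in> I" "mx Y x = Y k x" using mx_attained[of Y x] by blast
    have "(\<integral>\<^sup>+y. ennreal (exp (l * (mx (rot 0) (x, y) - mx (rot h) (x, y)))) \<partial>M)
        \<le> (\<integral>\<^sup>+y. ennreal (exp (l * (1 - cos h) * mx Y x)) * ennreal (exp (- (l * sin h) * Y k y)) \<partial>M)"
    proof (rule nn_integral_mono)
      fix y
      have "mx (rot 0) (x, y) = mx Y x" by (simp add: mx_def rot_def)
      then have "mx (rot 0) (x, y) = Y k x" using k(2) by (rule trans)
      moreover have "cos h * Y k x + sin h * Y k y \<le> mx (rot h) (x, y)"
        using mx_ge[OF k(1), of "rot h" "(x, y)"] by (simp add: rot_def)
      ultimately have "l * (mx (rot 0) (x, y) - mx (rot h) (x, y)) \<le> l * ((1 - cos h) * Y k x - sin h * Y k y)"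
        by (intro mult_left_mono l) (simp add: algebra_simps)
      also have "\<dots> = l * (1 - cos h) * mx Y x + - (l * sin h) * Y k y"
        unfolding k(2) by (simp add: algebra_simps)
      finally have "exp (l * (mx (rot 0) (x, y) - mx (rot h) (x, y)))
          \<le> exp (l * (1 - cos h) * mx Y x) * exp (- (l * sin h) * Y k y)"
        by (simp only: exp_add[symmetric] exp_le_cancel_iff)
      then show "ennreal (exp (l * (mx (rot 0) (x, y) - mx (rot h) (x, y))))
          \<le> ennreal (exp (l * (1 - cos h) * mx Y x)) * ennreal (exp (- (l * sin h) * Y k y))"
        by (subst ennreal_mult[symmetric]) (auto intro: ennreal_leI)
    qed
    also have "\<dots> = ennreal (exp (l * (1 - cos h) * mx Y x)) * (\<integral>\<^sup>+y. ennreal (exp (- (l * sin h) * Y k y)) \<partial>M)"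
      using k(1) by (intro nn_integral_cmult) measurable
    also have "\<dots> \<le> ennreal (exp (l * (1 - cos h) * mx Y x)) * ennreal (exp ((l * sin h)\<^sup>2 * s / 2))"
      using mgf_Y_le[OF k(1), of "- (l * sin h)"] by (intro mult_left_mono) (simp_all only: power2_minus zero_le)
    finally show "(\<integral>\<^sup>+y. ennreal (exp (l * (mx (rot 0) (x, y) - mx (rot h) (x, y)))) \<partial>M)
        \<le> ennreal (exp (l * (1 - cos h) * mx Y x)) * ennreal (exp ((l * sin h)\<^sup>2 * s / 2))" .
  qed
  also have "\<dots> = (\<integral>\<^sup>+x. ennreal (exp (l * (1 - cos h) * mx Y x)) \<partial>M) * ennreal (exp ((l * sin h)\<^sup>2 * s / 2))"
    by (rule nn_integral_multc) measurable
  finally show ?thesis .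
qed

text \<open>The factor \<open>card I\<close> is crude but harmless: the lemma is used with
  \<open>a\<close> of order \<open>1 / J\<close>, so the excess over one vanishes as the rotation is
  refined.\<close>

lemma mgf_mx_le:
  assumes a: "0 \<le> a" "a \<le> 1"
  shows "(\<integral>\<^sup>+\<omega>. ennreal (exp (a * mx Y \<omega>)) \<partial>M) \<le> ennreal (1 + a * (card I * exp (s / 2)))"
proof -
  have "(\<integral>\<^sup>+\<omega>. ennreal (exp (a * mx Y \<omega>)) \<partial>M) \<le> (\<integral>\<^sup>+\<omega>. 1 + ennreal a * (\<Sum>i\<in>I. ennreal (exp (1 * Y i \<omega>))) \<partial>M)"
  proof (rule nn_integral_mono)
    fix \<omega>
    obtain k where k: "k \<in> I" "mx Y \<omega> = Y k \<omega>" using mx_attained[of Y \<omega>] by blast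
    have "exp (mx Y \<omega>) \<le> (\<Sum>i\<in>I. exp (Y i \<omega>))"
      unfolding k(2) by (rule member_le_sum) (use k finI in auto)
    then have "exp (a * mx Y \<omega>) \<le> 1 + a * (\<Sum>i\<in>I. exp (Y i \<omega>))"
      using exp_scale_le[OF a, of "mx Y \<omega>"] a by (smt (verit) mult_left_mono)
    then have "ennreal (exp (a * mx Y \<omega>)) \<le> ennreal (1 + a * (\<Sum>i\<in>I. exp (Y i \<omega>)))" by (rule ennreal_leI)
    also have "\<dots> = 1 + ennreal a * (\<Sum>i\<in>I. ennreal (exp (1 * Y i \<omega>)))"
      using a by (simp add: ennreal_plus ennreal_mult sum_nonneg sum_ennreal)
    finally show "ennreal (exp (a * mx Y \<omega>)) \<le> \<dots>" .
  qed
  also have "\<dots> = 1 + ennreal a * (\<Sum>i\<in>I. (\<integral>\<^sup>+\<omega>. ennreal (exp (1 * Y i \<omega>)) \<partial>M))"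
    by (subst nn_integral_add; (subst nn_integral_cmult)?; (subst nn_integral_sum)?)
       (auto simp: emeasure_space_1)
  also have "\<dots> \<le> 1 + ennreal a * (\<Sum>i\<in>I. ennreal (exp (s / 2)))"
    using mgf_Y_le[of _ 1] by (intro add_left_mono mult_left_mono sum_mono) auto
  also have "\<dots> = ennreal (1 + a * (card I * exp (s / 2)))"
    using a by (simp add: ennreal_plus ennreal_mult ennreal_of_nat_eq_real_of_nat)
  finally show ?thesis .
qed

text \<open>Jensen raises the parameter to \<open>J * l\<close> for each of \<open>J\<close> steps
  of angle \<open>h = pi / (2 * J)\<close>. The sine part then contributes at most
  \<open>(J * l * h)\<^sup>2 * s / 2 = l\<^sup>2 * pi\<^sup>2 * s / 8\<close>, whatever
  \<open>J\<close> is, while the cosine part has parameter at most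
  \<open>J * l * h\<^sup>2 / 2 = l * pi\<^sup>2 / (8 * J)\<close>, which tends to zero.\<close>

lemma mgf_difference_le:
  assumes l: "l \<ge> 0" and s: "s \<ge> 0" and J: "J > 0" and a: "l * pi\<^sup>2 / (8 * real J) \<le> 1"
  shows "(\<integral>\<^sup>+p. ennreal (exp (l * (mx Y (fst p) - mx Y (snd p)))) \<partial>MM)
    \<le> ennreal ((1 + l * pi\<^sup>2 / (8 * real J) * (card I * exp (s / 2))) * exp (l\<^sup>2 * pi\<^sup>2 * s / 8))"
    (is "_ \<le> ?R")
proof -
  define h where "h = pi / (2 * real J)"
  have Jh: "real J * h = pi / 2" using J by (simp add: h_def)
  define D where "D j p = mx (rot (real j * h)) p - mx (rot (real j * h + h)) p" for j p
  have [measurable]: "D j \<in> borel_measurable MM" for j unfolding D_def by measurable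
  \<comment> \<open>At the final angle \<open>J * h = pi / 2\<close> only the second copy is left,
    so the steps telescope to the full difference.\<close>
  have tele: "mx Y (fst p) - mx Y (snd p) = (\<Sum>j<J. D j p)" for p
  proof -
    have "(\<Sum>j<n. D j p) = mx (rot 0) p - mx (rot (real n * h)) p" for n
      by (induction n) (auto simp: D_def algebra_simps)
    from this[of J] show ?thesis unfolding Jh by (simp add: mx_def rot_def)
  qed
  have stepj: "(\<integral>\<^sup>+p. ennreal (exp (real J * (l * D j p))) \<partial>MM) \<le> ?R" for j
  proof -
    have Jl: "0 \<le> real J * l" using l by simp
    have "(\<integral>\<^sup>+p. ennreal (exp (real J * (l * D j p))) \<partial>MM)
        = (\<integral>\<^sup>+p. ennreal (exp ((real J * l) * (mx (rot 0) p - mx (rot h) p))) \<partial>MM)"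
      unfolding D_def mult.assoc[symmetric] by (rule rot_step_stationary)
    also have "\<dots> \<le> (\<integral>\<^sup>+\<omega>. ennreal (exp (real J * l * (1 - cos h) * mx Y \<omega>)) \<partial>M) * ennreal (exp ((real J * l * sin h)\<^sup>2 * s / 2))"
      by (rule rot_step_mgf[OF Jl])
    also have "\<dots> \<le> ennreal (1 + real J * l * (1 - cos h) * (card I * exp (s / 2))) * ennreal (exp ((real J * l * sin h)\<^sup>2 * s / 2))"
    proof (intro mult_right_mono mgf_mx_le)
      show "0 \<le> real J * l * (1 - cos h)" using l by simp
      have "real J * l * (1 - cos h) \<le> real J * l * (h\<^sup>2 / 2)" by (intro mult_left_mono one_minus_cos_le Jl)
      also have "\<dots> = l * pi\<^sup>2 / (8 * real J)" using J by (simp add: h_def field_simps power2_eq_square)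
      finally show "real J * l * (1 - cos h) \<le> 1" using a by simp
    qed auto
    also have "\<dots> \<le> ennreal (1 + l * pi\<^sup>2 / (8 * real J) * (card I * exp (s / 2))) * ennreal (exp (l\<^sup>2 * pi\<^sup>2 * s / 8))"
    proof (intro mult_mono ennreal_leI add_left_mono mult_right_mono)
      have "real J * l * (1 - cos h) \<le> real J * l * (h\<^sup>2 / 2)" by (intro mult_left_mono one_minus_cos_le Jl)
      also have "\<dots> = l * pi\<^sup>2 / (8 * real J)" using J by (simp add: h_def field_simps power2_eq_square)
      finally show "real J * l * (1 - cos h) \<le> l * pi\<^sup>2 / (8 * real J)" .
      have "(sin h)\<^sup>2 \<le> h\<^sup>2" using abs_sin_x_le_abs_x[of h] by (simp add: abs_le_square_iff)
      then have "(real J * l * sin h)\<^sup>2 \<le> (real J * l * h)\<^sup>2" by (simp add: power_mult_distrib mult_left_mono)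
      also have "real J * l * h = l * (pi / 2)" using Jh by (simp add: algebra_simps)
      also have "(l * (pi / 2))\<^sup>2 = l\<^sup>2 * pi\<^sup>2 / 4" by (simp add: power_mult_distrib power_divide)
      finally have "(real J * l * sin h)\<^sup>2 * s \<le> l\<^sup>2 * pi\<^sup>2 / 4 * s" by (rule mult_right_mono[OF _ s])
      then show "exp ((real J * l * sin h)\<^sup>2 * s / 2) \<le> exp (l\<^sup>2 * pi\<^sup>2 * s / 8)" by (simp add: field_simps)
    qed (use l in auto)
    also have "\<dots> = ?R" by (rule ennreal_mult''[symmetric]) simp
    finally show ?thesis .
  qed
  have "(\<integral>\<^sup>+p. ennreal (exp (l * (mx Y (fst p) - mx Y (snd p)))) \<partial>MM)
      \<le> (\<integral>\<^sup>+p. (\<Sum>j<J. ennreal (1 / J) * ennreal (exp (real J * (l * D j p)))) \<partial>MM)"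
  proof (rule nn_integral_mono)
    fix p
    have "exp (l * (mx Y (fst p) - mx Y (snd p))) = exp (\<Sum>j<J. l * D j p)" unfolding tele by (simp add: sum_distrib_left)
    also have "\<dots> \<le> (\<Sum>j<J. exp (real J * (l * D j p))) / J" by (rule exp_average_le[OF J])
    also have "\<dots> = (\<Sum>j<J. 1 / J * exp (real J * (l * D j p)))" by (simp add: sum_divide_distrib)
    finally have "ennreal (exp (l * (mx Y (fst p) - mx Y (snd p)))) \<le> ennreal (\<Sum>j<J. 1 / J * exp (real J * (l * D j p)))"
      by (rule ennreal_leI)
    also have "\<dots> = (\<Sum>j<J. ennreal (1 / J * exp (real J * (l * D j p))))" by (rule sum_ennreal[symmetric]) simp
    also have "\<dots> = (\<Sum>j<J. ennreal (1 / J) * ennreal (exp (real J * (l * D j p))))"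
      by (intro sum.cong refl ennreal_mult) auto
    finally show "ennreal (exp (l * (mx Y (fst p) - mx Y (snd p)))) \<le> \<dots>" .
  qed
  also have "\<dots> = (\<Sum>j<J. (\<integral>\<^sup>+p. ennreal (1 / J) * ennreal (exp (real J * (l * D j p))) \<partial>MM))"
    by (rule nn_integral_sum) measurable
  also have "\<dots> = (\<Sum>j<J. ennreal (1 / J) * (\<integral>\<^sup>+p. ennreal (exp (real J * (l * D j p))) \<partial>MM))"
    by (intro sum.cong refl nn_integral_cmult) measurable
  also have "\<dots> \<le> (\<Sum>j<J. ennreal (1 / J) * ?R)"
    by (intro sum_mono mult_left_mono stepj) auto
  also have "\<dots> = ennreal J * ennreal (1 / J) * ?R"
    by (simp add: ennreal_of_nat_eq_real_of_nat mult.assoc)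
  also have "ennreal J * ennreal (1 / J) = 1" using J by (simp add: ennreal_mult'[symmetric])
  finally show ?thesis by simp
qed

text \<open>The product is the probability that, for two independent copies, the first maximum
  exceeds \<open>u\<close> while the second is at most \<open>v\<close>. Markov's inequality for the
  exponential of the difference bounds it, and letting \<open>J\<close> tend to infinity removes the
  number of coordinates.\<close>

lemma concentration:
  assumes s: "s > 0" and uv: "v \<le> u"
  shows "prob {\<omega>\<in>space M. u < mx Y \<omega>} * prob {\<omega>\<in>space M. mx Y \<omega> \<le> v} \<le> exp (- 2 * (u - v)\<^sup>2 / (pi\<^sup>2 * s))"
proof -
  \<comment> \<open>Minimises \<open>- l * (u - v) + l\<^sup>2 * pi\<^sup>2 * s / 8\<close>.\<close>
  define l where "l = 4 * (u - v) / (pi\<^sup>2 * s)"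
  have l: "l \<ge> 0" using uv s by (simp add: l_def)
  define A where "A = {\<omega>\<in>space M. u < mx Y \<omega>}"
  define B where "B = {\<omega>\<in>space M. mx Y \<omega> \<le> v}"
  have [measurable]: "A \<in> sets M" "B \<in> sets M" unfolding A_def B_def by measurable
  define K where "K = card I * exp (s / 2)"
  have bound: "prob A * prob B \<le> exp (- l * (u - v)) * ((1 + l * pi\<^sup>2 / (8 * real J) * K) * exp (l\<^sup>2 * pi\<^sup>2 * s / 8))"
    if J: "J > 0" and a: "l * pi\<^sup>2 / (8 * real J) \<le> 1" for J
  proof -
    have "ennreal (prob A * prob B) = emeasure MM (A \<times> B)"
      by (subst emeasure_pair_measure_Times) (auto simp: emeasure_eq_measure ennreal_mult)
    also have "\<dots> = (\<integral>\<^sup>+p. indicator (A \<times> B) p \<partial>MM)" by simp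
    also have "\<dots> \<le> (\<integral>\<^sup>+p. ennreal (exp (- l * (u - v))) * ennreal (exp (l * (mx Y (fst p) - mx Y (snd p)))) \<partial>MM)"
    proof (rule nn_integral_mono)
      fix p
      have "1 \<le> exp (- l * (u - v)) * exp (l * (mx Y (fst p) - mx Y (snd p)))" if "p \<in> A \<times> B"
      proof -
        have "l * (u - v) \<le> l * (mx Y (fst p) - mx Y (snd p))"
          by (intro mult_left_mono l) (use that in \<open>auto simp: A_def B_def\<close>)
        then show ?thesis unfolding exp_add[symmetric] by simp
      qed
      then show "indicator (A \<times> B) p \<le> ennreal (exp (- l * (u - v))) * ennreal (exp (l * (mx Y (fst p) - mx Y (snd p))))"
        by (auto simp: indicator_def ennreal_mult'[symmetric] simp del: mem_Times_iff)
    qed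
    also have "\<dots> = ennreal (exp (- l * (u - v))) * (\<integral>\<^sup>+p. ennreal (exp (l * (mx Y (fst p) - mx Y (snd p)))) \<partial>MM)"
      by (rule nn_integral_cmult) measurable
    also have "\<dots> \<le> ennreal (exp (- l * (u - v))) * ennreal ((1 + l * pi\<^sup>2 / (8 * real J) * K) * exp (l\<^sup>2 * pi\<^sup>2 * s / 8))"
      unfolding K_def using mgf_difference_le[OF l _ J a] s by (intro mult_left_mono) auto
    also have "\<dots> = ennreal (exp (- l * (u - v)) * ((1 + l * pi\<^sup>2 / (8 * real J) * K) * exp (l\<^sup>2 * pi\<^sup>2 * s / 8)))"
      by (rule ennreal_mult'[symmetric]) simp
    finally have "ennreal (prob A * prob B) \<le> \<dots>" .
    moreover have "0 \<le> l * pi\<^sup>2 / (8 * real J) * K" using l by (simp add: K_def)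
    then have "0 \<le> exp (- l * (u - v)) * ((1 + l * pi\<^sup>2 / (8 * real J) * K) * exp (l\<^sup>2 * pi\<^sup>2 * s / 8))"
      by (intro mult_nonneg_nonneg) auto
    ultimately show ?thesis by (simp only: ennreal_le_iff)
  qed
  have lim0: "(\<lambda>J. l * pi\<^sup>2 / (8 * real J)) \<longlonglongrightarrow> 0" by real_asymp
  have "(\<lambda>J. exp (- l * (u - v)) * ((1 + l * pi\<^sup>2 / (8 * real J) * K) * exp (l\<^sup>2 * pi\<^sup>2 * s / 8)))
     \<longlonglongrightarrow> exp (- l * (u - v)) * ((1 + 0 * K) * exp (l\<^sup>2 * pi\<^sup>2 * s / 8))"
    by (intro tendsto_mult tendsto_add lim0 tendsto_const)
  moreover have "eventually (\<lambda>J. prob A * prob B \<le> exp (- l * (u - v)) * ((1 + l * pi\<^sup>2 / (8 * real J) * K) * exp (l\<^sup>2 * pi\<^sup>2 * s / 8))) sequentially"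
    using eventually_gt_at_top[of 0] order_tendstoD(2)[OF lim0 zero_less_one]
    by eventually_elim (rule bound, simp_all)
  ultimately have "prob A * prob B \<le> exp (- l * (u - v)) * ((1 + 0 * K) * exp (l\<^sup>2 * pi\<^sup>2 * s / 8))"
    by (rule tendsto_lowerbound) simp
  also have "\<dots> = exp (- l * (u - v) + l\<^sup>2 * pi\<^sup>2 * s / 8)" unfolding exp_add by simp
  also have "- l * (u - v) + l\<^sup>2 * pi\<^sup>2 * s / 8 = - 2 * (u - v)\<^sup>2 / (pi\<^sup>2 * s)"
    unfolding l_def using s by (simp add: field_simps power2_eq_square)
  finally show ?thesis unfolding A_def B_def .
qed

end

section \<open>Gaussian tails with respect to a totally bounded convex body\<close>

text \<open>A finite net of \<open>S\<close> spans a compact polytope \<open>C\<close>. The convex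
  set \<open>C + ball 0 (e/4)\<close> contains \<open>S\<close>, hence its hull, so a finite net of
  \<open>C\<close> serves. Net, neighbourhood and closure cost \<open>e/4\<close> each.\<close>

lemma totally_bounded_convex_hull:
  fixes S :: "'b::real_normed_vector set"
  assumes S: "compact S" and e: "e > 0"
  shows "\<exists>A. finite A \<and> closure (convex hull S) \<subseteq> (\<Union>a\<in>A. ball a e)"
proof -
  have e4: "e/4 > 0" using e by simp
  obtain F where F: "finite F" "S \<subseteq> (\<Union>a\<in>F. ball a (e/4))"
    using seq_compact_imp_totally_bounded[OF compact_imp_seq_compact[OF S]] e4 by blast
  define C where "C = convex hull F"
  have C: "compact C" "convex C" using finite_imp_compact_convex_hull[OF F(1)] by (auto simp: C_def)
  obtain A where A: "finite A" "C \<subseteq> (\<Union>a\<in>A. ball a (e/4))"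
    using seq_compact_imp_totally_bounded[OF compact_imp_seq_compact[OF C(1)]] e4 by blast
  define N where "N = (\<Union>x\<in>C. \<Union>y\<in>ball 0 (e/4). {x + y})"
  have "convex N" unfolding N_def by (rule convex_sums[OF C(2)]) simp
  moreover have "S \<subseteq> N"
  proof
    fix x assume "x \<in> S"
    then obtain a where a: "a \<in> F" "x \<in> ball a (e/4)" using F(2) by blast
    have "a \<in> C" using a(1) unfolding C_def by (rule hull_inc)
    moreover have "x - a \<in> ball 0 (e/4)" using a(2) by (simp add: dist_norm norm_minus_commute)
    ultimately show "x \<in> N" unfolding N_def by (intro UN_I[of a] UN_I[of "x - a"]) auto
  qed
  ultimately have hN: "convex hull S \<subseteq> N" by (rule hull_minimal[rotated])
  have "closure (convex hull S) \<subseteq> (\<Union>a\<in>A. ball a e)"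
  proof
    fix x assume "x \<in> closure (convex hull S)"
    then obtain y where y: "y \<in> convex hull S" "dist y x < e/4"
      using e4 unfolding closure_approachable by blast
    obtain c z where c: "c \<in> C" "z \<in> ball 0 (e/4)" "y = c + z" using y(1) hN unfolding N_def by blast
    obtain a where a: "a \<in> A" "c \<in> ball a (e/4)" using A(2) c(1) by blast
    have "dist c y < e/4" using c by (simp add: dist_norm)
    moreover have "dist a c < e/4" using a by simp
    moreover have "dist a x \<le> dist a c + dist c y + dist y x"
      using dist_triangle[of a x c] dist_triangle[of c x y] by linarith
    ultimately have "dist a x < e" using y(2) e by linarith
    then show "x \<in> (\<Union>a\<in>A. ball a e)" using a(1) by auto
  qed
  then show ?thesis using A(1) by blast
qed

text \<open>Inner regularity provides a compact set of mass above \<open>1/2\<close>; its reflection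
  and the origin are adjoined before the closed convex hull is taken. Total boundedness of the
  result is what later reduces the dual ball to finitely many functionals.\<close>

lemma exists_symmetric_body:
  fixes P :: "'b::{banach, second_countable_topology} measure"
  assumes P: "prob_space P" and sets: "sets P = sets borel"
  shows "\<exists>K. closed K \<and> convex K \<and> (\<forall>x\<in>K. - x \<in> K) \<and> 0 \<in> K \<and>
     (\<forall>e>0. \<exists>A. finite A \<and> K \<subseteq> (\<Union>a\<in>A. ball a e)) \<and> 1/2 \<le> measure P K"
proof -
  interpret prob_space P by (rule P)
  have sp: "space P = UNIV" using sets_eq_imp_space_eq[OF sets] by simp
  have "emeasure P UNIV = (SUP K \<in> {K. K \<subseteq> UNIV \<and> compact K}. emeasure P K)"
    by (rule inner_regular) (use sets sp emeasure_space_1 in auto)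
  then have "ennreal (1/2) < (SUP K \<in> {K. K \<subseteq> UNIV \<and> compact K}. emeasure P K)"
  proof -
    have "ennreal (1/2) < ennreal 1" by (subst ennreal_less_iff) auto
    also have "ennreal 1 = emeasure P UNIV" using emeasure_space_1 by (simp add: sp)
    finally show ?thesis using \<open>emeasure P UNIV = _\<close> by (simp only:)
  qed
  then obtain K0 where K0: "compact K0" "ennreal (1/2) < emeasure P K0"
    by (auto simp: less_SUP_iff)
  define S where "S = insert 0 (K0 \<union> uminus ` K0)"
  have S: "compact S" unfolding S_def
    using K0 by (intro compact_insert compact_Un compact_continuous_image continuous_intros) auto
  define K where "K = closure (convex hull S)"
  have SK: "S \<subseteq> K" unfolding K_def by (meson closure_subset hull_subset order_trans)
  have "uminus ` S = S" unfolding S_def by (auto simp: image_Un image_image)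
  then have sym: "uminus ` K = K"
  proof -
    assume a: "uminus ` S = S"
    have "(*\<^sub>R) (-1) ` K = closure ((*\<^sub>R) (-1) ` (convex hull S))" unfolding K_def by (rule closure_scaleR)
    also have "(*\<^sub>R) (-1) ` (convex hull S) = convex hull ((*\<^sub>R) (-1) ` S)" by (rule convex_hull_scaling[symmetric])
    also have "(*\<^sub>R) (-1) ` S = S" using a by (simp add: image_def)
    finally show ?thesis by (simp add: K_def image_def)
  qed
  have cl: "closed K" unfolding K_def by simp
  have "ennreal (1/2) < emeasure P K"
    using K0(2) by (rule less_le_trans) (rule emeasure_mono, use SK cl sets in \<open>auto simp: S_def\<close>)
  then have m: "1/2 < measure P K"
    unfolding emeasure_eq_measure by (subst (asm) ennreal_less_iff) auto
  have "convex K" unfolding K_def by (intro convex_closure convex_convex_hull)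
  moreover have "- x \<in> K" if "x \<in> K" for x using sym that by blast
  moreover have "0 \<in> K" using SK by (auto simp: S_def)
  moreover have "\<exists>A. finite A \<and> K \<subseteq> (\<Union>a\<in>A. ball a e)" if "e > 0" for e
    unfolding K_def using totally_bounded_convex_hull[OF S that] .
  ultimately show ?thesis using cl m by (intro exI[of _ K]) auto
qed

lemma polar_separation:
  fixes K :: "'b::real_normed_vector set"
  assumes K: "closed K" "convex K" "0 \<in> K" and x: "x \<notin> K"
  shows "\<exists>f :: 'b \<Rightarrow> real. bounded_linear f \<and> (\<forall>y\<in>K. f y \<le> 1) \<and> 1 < f x"
proof -
  obtain e where e: "e > 0" "\<And>y. y \<in> K \<Longrightarrow> e \<le> dist x y"
  proof -
    have "open (- K)" "x \<in> - K" using K(1) x by auto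
    then obtain e where "e > 0" "ball x e \<subseteq> - K" by (meson open_contains_ball)
    then show thesis using that[of e] by (metis ComplD linorder_not_le mem_ball subsetD)
  qed
  obtain f where f: "bounded_linear f" "\<forall>a\<in>K. f a + e \<le> f x"
    using dual_separation[OF K(2) _ e(2)] K(3) by blast
  have f0: "f 0 = 0" using f(1) by (rule linear_simps)
  \<comment> \<open>Division by \<open>f x - e/2\<close> puts the level \<open>1\<close> strictly
    between the values on \<open>K\<close>, which are at most \<open>f x - e\<close>, and
    \<open>f x\<close>. The divisor is positive because \<open>K\<close> contains the
    origin.\<close>
  have pos: "0 < f x - e/2" using f(2) K(3) e(1) f0 by (smt (verit) field_sum_of_halves)
  show ?thesis
  proof (intro exI[of _ "\<lambda>y. f y / (f x - e/2)"] conjI ballI)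
    show "bounded_linear (\<lambda>y. f y / (f x - e/2))"
      using bounded_linear_divide[THEN bounded_linear_compose, OF f(1)] .
    show "f y / (f x - e/2) \<le> 1" if "y \<in> K" for y using f(2) that pos e(1) by (smt (verit) divide_le_eq_1 field_sum_of_halves)
    show "1 < f x / (f x - e/2)" using pos e(1) by simp
  qed
qed

text \<open>The complement of \<open>K\<close> is covered by open half-spaces given by the polar,
  and Lindelof's theorem leaves countably many of them. Leaving \<open>K\<close> thereby becomes a
  limit of events about finite maxima.\<close>

lemma countable_polar:
  fixes K :: "'b::{real_normed_vector, second_countable_topology} set"
  assumes K: "closed K" "convex K" "0 \<in> K"
  shows "\<exists>f :: nat \<Rightarrow> 'b \<Rightarrow> real. (\<forall>n. bounded_linear (f n)) \<and> (\<forall>n. \<forall>y\<in>K. f n y \<le> 1) \<and> (\<forall>x. x \<notin> K \<longrightarrow> (\<exists>n. 1 < f n x))"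
proof -
  define G where "G = {f :: 'b \<Rightarrow> real. bounded_linear f \<and> (\<forall>y\<in>K. f y \<le> 1)}"
  define H where "H f = {x. 1 < f x}" for f :: "'b \<Rightarrow> real"
  have "open (H f)" if "f \<in> G" for f
    unfolding H_def using that bounded_linear.continuous_on[of f UNIV "\<lambda>x. x"]
    by (intro open_Collect_less continuous_on_const) (auto simp: G_def)
  then have op: "\<And>S. S \<in> H ` G \<Longrightarrow> open S" by auto
  obtain F' where F': "F' \<subseteq> H ` G" "countable F'" "\<Union>F' = \<Union>(H ` G)"
    using Lindelof[OF op] by blast
  obtain G' where G': "countable G'" "G' \<subseteq> G" "F' = H ` G'"
    using F'(1,2) countable_subset_image[of F' H G] by auto
  \<comment> \<open>The zero functional keeps the family nonempty, so that it can be enumerated even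
    when \<open>K\<close> is the whole space.\<close>
  define G'' where "G'' = insert (\<lambda>_. 0) G'"
  have G'': "countable G''" "G'' \<noteq> {}" "G'' \<subseteq> G" using G' by (auto simp: G''_def G_def)
  show ?thesis
  proof (intro exI[of _ "from_nat_into G''"] conjI allI ballI impI)
    fix n
    have "from_nat_into G'' n \<in> G" using from_nat_into[OF G''(2), of n] G''(3) by blast
    then show "bounded_linear (from_nat_into G'' n)" "\<And>y. y \<in> K \<Longrightarrow> from_nat_into G'' n y \<le> 1"
      by (auto simp: G_def)
  next
    fix x assume "x \<notin> K"
    then have "x \<in> \<Union>(H ` G)" using polar_separation[OF K] by (auto simp: G_def H_def)
    then obtain g where "g \<in> G'" "1 < g x" using F'(3) G'(3) by (auto simp: H_def)
    then show "\<exists>n. 1 < from_nat_into G'' n x"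
      using from_nat_into_surj[OF G''(1), of g] by (auto simp: G''_def)
  qed
qed

section \<open>Gaussian tails and square integrability of a Banach space valued element\<close>

locale gaussian_element = prob_space M for M :: "'a measure" +
  fixes X :: "'a \<Rightarrow> 'b::{banach, second_countable_topology}" and K :: "'b set"
  assumes X_meas[measurable]: "X \<in> borel_measurable M"
    and X_gauss: "\<And>f :: 'b \<Rightarrow> real. bounded_linear f \<Longrightarrow> centered_gaussian_rv M (\<lambda>\<omega>. f (X \<omega>))"
    and K_closed: "closed K" and K_convex: "convex K" and K_sym: "\<And>x. x \<in> K \<Longrightarrow> - x \<in> K"
    and K_zero: "0 \<in> K" and K_prob: "1/2 \<le> prob {\<omega>\<in>space M. X \<omega> \<in> K}"
    and K_tb: "\<And>e. e > 0 \<Longrightarrow> \<exists>A. finite A \<and> K \<subseteq> (\<Union>a\<in>A. ball a e)"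
begin

lemma K_meas[measurable]: "K \<in> sets borel" using K_closed by simp

lemma variance_le_polar:
  fixes f :: "'b \<Rightarrow> real"
  assumes f: "bounded_linear f" and le: "\<And>y. y \<in> K \<Longrightarrow> \<bar>f y\<bar> \<le> 1"
  shows "(\<integral>\<omega>. (f (X \<omega>))\<^sup>2 \<partial>M) \<le> 4"
proof (rule gaussian_variance_le[OF X_gauss[OF f]])
  have [measurable]: "(\<lambda>\<omega>. f (X \<omega>)) \<in> borel_measurable M"
    using X_gauss[OF f] by (simp add: centered_gaussian_rv_def)
  have "prob {\<omega>\<in>space M. X \<omega> \<in> K} \<le> prob {\<omega>\<in>space M. \<bar>f (X \<omega>)\<bar> \<le> 1}"
    by (rule finite_measure_mono) (use le in auto)
  then show "1/2 \<le> prob {\<omega>\<in>space M. \<bar>f (X \<omega>)\<bar> \<le> 1}" using K_prob by linarith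
qed

text \<open>The event lies in the increasing limit of the events that one of the first polar
  functionals exceeds \<open>l\<close>. When \<open>X\<close> lies in \<open>K\<close>, which has
  probability at least \<open>1/2\<close>, all of them are at most one. Concentration with
  \<open>u = l\<close>, \<open>v = 1\<close>, \<open>s = 4\<close> then bounds each event uniformly
  in \<open>N\<close>, and the factor \<open>2\<close> is the inverse of \<open>1/2\<close>.\<close>

lemma body_tail:
  assumes l: "l \<ge> 1"
  shows "prob {\<omega>\<in>space M. (1 / l) *\<^sub>R X \<omega> \<notin> K} \<le> 2 * exp (- (l - 1)\<^sup>2 / (2 * pi\<^sup>2))"
proof -
  obtain f :: "nat \<Rightarrow> 'b \<Rightarrow> real" where f: "\<And>n. bounded_linear (f n)" "\<And>n y. y \<in> K \<Longrightarrow> f n y \<le> 1"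
      "\<And>x. x \<notin> K \<Longrightarrow> \<exists>n. 1 < f n x"
    using countable_polar[OF K_closed K_convex K_zero] by blast
  have fneg: "f n (- y) = - f n y" and fsc: "f n (r *\<^sub>R y) = r * f n y" for n y r
    using linear_simps[OF f(1)[of n]] by auto
  have fabs: "\<bar>f n y\<bar> \<le> 1" if "y \<in> K" for n y
    using f(2)[OF that, of n] f(2)[OF K_sym[OF that], of n] fneg[of n y] by linarith
  have [measurable]: "(\<lambda>\<omega>. f n (X \<omega>)) \<in> borel_measurable M" for n
    using X_gauss[OF f(1)] by (simp add: centered_gaussian_rv_def)
  define A where "A N = {\<omega>\<in>space M. \<exists>n\<le>N. l < f n (X \<omega>)}" for N :: nat
  have Am[measurable]: "A N \<in> sets M" for N unfolding A_def by measurable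
  have U: "{\<omega>\<in>space M. (1 / l) *\<^sub>R X \<omega> \<notin> K} \<subseteq> (\<Union>N. A N)"
  proof
    fix \<omega> assume "\<omega> \<in> {\<omega>\<in>space M. (1 / l) *\<^sub>R X \<omega> \<notin> K}"
    then have w: "\<omega> \<in> space M" "(1 / l) *\<^sub>R X \<omega> \<notin> K" by auto
    obtain n where "1 < f n ((1 / l) *\<^sub>R X \<omega>)" using f(3)[OF w(2)] by blast
    then have "l < f n (X \<omega>)" using l unfolding fsc by (simp add: field_simps)
    then show "\<omega> \<in> (\<Union>N. A N)" using w unfolding A_def by auto
  qed
  have bound: "prob (A N) \<le> 2 * exp (- (l - 1)\<^sup>2 / (2 * pi\<^sup>2))" for N
  proof -
    define Y where "Y n \<omega> = f n (X \<omega>)" for n \<omega>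
    interpret gv: gaussian_vector M "{..N}" Y 4
    proof unfold_locales
      show "jointly_gaussian M {..N} Y"
        unfolding jointly_gaussian_def Y_def
      proof
        fix c :: "nat \<Rightarrow> real"
        have "bounded_linear (\<lambda>x. \<Sum>n\<in>{..N}. c n * f n x)"
          by (intro bounded_linear_sum bounded_linear_const_mult f(1))
        from X_gauss[OF this] show "centered_gaussian_rv M (\<lambda>\<omega>. \<Sum>n\<in>{..N}. c n * f n (X \<omega>))" .
      qed
      show "(\<integral>\<omega>. (Y i \<omega>)\<^sup>2 \<partial>M) \<le> 4" for i
        unfolding Y_def by (rule variance_le_polar[OF f(1) fabs])
    qed auto
    have A: "A N = {\<omega>\<in>space M. l < gv.mx Y \<omega>}"
    proof -
      have "(l < gv.mx Y \<omega>) \<longleftrightarrow> (\<exists>n\<le>N. l < f n (X \<omega>))" for \<omega>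
        unfolding gv.mx_def Y_def by (subst Max_gr_iff) auto
      then show ?thesis unfolding A_def by auto
    qed
    have "prob {\<omega>\<in>space M. X \<omega> \<in> K} \<le> prob {\<omega>\<in>space M. gv.mx Y \<omega> \<le> 1}"
      by (rule finite_measure_mono) (use f(2) in \<open>auto simp: gv.mx_def Y_def\<close>)
    then have half: "1/2 \<le> prob {\<omega>\<in>space M. gv.mx Y \<omega> \<le> 1}" using K_prob by linarith
    have "prob (A N) * (1/2) \<le> prob (A N) * prob {\<omega>\<in>space M. gv.mx Y \<omega> \<le> 1}"
      using half by (intro mult_left_mono) auto
    also have "\<dots> \<le> exp (- 2 * (l - 1)\<^sup>2 / (pi\<^sup>2 * 4))"
      unfolding A by (rule gv.concentration) (use l in auto)
    also have "- 2 * (l - 1)\<^sup>2 / (pi\<^sup>2 * 4) = - (l - 1)\<^sup>2 / (2 * pi\<^sup>2)" by simp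
    finally show ?thesis by simp
  qed
  have "(\<lambda>N. prob (A N)) \<longlonglongrightarrow> prob (\<Union>N. A N)"
    by (rule finite_Lim_measure_incseq) (auto simp: incseq_def A_def intro: order_trans)
  then have "prob (\<Union>N. A N) \<le> 2 * exp (- (l - 1)\<^sup>2 / (2 * pi\<^sup>2))"
    by (rule LIMSEQ_le_const2) (use bound in auto)
  moreover have "prob {\<omega>\<in>space M. (1 / l) *\<^sub>R X \<omega> \<notin> K} \<le> prob (\<Union>N. A N)"
    by (rule finite_measure_mono[OF U]) auto
  ultimately show ?thesis by linarith
qed

lemma K_bounded: obtains r where "r > 0" "\<And>y. y \<in> K \<Longrightarrow> norm y \<le> r"
proof -
  obtain A where A: "finite A" "K \<subseteq> (\<Union>a\<in>A. ball a 1)" using K_tb[of 1] by auto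
  have "bounded K" by (rule bounded_subset[OF _ A(2)]) (use A(1) in auto)
  then show thesis using that by (auto simp: bounded_pos)
qed

text \<open>A Fernique-type consequence of the body tail: \<open>K\<close> lies in a ball of radius
  \<open>r\<close>, so the norm has Gaussian tails on the scale \<open>r\<close>. It ensures that
  the Bochner integrals defining the ellipsoid exist.\<close>

lemma norm_square_integrable: "integrable M (\<lambda>\<omega>. (norm (X \<omega>))\<^sup>2)"
proof -
  obtain r where r: "r > 0" "\<And>y. y \<in> K \<Longrightarrow> norm y \<le> r" by (rule K_bounded) blast
  \<comment> \<open>\<open>body_tail\<close> concerns levels at least one; at level zero the trivial
    bound is used.\<close>
  define a where "a n = (if n < 1 then 1 else 2 * exp (- (real n - 1)\<^sup>2 / (2 * pi\<^sup>2)))" for n :: nat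
  have pa: "prob {\<omega>\<in>space M. real n * r < norm (X \<omega>)} \<le> a n" for n
  proof (cases "n < 1")
    case True then show ?thesis by (simp add: a_def)
  next
    case False
    have "prob {\<omega>\<in>space M. real n * r < norm (X \<omega>)} \<le> prob {\<omega>\<in>space M. (1 / real n) *\<^sub>R X \<omega> \<notin> K}"
    proof (rule finite_measure_mono)
      have "norm (X \<omega>) \<le> real n * r" if "(1 / real n) *\<^sub>R X \<omega> \<in> K" for \<omega>
        using r(2)[OF that] False by (simp add: field_simps)
      then show "{\<omega>\<in>space M. real n * r < norm (X \<omega>)} \<subseteq> {\<omega>\<in>space M. (1 / real n) *\<^sub>R X \<omega> \<notin> K}" by force
    qed measurable
    also have "\<dots> \<le> a n" using body_tail[of "real n"] False by (simp add: a_def)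
    finally show ?thesis .
  qed
  have sm: "summable (\<lambda>n. ((real n + 1) * r)\<^sup>2 * a n)"
  proof (rule summable_comparison_test_bigo)
    show "summable (\<lambda>n. norm (1 / real n ^ 2))" using inverse_power_summable[of 2, where 'a = real] by (simp add: inverse_eq_divide)
    have "(\<lambda>n. ((real n + 1) * r)\<^sup>2 * (2 * exp (- (real n - 1)\<^sup>2 / (2 * pi\<^sup>2)))) \<in> O(\<lambda>n. 1 / real n ^ 2)"
      using r(1) pi_gt_zero by real_asymp
    moreover have "eventually (\<lambda>n. ((real n + 1) * r)\<^sup>2 * a n = ((real n + 1) * r)\<^sup>2 * (2 * exp (- (real n - 1)\<^sup>2 / (2 * pi\<^sup>2)))) sequentially"
      using eventually_ge_at_top[of 1] by eventually_elim (auto simp: a_def)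
    ultimately show "(\<lambda>n. ((real n + 1) * r)\<^sup>2 * a n) \<in> O(\<lambda>n. 1 / real n ^ 2)"
      by (subst landau_o.big.in_cong) auto
  qed
  have "(\<integral>\<^sup>+\<omega>. ennreal ((norm (X \<omega>))\<^sup>2) \<partial>M)
      \<le> (\<integral>\<^sup>+\<omega>. (\<Sum>n. ennreal (((real n + 1) * r)\<^sup>2) * indicator {\<omega>\<in>space M. real n * r < norm (X \<omega>)} \<omega>) \<partial>M)"
  proof (rule nn_integral_mono)
    fix \<omega> assume w: "\<omega> \<in> space M"
    show "ennreal ((norm (X \<omega>))\<^sup>2) \<le> (\<Sum>n. ennreal (((real n + 1) * r)\<^sup>2) * indicator {\<omega>\<in>space M. real n * r < norm (X \<omega>)} \<omega>)"
    proof (cases "norm (X \<omega>) = 0")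
      case False
      \<comment> \<open>The index of the shell between radii \<open>m * r\<close> and
        \<open>(m + 1) * r\<close>; ceiling minus one keeps the lower inequality strict.\<close>
      define m where "m = nat (\<lceil>norm (X \<omega>) / r\<rceil> - 1)"
      have "norm (X \<omega>) / r > 0" using False r(1) by simp
      then have m: "real m < norm (X \<omega>) / r" "norm (X \<omega>) / r \<le> real m + 1"
        unfolding m_def by linarith+
      have "ennreal ((norm (X \<omega>))\<^sup>2) \<le> ennreal (((real m + 1) * r)\<^sup>2)"
        by (intro ennreal_leI power_mono) (use m r in \<open>auto simp: field_simps\<close>)
      also have "\<dots> = ennreal (((real m + 1) * r)\<^sup>2) * indicator {\<omega>\<in>space M. real m * r < norm (X \<omega>)} \<omega>"
        using m r w by (simp add: field_simps)
      also have "\<dots> \<le> (\<Sum>n. ennreal (((real n + 1) * r)\<^sup>2) * indicator {\<omega>\<in>space M. real n * r < norm (X \<omega>)} \<omega>)"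
      proof -
        have "g m \<le> suminf g" for g :: "nat \<Rightarrow> ennreal" using sum_le_suminf[of g "{m}"] by simp
        then show ?thesis .
      qed
      finally show ?thesis .
    qed simp
  qed
  also have "\<dots> = (\<Sum>n. (\<integral>\<^sup>+\<omega>. ennreal (((real n + 1) * r)\<^sup>2) * indicator {\<omega>\<in>space M. real n * r < norm (X \<omega>)} \<omega> \<partial>M))"
    by (rule nn_integral_suminf) measurable
  also have "\<dots> = (\<Sum>n. ennreal (((real n + 1) * r)\<^sup>2) * emeasure M {\<omega>\<in>space M. real n * r < norm (X \<omega>)})"
    by (subst nn_integral_cmult_indicator) auto
  also have "\<dots> \<le> (\<Sum>n. ennreal (((real n + 1) * r)\<^sup>2 * a n))"
    unfolding emeasure_eq_measure
  proof (intro suminf_le summableI)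
    fix n
    have "ennreal (((real n + 1) * r)\<^sup>2 * prob {\<omega>\<in>space M. real n * r < norm (X \<omega>)}) \<le> ennreal (((real n + 1) * r)\<^sup>2 * a n)"
      by (intro ennreal_leI mult_left_mono pa) simp
    then show "ennreal (((real n + 1) * r)\<^sup>2) * ennreal (prob {\<omega>\<in>space M. real n * r < norm (X \<omega>)}) \<le> ennreal (((real n + 1) * r)\<^sup>2 * a n)"
      by (subst ennreal_mult[symmetric]) auto
  qed
  also have "\<dots> = ennreal (\<Sum>n. ((real n + 1) * r)\<^sup>2 * a n)"
    by (rule suminf_ennreal2[OF _ sm]) (auto simp: a_def)
  also have "\<dots> < \<infinity>" by simp
  finally show ?thesis by (intro integrableI_bounded) auto
qed

end

section \<open>Maxima of weakly correlated Gaussian families\<close>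

abbreviation cov :: "'a measure \<Rightarrow> ('t \<Rightarrow> 'a \<Rightarrow> real) \<Rightarrow> 't \<Rightarrow> 't \<Rightarrow> real" where
  "cov M Y t s \<equiv> \<integral>\<omega>. Y t \<omega> * Y s \<omega> \<partial>M"

context prob_space
begin

text \<open>Cauchy-Schwarz for the number \<open>N\<close> of events that occur: \<open>N\<close>
  vanishes off the union, and expanding the square of \<open>indicator U - c * N\<close> gives the
  bound with the optimal \<open>c = S / Q\<close>.\<close>

lemma second_moment_union_bound:
  assumes L: "finite L" and A[measurable]: "\<And>t. t \<in> L \<Longrightarrow> A t \<in> sets M"
    and Q: "(\<Sum>t\<in>L. \<Sum>s\<in>L. prob (A t \<inter> A s)) \<le> Q" "Q > 0"
  shows "(\<Sum>t\<in>L. prob (A t))\<^sup>2 / Q \<le> prob (\<Union>t\<in>L. A t)"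
proof -
  define U where "U = (\<Union>t\<in>L. A t)"
  define S where "S = (\<Sum>t\<in>L. prob (A t))"
  define c where "c = S / Q"
  define N :: "'a \<Rightarrow> real" where "N \<omega> = (\<Sum>t\<in>L. indicator (A t) \<omega>)" for \<omega>
  have [measurable]: "U \<in> sets M" using L A unfolding U_def by (intro sets.finite_UN) auto
  have NU: "indicator U \<omega> * N \<omega> = N \<omega>" for \<omega>
    unfolding N_def sum_distrib_left by (intro sum.cong refl) (auto simp: U_def indicator_def)
  have N2: "(N \<omega>)\<^sup>2 = (\<Sum>t\<in>L. \<Sum>s\<in>L. indicator (A t \<inter> A s) \<omega>)" for \<omega>
    unfolding N_def power2_eq_square sum_product by (simp add: indicator_inter_arith)
  have iN: "integrable M N" "(\<integral>\<omega>. N \<omega> \<partial>M) = S"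
  proof -
    have i: "integrable M (\<lambda>\<omega>. indicator (A t) \<omega> :: real)" if "t \<in> L" for t
      using A[OF that] by (intro integrable_real_indicator) (auto simp: emeasure_eq_measure)
    show "integrable M N" unfolding N_def by (intro Bochner_Integration.integrable_sum i)
    have "(\<integral>\<omega>. N \<omega> \<partial>M) = (\<Sum>t\<in>L. \<integral>\<omega>. indicator (A t) \<omega> \<partial>M)"
      unfolding N_def by (intro Bochner_Integration.integral_sum i)
    also have "\<dots> = S"
      unfolding S_def by (intro sum.cong refl) (simp add: Int_absorb2 A sets.sets_into_space)
    finally show "(\<integral>\<omega>. N \<omega> \<partial>M) = S" .
  qed
  have iN2: "integrable M (\<lambda>\<omega>. (N \<omega>)\<^sup>2)" "(\<integral>\<omega>. (N \<omega>)\<^sup>2 \<partial>M) = (\<Sum>t\<in>L. \<Sum>s\<in>L. prob (A t \<inter> A s))"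
  proof -
    have i: "integrable M (\<lambda>\<omega>. indicator (A t \<inter> A s) \<omega> :: real)" if "t \<in> L" "s \<in> L" for t s
      using A[OF that(1)] A[OF that(2)] by (intro integrable_real_indicator) (auto simp: emeasure_eq_measure)
    show "integrable M (\<lambda>\<omega>. (N \<omega>)\<^sup>2)"
      unfolding N2 by (intro Bochner_Integration.integrable_sum i)
    have "(\<integral>\<omega>. (N \<omega>)\<^sup>2 \<partial>M) = (\<Sum>t\<in>L. \<integral>\<omega>. (\<Sum>s\<in>L. indicator (A t \<inter> A s) \<omega>) \<partial>M)"
      unfolding N2 by (intro Bochner_Integration.integral_sum Bochner_Integration.integrable_sum i)
    also have "\<dots> = (\<Sum>t\<in>L. \<Sum>s\<in>L. \<integral>\<omega>. indicator (A t \<inter> A s) \<omega> \<partial>M)"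
      by (intro sum.cong refl Bochner_Integration.integral_sum i)
    also have "\<dots> = (\<Sum>t\<in>L. \<Sum>s\<in>L. prob (A t \<inter> A s))"
      by (intro sum.cong refl) (simp add: Int_absorb2 A sets.sets_into_space inf.coboundedI1)
    finally show "(\<integral>\<omega>. (N \<omega>)\<^sup>2 \<partial>M) = (\<Sum>t\<in>L. \<Sum>s\<in>L. prob (A t \<inter> A s))" .
  qed
  have iU: "integrable M (indicator U :: 'a \<Rightarrow> real)"
    by (intro integrable_real_indicator) (auto simp: emeasure_eq_measure)
  have "0 \<le> (\<integral>\<omega>. (indicator U \<omega> - c * N \<omega>)\<^sup>2 \<partial>M)" by simp
  also have "(\<integral>\<omega>. (indicator U \<omega> - c * N \<omega>)\<^sup>2 \<partial>M) = (\<integral>\<omega>. indicator U \<omega> - 2 * c * N \<omega> + c\<^sup>2 * (N \<omega>)\<^sup>2 \<partial>M)"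
  proof (intro Bochner_Integration.integral_cong refl)
    fix \<omega>
    have "(indicator U \<omega> - c * N \<omega>)\<^sup>2 = (indicator U \<omega>)\<^sup>2 - 2 * c * (indicator U \<omega> * N \<omega>) + c\<^sup>2 * (N \<omega>)\<^sup>2"
      by (simp add: power2_eq_square algebra_simps)
    also have "(indicator U \<omega> :: real)\<^sup>2 = indicator U \<omega>" by (simp add: indicator_def)
    finally show "(indicator U \<omega> - c * N \<omega>)\<^sup>2 = indicator U \<omega> - 2 * c * N \<omega> + c\<^sup>2 * (N \<omega>)\<^sup>2" unfolding NU .
  qed
  also have "\<dots> = prob U - 2 * c * S + c\<^sup>2 * (\<Sum>t\<in>L. \<Sum>s\<in>L. prob (A t \<inter> A s))"
    using iU iN iN2 by simp
  also have "\<dots> \<le> prob U - 2 * c * S + c\<^sup>2 * Q"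
    using Q(1) by (intro add_left_mono mult_left_mono) auto
  also have "\<dots> = prob U - S\<^sup>2 / Q" unfolding c_def using Q(2) by (simp add: power2_eq_square field_simps)
  finally show ?thesis unfolding U_def S_def by simp
qed

text \<open>If both variables exceed \<open>u\<close>, their sum exceeds \<open>2 * u\<close>, and
  its variance is below \<open>2 * (1 + d)\<close>. For small \<open>d\<close> the bound is nearly
  the square of the one-dimensional tail bound.\<close>

lemma gaussian_joint_tail:
  assumes jg: "jointly_gaussian M {t, s} Y" and ts: "t \<noteq> s"
    and v: "(\<integral>\<omega>. (Y t \<omega>)\<^sup>2 \<partial>M) = 1" "(\<integral>\<omega>. (Y s \<omega>)\<^sup>2 \<partial>M) = 1"
    and r: "\<bar>cov M Y t s\<bar> < d" and u: "u \<ge> 0"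
  shows "prob {\<omega>\<in>space M. u < Y t \<omega> \<and> u < Y s \<omega>} \<le> exp (- u\<^sup>2 / (1 + d))"
proof -
  interpret gaussian_vector M "{t, s}" Y 1
    by unfold_locales (use jg v in auto)
  define Z where "Z \<omega> = Y t \<omega> + Y s \<omega>" for \<omega>
  have [measurable]: "Y t \<in> borel_measurable M" "Y s \<in> borel_measurable M" using Y_meas by auto
  have d: "d > 0" using r by linarith
  define e where "e k i = (if i = k then 1 else 0 :: real)" for k i :: 'b
  have ek: "comb (e t) = Y t" "comb (e s) = Y s" using ts by (auto simp: comb_def e_def)
  have c1: "(\<lambda>i. 1 * e t i + 1 * e s i) = (\<lambda>i. if i \<in> {t, s} then 1 else 0)" using ts by (auto simp: e_def)
  have c2: "comb (\<lambda>i. if i \<in> {t, s} then 1 else 0) = Z" unfolding comb_def Z_def using ts by auto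
  have Zg: "centered_gaussian_rv M Z" using comb_gauss[of "\<lambda>i. if i \<in> {t, s} then 1 else 0"] unfolding c2 .
  have "(\<integral>\<omega>. (Z \<omega>)\<^sup>2 \<partial>M) = 1 + 1 + 2 * cov M Y t s"
    using comb_sq_expand[of 1 "e t" 1 "e s"] unfolding c1 c2 ek v by simp
  also have "\<dots> \<le> 2 * (1 + d)"
    using r by (simp add: abs_less_iff)
  finally have vZ: "(\<integral>\<omega>. (Z \<omega>)\<^sup>2 \<partial>M) \<le> 2 * (1 + d)" .
  have "prob {\<omega>\<in>space M. u < Y t \<omega> \<and> u < Y s \<omega>} \<le> prob {\<omega>\<in>space M. 2 * u < Z \<omega>}"
  proof (rule finite_measure_mono)
    show "{\<omega>\<in>space M. 2 * u < Z \<omega>} \<in> sets M" unfolding Z_def by measurable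
  qed (auto simp: Z_def)
  also have "\<dots> \<le> exp (- (2 * u)\<^sup>2 / (2 * (2 * (1 + d))))"
    by (rule gaussian_tail[OF Zg vZ]) (use d u in auto)
  also have "- (2 * u)\<^sup>2 / (2 * (2 * (1 + d))) = - u\<^sup>2 / (1 + d)"
    using d by (simp add: power_mult_distrib divide_simps)
  finally show ?thesis .
qed

text \<open>Second moment bound for the number of exceedances. Pairs with covariance below
  \<open>d\<close> contribute the joint tail. Every index has at most \<open>D\<close> remaining
  partners, itself included, and such a pair costs no more than a single exceedance. The expected
  number, at least \<open>card L * q\<close>, provides the denominators.\<close>

lemma exceedance_probability:
  fixes Y :: "'t \<Rightarrow> 'a \<Rightarrow> real" and q d u :: real and D :: nat
  assumes jg: "\<And>L. finite L \<Longrightarrow> jointly_gaussian M L Y"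
    and v: "\<And>t. (\<integral>\<omega>. (Y t \<omega>)\<^sup>2 \<partial>M) = 1"
    and near: "\<And>t. finite {s. \<not> \<bar>cov M Y t s\<bar> < d}" "\<And>t. card {s. \<not> \<bar>cov M Y t s\<bar> < d} \<le> D"
    and d: "d < 1"
    and L: "finite L" "L \<noteq> {}" and u: "u \<ge> 0"
    and q: "q = exp (- (u + 1)\<^sup>2 / 2) / sqrt (2 * pi)"
  shows "1 \<le> prob {\<omega>\<in>space M. \<exists>t\<in>L. u < Y t \<omega>} * (exp (- u\<^sup>2 / (1 + d)) / q\<^sup>2 + D / (card L * q))"
proof -
  have q0: "q > 0" unfolding q by simp
  have Yg: "centered_gaussian_rv M (Y t)" for t
    using jointly_gaussian_component[OF jg, of "{t}" t] by simp
  have Ym[measurable]: "Y t \<in> borel_measurable M" for t using Yg[of t] by (simp add: centered_gaussian_rv_def)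
  define A where "A t = {\<omega>\<in>space M. u < Y t \<omega>}" for t
  have Am: "A t \<in> sets M" for t unfolding A_def by measurable
  define S where "S = (\<Sum>t\<in>L. prob (A t))"
  define n where "n = real (card L)"
  define e where "e = exp (- u\<^sup>2 / (1 + d))"
  have n: "n > 0" using L by (simp add: n_def card_gt_0_iff)
  have qA: "q \<le> prob (A t)" for t unfolding q A_def by (rule gaussian_tail_lower[OF Yg v u])
  have S: "n * q \<le> S" unfolding S_def n_def using qA sum_mono[of L "\<lambda>_. q" "\<lambda>t. prob (A t)"] by simp
  have S0: "S > 0" using S n q0 by (smt (verit) mult_pos_pos)
  have pair: "prob (A t \<inter> A s) \<le> e + (if \<bar>cov M Y t s\<bar> < d then 0 else prob (A t))" for t s
  proof (cases "\<bar>cov M Y t s\<bar> < d")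
    case True
    \<comment> \<open>The diagonal counts as strongly correlated, since its covariance is one and
      \<open>d < 1\<close>.\<close>
    have "t \<noteq> s" using True v[of t] d by (auto simp: power2_eq_square)
    have "A t \<inter> A s = {\<omega>\<in>space M. u < Y t \<omega> \<and> u < Y s \<omega>}" unfolding A_def by auto
    then show ?thesis using gaussian_joint_tail[OF jg \<open>t \<noteq> s\<close> v v True u] True by (simp add: e_def)
  next
    case False
    have "prob (A t \<inter> A s) \<le> prob (A t)" by (rule finite_measure_mono) (use Am in auto)
    moreover have "0 \<le> e" unfolding e_def by simp
    ultimately show ?thesis using False by simp
  qed
  have "(\<Sum>t\<in>L. \<Sum>s\<in>L. prob (A t \<inter> A s)) \<le> (\<Sum>t\<in>L. n * e + D * prob (A t))"
  proof (rule sum_mono)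
    fix t
    have "(\<Sum>s\<in>L. prob (A t \<inter> A s)) \<le> (\<Sum>s\<in>L. e + (if \<bar>cov M Y t s\<bar> < d then 0 else prob (A t)))"
      by (intro sum_mono pair)
    also have "\<dots> = n * e + (\<Sum>s\<in>{s\<in>L. \<not> \<bar>cov M Y t s\<bar> < d}. prob (A t))"
      unfolding sum.distrib n_def using L(1) by (simp add: sum.If_cases Collect_conj_eq Collect_neg_eq Int_commute)
    also have "(\<Sum>s\<in>{s\<in>L. \<not> \<bar>cov M Y t s\<bar> < d}. prob (A t)) \<le> D * prob (A t)"
    proof -
      have "card {s\<in>L. \<not> \<bar>cov M Y t s\<bar> < d} \<le> card {s. \<not> \<bar>cov M Y t s\<bar> < d}"
        by (rule card_mono[OF near(1)]) auto
      also have "\<dots> \<le> D" by (rule near(2))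
      finally show ?thesis by (simp add: mult_right_mono)
    qed
    finally show "(\<Sum>s\<in>L. prob (A t \<inter> A s)) \<le> n * e + D * prob (A t)" by simp
  qed
  also have "\<dots> = n\<^sup>2 * e + D * S"
    by (simp add: sum.distrib S_def n_def sum_distrib_left power2_eq_square)
  finally have EQ: "(\<Sum>t\<in>L. \<Sum>s\<in>L. prob (A t \<inter> A s)) \<le> n\<^sup>2 * e + D * S" .
  have Q0: "n\<^sup>2 * e + D * S > 0"
  proof -
    have "0 < n\<^sup>2 * e" using n by (simp add: e_def)
    moreover have "0 \<le> D * S" using S0 by simp
    ultimately show ?thesis by linarith
  qed
  define p where "p = prob (\<Union>t\<in>L. A t)"
  have "S\<^sup>2 / (n\<^sup>2 * e + D * S) \<le> p"
    unfolding p_def S_def by (rule second_moment_union_bound[OF L(1) Am EQ[unfolded S_def] Q0[unfolded S_def]])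
  then have "S\<^sup>2 \<le> p * (n\<^sup>2 * e + D * S)" using Q0 by (simp add: field_simps)
  then have "1 \<le> p * (n\<^sup>2 * e + D * S) / S\<^sup>2" using S0 by (simp add: field_simps)
  also have "\<dots> = p * (n\<^sup>2 * e / S\<^sup>2 + D / S)" using S0 by (simp add: field_simps power2_eq_square)
  also have "\<dots> \<le> p * (e / q\<^sup>2 + D / (n * q))"
  proof (intro mult_left_mono add_mono)
    have "n\<^sup>2 * e / S\<^sup>2 \<le> n\<^sup>2 * e / (n * q)\<^sup>2"
      using S S0 n q0 by (intro divide_left_mono power_mono) (auto simp: e_def)
    also have "\<dots> = e / q\<^sup>2" using n by (simp add: power_mult_distrib)
    finally show "n\<^sup>2 * e / S\<^sup>2 \<le> e / q\<^sup>2" .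
    show "D / S \<le> D / (n * q)" using S S0 n q0 by (intro divide_left_mono) auto
  qed (simp add: p_def)
  also have "p = prob {\<omega>\<in>space M. \<exists>t\<in>L. u < Y t \<omega>}"
    unfolding p_def A_def by (rule arg_cong[where f = prob]) auto
  finally show ?thesis unfolding e_def n_def .
qed

text \<open>Write \<open>l = ln n\<close> and \<open>b = bfun n\<close>. The second moment bound
  gives probability at least \<open>exp (- 3 * d * l)\<close> of exceeding
  \<open>(1 - e) * b\<close>. Concentration between this level and \<open>(1 - 2 * e) * b\<close>
  limits the product to \<open>exp (- 4 * e\<^sup>2 * l / pi\<^sup>2)\<close>. The quotient is a
  negative power of \<open>n\<close>, summable along powers of two.\<close>

lemma maximum_lower_bound:
  fixes Y :: "'t \<Rightarrow> 'a \<Rightarrow> real"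
  assumes gauss: "\<And>L. finite L \<Longrightarrow> jointly_gaussian M L Y"
    and v: "\<And>t. (\<integral>\<omega>. (Y t \<omega>)\<^sup>2 \<partial>M) = 1"
    and near: "\<And>d. d > 0 \<Longrightarrow> \<exists>D. \<forall>t. finite {s. \<not> \<bar>cov M Y t s\<bar> < d} \<and> card {s. \<not> \<bar>cov M Y t s\<bar> < d} \<le> D"
    and e: "0 < e" "e < 1/2"
  shows "\<exists>k>0. \<exists>N. \<forall>L. finite L \<longrightarrow> N \<le> card L \<longrightarrow>
    prob {\<omega>\<in>space M. \<forall>t\<in>L. Y t \<omega> \<le> (1 - 2 * e) * bfun (card L)} \<le> exp (- k * ln (card L))"
proof -
  \<comment> \<open>The divisor makes \<open>3 * d = e\<^sup>2 / 5\<close>, below the concentration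
    exponent \<open>4 * e\<^sup>2 / pi\<^sup>2\<close>, which exceeds \<open>e\<^sup>2 / 4\<close>.
    The gap \<open>1/4 - 1/5\<close> is the \<open>1/20\<close> of the final rate.\<close>
  define d where "d = e\<^sup>2 / 15"
  have d: "d > 0" "d < 1" using e power_mono[of e 1 2] by (auto simp: d_def)
  obtain D where D: "\<And>t. finite {s. \<not> \<bar>cov M Y t s\<bar> < d}"
      "\<And>t. card {s. \<not> \<bar>cov M Y t s\<bar> < d} \<le> D"
    using near[OF d(1)] by blast
  \<comment> \<open>This condition absorbs the prefactor and the cross term of
    \<open>(u + 1)\<^sup>2\<close>. The next one absorbs the strongly correlated pairs, whose share
    decays like \<open>n\<close> to the power \<open>- e\<close> up to a subpolynomial
    factor.\<close>
  have "eventually (\<lambda>n::nat. ln (4 * pi) + 2 * sqrt (2 * ln n) + 1 \<le> d * ln n) sequentially"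
    using d(1) by real_asymp
  moreover have "eventually (\<lambda>n::nat. (D + 1) * sqrt (2 * pi) * exp (sqrt (2 * ln n) + 1/2 - e * ln n) \<le> 1/2) sequentially"
    using e(1) by real_asymp
  moreover have "eventually (\<lambda>n::nat. n \<ge> 2) sequentially" by (rule eventually_ge_at_top)
  ultimately have "eventually (\<lambda>n::nat. n \<ge> 2 \<and> ln (4 * pi) + 2 * sqrt (2 * ln (real n)) + 1 \<le> d * ln (real n) \<and>
      (D + 1) * sqrt (2 * pi) * exp (sqrt (2 * ln n) + 1/2 - e * ln n) \<le> 1/2) sequentially"
    by eventually_elim auto
  then obtain N :: nat where N: "\<forall>n\<ge>N. n \<ge> 2 \<and> ln (4 * pi) + 2 * sqrt (2 * ln (real n)) + 1 \<le> d * ln (real n) \<and>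
      (D + 1) * sqrt (2 * pi) * exp (sqrt (2 * ln (real n)) + 1/2 - e * ln (real n)) \<le> 1/2"
    unfolding eventually_sequentially by (rule exE)
  have "prob {\<omega>\<in>space M. \<forall>t\<in>L. Y t \<omega> \<le> (1 - 2 * e) * bfun (card L)} \<le> exp (- (e\<^sup>2 / 20) * ln (card L))"
    if L: "finite L" "N \<le> card L" for L
  proof -
    define n where "n = card L"
    define l where "l = ln (real n)"
    define b where "b = sqrt (2 * l)"
    note Nn = N[rule_format, OF L(2), folded n_def, folded l_def, folded b_def]
    have n2: "n \<ge> 2" using Nn by blast
    have l0: "l > 0" using n2 by (simp add: l_def)
    have bb: "bfun n = b" using n2 by (simp add: bfun_def b_def l_def max_absorb1)
    have b2: "b\<^sup>2 = 2 * l" and b0: "b > 0" using l0 by (auto simp: b_def)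
    have expl: "exp l = n" using n2 by (simp add: l_def)
    define u where "u = (1 - e) * b"
    have u0: "u \<ge> 0" and ub: "u \<le> b" using e b0 by (auto simp: u_def mult_le_cancel_right1)
    define q where "q = exp (- (u + 1)\<^sup>2 / 2) / sqrt (2 * pi)"
    have Lne: "L \<noteq> {}" using n2 by (auto simp: n_def)
    interpret gaussian_vector M L Y 1
      by unfold_locales (use L Lne gauss v in auto)
    define p where "p = prob {\<omega>\<in>space M. u < mx Y \<omega>}"
    have pU: "{\<omega>\<in>space M. \<exists>t\<in>L. u < Y t \<omega>} = {\<omega>\<in>space M. u < mx Y \<omega>}"
      unfolding mx_def using L Lne by (auto simp: Max_gr_iff)
    have E: "1 \<le> p * (exp (- u\<^sup>2 / (1 + d)) / q\<^sup>2 + D / (n * q))"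
      using exceedance_probability[OF gauss v D d(2) L(1) Lne u0 q_def] unfolding pU p_def n_def .
    have t1: "exp (- u\<^sup>2 / (1 + d)) / q\<^sup>2 \<le> 1/2 * exp (3 * d * l)"
    proof -
      have q2: "q\<^sup>2 = exp (- (u + 1)\<^sup>2) / (2 * pi)"
        unfolding q_def by (simp add: power_divide flip: exp_double)
      have "u\<^sup>2 - u\<^sup>2 / (1 + d) = d * u\<^sup>2 / (1 + d)" using d by (simp add: field_simps)
      also have "\<dots> \<le> d * u\<^sup>2 / 1" using d by (intro divide_left_mono) auto
      also have "\<dots> \<le> d * b\<^sup>2" using d u0 ub by (auto intro!: mult_left_mono power_mono)
      finally have h1: "u\<^sup>2 - u\<^sup>2 / (1 + d) \<le> 2 * d * l" by (simp add: b2)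
      have "exp (- u\<^sup>2 / (1 + d)) / q\<^sup>2 = 2 * pi * exp (- u\<^sup>2 / (1 + d) + (u + 1)\<^sup>2)"
        unfolding q2 exp_add exp_minus[of "(u + 1)\<^sup>2"]
        by (simp only: divide_inverse inverse_mult_distrib inverse_inverse_eq ac_simps)
      also have "\<dots> \<le> 2 * pi * exp (3 * d * l - ln (4 * pi))"
      proof -
        have "- u\<^sup>2 / (1 + d) + (u + 1)\<^sup>2 \<le> 2 * b + 1 + 2 * d * l"
          using h1 ub by (simp add: power2_sum)
        also have "\<dots> \<le> 3 * d * l - ln (4 * pi)" using Nn by linarith
        finally show ?thesis by simp
      qed
      also have "2 * pi * exp (3 * d * l - ln (4 * pi)) = 1/2 * exp (3 * d * l)"
        by (simp add: exp_diff)
      finally show ?thesis by simp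
    qed
    have t2: "D / (n * q) \<le> 1/2 * exp (3 * d * l)"
    proof -
      have "(1 - e)\<^sup>2 \<le> 1 - e" using e by (simp add: power2_eq_square mult_left_le)
      then have "(1 - e)\<^sup>2 * (2 * l) \<le> (1 - e) * (2 * l)" using l0 by (intro mult_right_mono) auto
      then have "(u + 1)\<^sup>2 / 2 \<le> (1 - e) * l + b + 1/2"
        using ub by (simp add: power2_sum u_def power_mult_distrib b2)
      then have h2: "(u + 1)\<^sup>2 / 2 - l \<le> b + 1/2 - e * l" by (simp add: algebra_simps)
      have "D / (n * q) = D * sqrt (2 * pi) * exp ((u + 1)\<^sup>2 / 2 - l)"
        unfolding q_def exp_diff expl minus_divide_left[symmetric] exp_minus[of "(u + 1)\<^sup>2 / 2"]
        by (simp only: divide_inverse inverse_mult_distrib inverse_inverse_eq ac_simps)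
      also have "\<dots> \<le> (D + 1) * sqrt (2 * pi) * exp (b + 1/2 - e * l)"
        using h2 by (intro mult_mono) auto
      also have "\<dots> \<le> 1/2 * 1" using Nn by simp
      also have "\<dots> \<le> 1/2 * exp (3 * d * l)" using d l0 by (intro mult_left_mono) auto
      finally show ?thesis .
    qed
    have "p * (exp (- u\<^sup>2 / (1 + d)) / q\<^sup>2 + D / (n * q)) \<le> p * exp (3 * d * l)"
      by (rule mult_left_mono) (use add_mono[OF t1 t2] in \<open>simp_all add: p_def\<close>)
    with E have p1: "1 \<le> p * exp (3 * d * l)" by linarith
    define r where "r = prob {\<omega>\<in>space M. mx Y \<omega> \<le> (1 - 2 * e) * b}"
    have "p * r \<le> exp (- 2 * (u - (1 - 2 * e) * b)\<^sup>2 / (pi\<^sup>2 * 1))"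
      unfolding p_def r_def by (rule concentration) (use e b0 in \<open>auto simp: u_def\<close>)
    also have "u - (1 - 2 * e) * b = e * b" by (simp add: u_def algebra_simps)
    finally have pr: "p * r \<le> exp (- 4 * e\<^sup>2 * l / pi\<^sup>2)" by (simp add: power_mult_distrib b2 mult.assoc)
    have r0: "r \<ge> 0" by (simp add: r_def)
    have "r \<le> r * (p * exp (3 * d * l))" using mult_left_mono[OF p1 r0] by simp
    also have "\<dots> = (p * r) * exp (3 * d * l)" by simp
    also have "\<dots> \<le> exp (- 4 * e\<^sup>2 * l / pi\<^sup>2) * exp (3 * d * l)" using pr by (intro mult_right_mono) auto
    also have "\<dots> \<le> exp (- (e\<^sup>2 / 20) * l)"
    proof -
      have "pi\<^sup>2 < 4\<^sup>2" using pi_less_4 pi_gt_zero by (intro power_strict_mono) auto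
      then have "4 * e\<^sup>2 * l / 16 \<le> 4 * e\<^sup>2 * l / pi\<^sup>2" using l0 by (intro divide_left_mono) auto
      then have "e\<^sup>2 * l / 4 \<le> 4 * e\<^sup>2 * l / pi\<^sup>2" by (simp only: mult.assoc)
      then have "- (4 * e\<^sup>2 * l / pi\<^sup>2) + e\<^sup>2 * l / 5 \<le> - (e\<^sup>2 * l / 20)" by linarith
      moreover have "- 4 * e\<^sup>2 * l / pi\<^sup>2 + 3 * d * l = - (4 * e\<^sup>2 * l / pi\<^sup>2) + e\<^sup>2 * l / 5"
        by (simp add: d_def)
      ultimately have "- 4 * e\<^sup>2 * l / pi\<^sup>2 + 3 * d * l \<le> - (e\<^sup>2 * l / 20)" by (simp only:)
      then show ?thesis unfolding exp_add[symmetric] exp_le_cancel_iff by simp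
    qed
    also have "r = prob {\<omega>\<in>space M. \<forall>t\<in>L. Y t \<omega> \<le> (1 - 2 * e) * bfun (card L)}"
      unfolding r_def mx_def bb[unfolded n_def] using L Lne by simp
    finally show ?thesis unfolding l_def n_def .
  qed
  moreover have "e\<^sup>2 / 20 > 0" using e by simp
  ultimately show ?thesis by blast
qed

end

section \<open>The concentration ellipsoid\<close>

definition sd :: "'b::real_normed_vector measure \<Rightarrow> ('b \<Rightarrow> real) \<Rightarrow> real" where
  "sd P f = sqrt (\<integral>x. (f x)\<^sup>2 \<partial>P)"

lemma sd_nonneg: "sd P f \<ge> 0"
  unfolding sd_def by simp

context gaussian_element
begin

abbreviation law :: "'b measure" where "law \<equiv> distr M borel X"

lemma law_norm_square: "integrable law (\<lambda>x. (norm x)\<^sup>2)"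
  by (subst integrable_distr_eq) (use norm_square_integrable in auto)

lemma functional_measurable[measurable]:
  fixes f :: "'b \<Rightarrow> real"
  shows "bounded_linear f \<Longrightarrow> f \<in> borel_measurable borel"
  by (intro borel_measurable_continuous_onI linear_continuous_on)

lemma sd_law:
  fixes f :: "'b \<Rightarrow> real"
  assumes "bounded_linear f" shows "(sd law f)\<^sup>2 = (\<integral>\<omega>. (f (X \<omega>))\<^sup>2 \<partial>M)"
  unfolding sd_def using functional_measurable[OF assms] by (subst integral_distr) auto

lemma sd_law_square: "(sd law f)\<^sup>2 = (\<integral>x. (f x)\<^sup>2 \<partial>law)"
  unfolding sd_def by simp

lemma functional_square_integrable:
  fixes f :: "'b \<Rightarrow> real"
  assumes "bounded_linear f" shows "integrable law (\<lambda>x. (f x)\<^sup>2)"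
  using functional_measurable[OF assms] gaussian_square_integrable[OF X_gauss[OF assms]]
  by (subst integrable_distr_eq) auto

text \<open>A Bochner integral without integrability is zero by convention; this shows that the
  vectors in the definition of the ellipsoid are genuine integrals.\<close>

lemma weighted_integrable:
  assumes "\<xi> \<in> borel_measurable law" "integrable law (\<lambda>x. (\<xi> x)\<^sup>2)"
  shows "integrable law (\<lambda>x. \<xi> x *\<^sub>R x)"
proof (rule Bochner_Integration.integrable_bound)
  show "integrable law (\<lambda>x. (\<xi> x)\<^sup>2 + (norm x)\<^sup>2)" using assms law_norm_square by simp
  have [measurable]: "\<xi> \<in> borel_measurable borel" using assms(1) by simp
  show "(\<lambda>x. \<xi> x *\<^sub>R x) \<in> borel_measurable law" by measurable
  have "norm (\<xi> x *\<^sub>R x) \<le> norm ((\<xi> x)\<^sup>2 + (norm x)\<^sup>2)" for x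
    using abs_mult_le_sum_squares[of "\<xi> x" "norm x"] by (simp add: abs_mult)
  then show "AE x in law. norm (\<xi> x *\<^sub>R x) \<le> norm ((\<xi> x)\<^sup>2 + (norm x)\<^sup>2)" by simp
qed

text \<open>Cauchy-Schwarz as a weighted arithmetic-geometric mean inequality with free parameter
  \<open>c\<close>: taking \<open>c\<close> as the standard deviation gives the bound, and
  arbitrarily small \<open>c\<close> settles the degenerate case.\<close>

lemma ellipsoid_le_sd:
  fixes f :: "'b \<Rightarrow> real"
  assumes f: "bounded_linear f" and h: "h \<in> conc_ellipsoid law"
  shows "f h \<le> sd law f"
proof -
  obtain \<xi> where \<xi>: "h = (\<integral>x. \<xi> x *\<^sub>R x \<partial>law)" "\<xi> \<in> L2_dual_closure law" "(\<integral>x. (\<xi> x)\<^sup>2 \<partial>law) \<le> 1"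
    using h unfolding conc_ellipsoid_def by blast
  have m[measurable]: "\<xi> \<in> borel_measurable law" and i: "integrable law (\<lambda>x. (\<xi> x)\<^sup>2)"
    using \<xi>(2) by (auto simp: L2_dual_closure_def)
  have w: "integrable law (\<lambda>x. \<xi> x *\<^sub>R x)" by (rule weighted_integrable[OF m i])
  have fs: "f (r *\<^sub>R x) = r * f x" for r x using linear_simps[OF f] by simp
  have fh: "f h = (\<integral>x. \<xi> x * f x \<partial>law)"
    unfolding \<xi>(1) integral_bounded_linear[OF f w, symmetric] fs ..
  have wi: "integrable law (\<lambda>x. \<xi> x * f x)"
    using integrable_bounded_linear[OF f w] unfolding fs .
  have bound: "f h \<le> (c + (sd law f)\<^sup>2 / c) / 2" if c: "c > 0" for c
  proof -
    have pw: "\<xi> x * f x \<le> (c * (\<xi> x)\<^sup>2 + (f x)\<^sup>2 / c) / 2" for x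
    proof -
      have "0 \<le> (c * \<xi> x - f x)\<^sup>2 / c" using c by simp
      also have "\<dots> = c * (\<xi> x)\<^sup>2 + (f x)\<^sup>2 / c - 2 * (\<xi> x * f x)"
        using c by (simp add: power2_eq_square field_simps)
      finally show ?thesis by simp
    qed
    have "f h \<le> (\<integral>x. (c * (\<xi> x)\<^sup>2 + (f x)\<^sup>2 / c) / 2 \<partial>law)"
      unfolding fh using wi i functional_square_integrable[OF f] pw
      by (intro integral_mono) auto
    also have "\<dots> = (c * (\<integral>x. (\<xi> x)\<^sup>2 \<partial>law) + (sd law f)\<^sup>2 / c) / 2"
      unfolding sd_law_square using i functional_square_integrable[OF f] by simp
    also have "\<dots> \<le> (c * 1 + (sd law f)\<^sup>2 / c) / 2"
      using c \<xi>(3) by (intro divide_right_mono add_right_mono mult_left_mono) auto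
    finally show ?thesis by simp
  qed
  show ?thesis
  proof (cases "sd law f = 0")
    case True
    have "f h \<le> 0 + e" if "e > 0" for e using bound[OF that] True that by simp
    then have "f h \<le> 0" by (rule field_le_epsilon)
    then show ?thesis using True by simp
  next
    case False
    then have "sd law f > 0" using sd_nonneg[of law f] by simp
    from bound[OF this] this show ?thesis by (simp add: power2_eq_square)
  qed
qed

lemma functional_in_closure:
  fixes f :: "'b \<Rightarrow> real"
  assumes "bounded_linear f" shows "f \<in> L2_dual_closure law"
  unfolding L2_dual_closure_def
  using functional_measurable[OF assms] functional_square_integrable[OF assms] assms
  by (auto simp: dual_elem_def intro!: exI[of _ "\<lambda>_. f"])

lemma zero_in_ellipsoid: "0 \<in> conc_ellipsoid law"
proof -
  have "(\<lambda>_. 0) \<in> L2_dual_closure law" by (rule functional_in_closure) simp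
  then show ?thesis unfolding conc_ellipsoid_def by (force intro!: exI[of _ "\<lambda>_. 0"])
qed

text \<open>Equality in Cauchy-Schwarz: the extremal density is \<open>f\<close> divided by its
  standard deviation, which is itself a functional and hence lies in the closure.\<close>

lemma ellipsoid_attains_sd:
  fixes f :: "'b \<Rightarrow> real"
  assumes f: "bounded_linear f"
  shows "\<exists>h\<in>conc_ellipsoid law. f h = sd law f"
proof (cases "sd law f = 0")
  case True
  then show ?thesis using zero_in_ellipsoid linear_simps(3)[OF f] by (intro bexI[of _ 0]) auto
next
  case False
  then have s: "sd law f > 0" using sd_nonneg[of law f] by simp
  define \<xi> where "\<xi> x = f x / sd law f" for x
  have bl: "bounded_linear \<xi>" unfolding \<xi>_def
    using bounded_linear_divide[THEN bounded_linear_compose, OF f] .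
  have c: "\<xi> \<in> L2_dual_closure law" by (rule functional_in_closure[OF bl])
  have "(\<integral>x. (\<xi> x)\<^sup>2 \<partial>law) = (\<integral>x. (f x)\<^sup>2 \<partial>law) / (sd law f)\<^sup>2"
    unfolding \<xi>_def by (simp add: power_divide)
  then have one: "(\<integral>x. (\<xi> x)\<^sup>2 \<partial>law) = 1" using s by (simp add: sd_law_square[symmetric])
  have mem: "(\<integral>x. \<xi> x *\<^sub>R x \<partial>law) \<in> conc_ellipsoid law"
    unfolding conc_ellipsoid_def using c one by (intro CollectI exI[of _ \<xi>]) auto
  have w: "integrable law (\<lambda>x. \<xi> x *\<^sub>R x)"
    by (rule weighted_integrable) (use c in \<open>auto simp: L2_dual_closure_def\<close>)
  have "f (\<integral>x. \<xi> x *\<^sub>R x \<partial>law) = (\<integral>x. (f x)\<^sup>2 / sd law f \<partial>law)"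
    unfolding integral_bounded_linear[OF f w, symmetric]
    by (rule arg_cong[where f = "integral\<^sup>L law"]) (use linear_simps[OF f] in \<open>auto simp: \<xi>_def power2_eq_square\<close>)
  also have "\<dots> = (sd law f)\<^sup>2 / sd law f" unfolding sd_law_square by simp
  also have "\<dots> = sd law f" using s by (simp add: power2_eq_square)
  finally show ?thesis using mem by blast
qed

text \<open>Read off at a point of the ellipsoid where \<open>g\<close> attains its standard
  deviation, by writing \<open>g\<close> as \<open>f\<close> plus \<open>g - f\<close>.\<close>

lemma sd_triangle:
  fixes f g :: "'b \<Rightarrow> real"
  assumes "bounded_linear f" "bounded_linear g"
  shows "sd law g \<le> sd law f + sd law (\<lambda>x. g x - f x)"
proof -
  obtain h where h: "h \<in> conc_ellipsoid law" "g h = sd law g" using ellipsoid_attains_sd[OF assms(2)] by blast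
  show ?thesis
    using ellipsoid_le_sd[OF assms(1) h(1)] ellipsoid_le_sd[OF bounded_linear_sub[OF assms(2,1)] h(1)] h(2) by simp
qed

text \<open>Together with the triangle inequality this makes functionals that are uniformly close on
  \<open>K\<close> close in standard deviation, so one net controls both support functions.\<close>

lemma sd_le_sup_body:
  fixes f :: "'b \<Rightarrow> real"
  assumes f: "bounded_linear f" and e: "e > 0" and le: "\<And>y. y \<in> K \<Longrightarrow> \<bar>f y\<bar> \<le> e"
  shows "sd law f \<le> 2 * e"
proof -
  have bl: "bounded_linear (\<lambda>x. f x / e)"
    using bounded_linear_divide[THEN bounded_linear_compose, OF f] .
  have "(\<integral>\<omega>. (f (X \<omega>) / e)\<^sup>2 \<partial>M) \<le> 4"
    by (rule variance_le_polar[OF bl]) (use le e in auto)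
  then have "(\<integral>\<omega>. (f (X \<omega>))\<^sup>2 \<partial>M) / e\<^sup>2 \<le> 4" by (simp add: power_divide)
  then have "(sd law f)\<^sup>2 \<le> (2 * e)\<^sup>2" using e by (simp add: sd_law[OF f] field_simps)
  then show ?thesis using e by (intro power2_le_imp_le[of "sd law f"]) auto
qed

text \<open>Convexity permits Hahn-Banach separation from the ellipsoid. One pointwise inequality,
  convexity of the square, controls integrability and norm of the combined density as well as its
  approximation by functionals.\<close>

lemma convex_ellipsoid: "convex (conc_ellipsoid law)"
proof (rule convexI)
  fix h1 h2 and u v :: real
  assume h: "h1 \<in> conc_ellipsoid law" "h2 \<in> conc_ellipsoid law" and uv: "0 \<le> u" "0 \<le> v" "u + v = 1"
  obtain \<xi> where \<xi>: "h1 = (\<integral>x. \<xi> x *\<^sub>R x \<partial>law)" "\<xi> \<in> L2_dual_closure law" "(\<integral>x. (\<xi> x)\<^sup>2 \<partial>law) \<le> 1"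
    using h(1) unfolding conc_ellipsoid_def by blast
  obtain \<zeta> where \<zeta>: "h2 = (\<integral>x. \<zeta> x *\<^sub>R x \<partial>law)" "\<zeta> \<in> L2_dual_closure law" "(\<integral>x. (\<zeta> x)\<^sup>2 \<partial>law) \<le> 1"
    using h(2) unfolding conc_ellipsoid_def by blast
  obtain f where f: "\<xi> \<in> borel_measurable law" "integrable law (\<lambda>x. (\<xi> x)\<^sup>2)" "\<And>n. dual_elem (f n)"
      "(\<lambda>n. \<integral>x. (\<xi> x - f n x)\<^sup>2 \<partial>law) \<longlonglongrightarrow> 0" using \<xi>(2) unfolding L2_dual_closure_def by blast
  obtain g where g: "\<zeta> \<in> borel_measurable law" "integrable law (\<lambda>x. (\<zeta> x)\<^sup>2)" "\<And>n. dual_elem (g n)"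
      "(\<lambda>n. \<integral>x. (\<zeta> x - g n x)\<^sup>2 \<partial>law) \<longlonglongrightarrow> 0" using \<zeta>(2) unfolding L2_dual_closure_def by blast
  have [measurable]: "\<xi> \<in> borel_measurable borel" "\<zeta> \<in> borel_measurable borel" using f(1) g(1) by auto
  have cvx: "(u * a + v * b)\<^sup>2 \<le> u * a\<^sup>2 + v * b\<^sup>2" for a b :: real
  proof -
    \<comment> \<open>The last term vanishes because \<open>u + v = 1\<close>; keeping it makes this
      a polynomial identity.\<close>
    have "u * a\<^sup>2 + v * b\<^sup>2 - (u * a + v * b)\<^sup>2 = u * v * (a - b)\<^sup>2 + (1 - (u + v)) * (u * a\<^sup>2 + v * b\<^sup>2)"
      by (simp add: power2_eq_square algebra_simps)
    also have "\<dots> \<ge> 0" using uv by simp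
    finally show ?thesis by simp
  qed
  define \<theta> where "\<theta> x = u * \<xi> x + v * \<zeta> x" for x
  have m\<theta>[measurable]: "\<theta> \<in> borel_measurable law" unfolding \<theta>_def by measurable
  have i\<theta>: "integrable law (\<lambda>x. (\<theta> x)\<^sup>2)"
  proof (rule Bochner_Integration.integrable_bound)
    show "integrable law (\<lambda>x. u * (\<xi> x)\<^sup>2 + v * (\<zeta> x)\<^sup>2)" using f(2) g(2) by simp
    have "norm ((\<theta> x)\<^sup>2) \<le> norm (u * (\<xi> x)\<^sup>2 + v * (\<zeta> x)\<^sup>2)" for x
      using cvx[of "\<xi> x" "\<zeta> x"] unfolding \<theta>_def by simp
    then show "AE x in law. norm ((\<theta> x)\<^sup>2) \<le> norm (u * (\<xi> x)\<^sup>2 + v * (\<zeta> x)\<^sup>2)" by simp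
  qed measurable
  have n\<theta>: "(\<integral>x. (\<theta> x)\<^sup>2 \<partial>law) \<le> 1"
  proof -
    have "(\<integral>x. (\<theta> x)\<^sup>2 \<partial>law) \<le> (\<integral>x. u * (\<xi> x)\<^sup>2 + v * (\<zeta> x)\<^sup>2 \<partial>law)"
      by (rule integral_mono) (use i\<theta> f(2) g(2) cvx in \<open>auto simp: \<theta>_def\<close>)
    also have "\<dots> = u * (\<integral>x. (\<xi> x)\<^sup>2 \<partial>law) + v * (\<integral>x. (\<zeta> x)\<^sup>2 \<partial>law)" using f(2) g(2) by simp
    also have "\<dots> \<le> u * 1 + v * 1" using uv \<xi>(3) \<zeta>(3) by (intro add_mono mult_left_mono) auto
    finally show ?thesis using uv by simp
  qed
  define k where "k n x = u * f n x + v * g n x" for n x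
  have blf: "bounded_linear (f n)" "bounded_linear (g n)" for n using f(3) g(3) by (auto simp: dual_elem_def)
  have k: "dual_elem (k n)" for n
    unfolding dual_elem_def k_def by (intro bounded_linear_add bounded_linear_const_mult blf)
  have idiff: "integrable law (\<lambda>x. (\<alpha> x - p x)\<^sup>2)"
    if "bounded_linear p" and a[measurable]: "\<alpha> \<in> borel_measurable borel" and "integrable law (\<lambda>x. (\<alpha> x)\<^sup>2)" for \<alpha> p :: "'b \<Rightarrow> real"
  proof (rule Bochner_Integration.integrable_bound)
    show "integrable law (\<lambda>x. 2 * (\<alpha> x)\<^sup>2 + 2 * (p x)\<^sup>2)"
      using that functional_square_integrable[OF that(1)] by simp
    have [measurable]: "p \<in> borel_measurable borel" by (rule functional_measurable[OF that(1)])
    show "(\<lambda>x. (\<alpha> x - p x)\<^sup>2) \<in> borel_measurable law" by measurable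
    have "(a - b)\<^sup>2 \<le> 2 * a\<^sup>2 + 2 * b\<^sup>2" for a b :: real
      using zero_le_power2[of "a + b"] by (simp add: power2_eq_square algebra_simps)
    then show "AE x in law. norm ((\<alpha> x - p x)\<^sup>2) \<le> norm (2 * (\<alpha> x)\<^sup>2 + 2 * (p x)\<^sup>2)" by simp
  qed
  have "(\<lambda>n. \<integral>x. (\<theta> x - k n x)\<^sup>2 \<partial>law) \<longlonglongrightarrow> 0"
  proof (rule tendsto_sandwich[OF _ _ tendsto_const])
    show "\<forall>\<^sub>F n in sequentially. 0 \<le> (\<integral>x. (\<theta> x - k n x)\<^sup>2 \<partial>law)" by simp
    have "(\<integral>x. (\<theta> x - k n x)\<^sup>2 \<partial>law) \<le> u * (\<integral>x. (\<xi> x - f n x)\<^sup>2 \<partial>law) + v * (\<integral>x. (\<zeta> x - g n x)\<^sup>2 \<partial>law)" for n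
    proof -
      have i1: "integrable law (\<lambda>x. (\<xi> x - f n x)\<^sup>2)" by (rule idiff) (use blf f in auto)
      have i2: "integrable law (\<lambda>x. (\<zeta> x - g n x)\<^sup>2)" by (rule idiff) (use blf g in auto)
      have "(\<integral>x. (\<theta> x - k n x)\<^sup>2 \<partial>law) \<le> (\<integral>x. u * (\<xi> x - f n x)\<^sup>2 + v * (\<zeta> x - g n x)\<^sup>2 \<partial>law)"
      proof (rule integral_mono)
        show "integrable law (\<lambda>x. (\<theta> x - k n x)\<^sup>2)"
          by (rule idiff) (use k i\<theta> m\<theta> in \<open>auto simp: dual_elem_def\<close>)
        show "integrable law (\<lambda>x. u * (\<xi> x - f n x)\<^sup>2 + v * (\<zeta> x - g n x)\<^sup>2)" using i1 i2 by simp
        show "(\<theta> x - k n x)\<^sup>2 \<le> u * (\<xi> x - f n x)\<^sup>2 + v * (\<zeta> x - g n x)\<^sup>2" for x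
          using cvx[of "\<xi> x - f n x" "\<zeta> x - g n x"] by (simp add: \<theta>_def k_def algebra_simps)
      qed
      then show ?thesis using i1 i2 by simp
    qed
    then show "\<forall>\<^sub>F n in sequentially. (\<integral>x. (\<theta> x - k n x)\<^sup>2 \<partial>law) \<le> u * (\<integral>x. (\<xi> x - f n x)\<^sup>2 \<partial>law) + v * (\<integral>x. (\<zeta> x - g n x)\<^sup>2 \<partial>law)"
      by simp
    have "(\<lambda>n. u * (\<integral>x. (\<xi> x - f n x)\<^sup>2 \<partial>law) + v * (\<integral>x. (\<zeta> x - g n x)\<^sup>2 \<partial>law)) \<longlonglongrightarrow> u * 0 + v * 0"
      by (intro tendsto_add tendsto_mult tendsto_const f(4) g(4))
    then show "(\<lambda>n. u * (\<integral>x. (\<xi> x - f n x)\<^sup>2 \<partial>law) + v * (\<integral>x. (\<zeta> x - g n x)\<^sup>2 \<partial>law)) \<longlonglongrightarrow> 0" by simp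
  qed
  then have c: "\<theta> \<in> L2_dual_closure law" using m\<theta> i\<theta> k unfolding L2_dual_closure_def by blast
  have "(\<integral>x. \<theta> x *\<^sub>R x \<partial>law) = (\<integral>x. u *\<^sub>R (\<xi> x *\<^sub>R x) + v *\<^sub>R (\<zeta> x *\<^sub>R x) \<partial>law)"
    by (simp add: \<theta>_def scaleR_add_left)
  also have "\<dots> = (\<integral>x. u *\<^sub>R (\<xi> x *\<^sub>R x) \<partial>law) + (\<integral>x. v *\<^sub>R (\<zeta> x *\<^sub>R x) \<partial>law)"
    by (intro Bochner_Integration.integral_add integrable_scaleR_right weighted_integrable f(1,2) g(1,2))
  also have "\<dots> = u *\<^sub>R h1 + v *\<^sub>R h2"
    unfolding \<xi>(1) \<zeta>(1) by (simp only: integral_scaleR_right)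
  finally have "u *\<^sub>R h1 + v *\<^sub>R h2 = (\<integral>x. \<theta> x *\<^sub>R x \<partial>law)" by (rule sym)
  then show "u *\<^sub>R h1 + v *\<^sub>R h2 \<in> conc_ellipsoid law"
    unfolding conc_ellipsoid_def using c n\<theta> by blast
qed

end

section \<open>Finite nets of functionals and the Hausdorff distance\<close>

definition dual_ball :: "('b::real_normed_vector \<Rightarrow> real) set" where
  "dual_ball = {f. bounded_linear f \<and> (\<forall>y. \<bar>f y\<bar> \<le> norm y)}"

text \<open>An Arzela-Ascoli argument on \<open>K\<close>: members of the dual ball are 1-Lipschitz,
  so their values on a finite \<open>e/4\<close>-net, rounded to multiples of \<open>e/4\<close>,
  fix them on \<open>K\<close> up to \<open>e\<close>, and only finitely many patterns of rounded
  values occur.\<close>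

lemma dual_ball_net:
  fixes K :: "'b::real_normed_vector set"
  assumes K: "\<And>e. e > 0 \<Longrightarrow> \<exists>A. finite A \<and> K \<subseteq> (\<Union>a\<in>A. ball a e)" and e: "e > 0"
  shows "\<exists>G. finite G \<and> G \<subseteq> dual_ball \<and> (\<forall>f\<in>dual_ball. \<exists>g\<in>G. \<forall>y\<in>K. \<bar>f y - g y\<bar> \<le> e)"
proof -
  have e4: "e / 4 > 0" using e by simp
  obtain A where A: "finite A" "K \<subseteq> (\<Union>a\<in>A. ball a (e/4))" using K[OF e4] by blast
  define \<Phi> where "\<Phi> f = (\<lambda>a\<in>A. \<lfloor>f a / (e/4)\<rfloor>)" for f :: "'b \<Rightarrow> real"
  define m where "m a = \<lceil>norm a / (e/4)\<rceil> + 1" for a :: 'b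
  have "\<Phi> f \<in> (\<Pi>\<^sub>E a\<in>A. {- m a .. m a})" if f: "f \<in> dual_ball" for f
    unfolding \<Phi>_def
  proof (intro restrict_PiE_iff[THEN iffD2] ballI)
    fix a assume "a \<in> A"
    have "\<bar>f a\<bar> / (e/4) \<le> norm a / (e/4)"
      using f e4 by (intro divide_right_mono) (auto simp: dual_ball_def)
    then have "\<bar>f a / (e/4)\<bar> \<le> norm a / (e/4)" using e by (simp add: abs_divide)
    then show "\<lfloor>f a / (e/4)\<rfloor> \<in> {- m a .. m a}" unfolding m_def atLeastAtMost_iff by linarith
  qed
  then have "\<Phi> ` dual_ball \<subseteq> (\<Pi>\<^sub>E a\<in>A. {- m a .. m a})" by blast
  moreover have "finite (\<Pi>\<^sub>E a\<in>A. {- m a .. m a})" by (intro finite_PiE A(1)) simp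
  ultimately have fin: "finite (\<Phi> ` dual_ball)" by (rule finite_subset)
  \<comment> \<open>Each pattern is represented by a member of the dual ball itself, because the
    almost sure limits are available only for functionals.\<close>
  define r where "r v = (SOME f. f \<in> dual_ball \<and> \<Phi> f = v)" for v
  have r: "r (\<Phi> f) \<in> dual_ball \<and> \<Phi> (r (\<Phi> f)) = \<Phi> f" if "f \<in> dual_ball" for f
    unfolding r_def by (rule someI[of _ f]) (use that in auto)
  have "\<exists>g\<in>r ` \<Phi> ` dual_ball. \<forall>y\<in>K. \<bar>f y - g y\<bar> \<le> e" if f: "f \<in> dual_ball" for f
  proof (intro bexI[of _ "r (\<Phi> f)"] ballI)
    define g where "g = r (\<Phi> f)"
    have g: "g \<in> dual_ball" "\<Phi> g = \<Phi> f" using r[OF f] by (auto simp: g_def)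
    fix y assume "y \<in> K"
    then obtain a where a: "a \<in> A" "dist a y < e/4" using A(2) by auto
    have "\<lfloor>f a / (e/4)\<rfloor> = \<lfloor>g a / (e/4)\<rfloor>" using fun_cong[OF g(2), of a] a(1) by (simp add: \<Phi>_def)
    then have "\<bar>f a / (e/4) - g a / (e/4)\<bar> < 1" by linarith
    moreover have "\<bar>f a / (e/4) - g a / (e/4)\<bar> = \<bar>f a - g a\<bar> / (e/4)"
      using e4 by (simp only: diff_divide_distrib[symmetric] abs_divide abs_of_pos)
    ultimately have 1: "\<bar>f a - g a\<bar> < e/4" using e4 by (simp only: pos_divide_less_eq mult_1)
    have lip: "\<bar>h y - h a\<bar> < e/4" if "h \<in> dual_ball" for h
    proof -
      have h: "bounded_linear h" "\<bar>h (y - a)\<bar> \<le> norm (y - a)" using that by (auto simp: dual_ball_def)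
      have "h (y - a) = h y - h a" using linear_simps[OF h(1)] by simp
      then show ?thesis using h(2) a(2) by (simp add: dist_norm norm_minus_commute)
    qed
    show "\<bar>f y - r (\<Phi> f) y\<bar> \<le> e" using 1 lip[OF f] lip[OF g(1)] unfolding g_def[symmetric] by linarith
  qed (use f in auto)
  moreover have "r ` \<Phi> ` dual_ball \<subseteq> dual_ball" using r by auto
  ultimately show ?thesis using fin by (intro exI[of _ "r ` \<Phi> ` dual_ball"]) auto
qed

text \<open>An infimum over the empty set carries no information, so nonnegativity too rests on
  having an admissible \<open>e\<close>.\<close>

lemma hausdorff_dist_bounds:
  assumes "e > 0" "A \<subseteq> eps_nbhd B e" "B \<subseteq> eps_nbhd A e"
  shows "0 \<le> hausdorff_dist A B" "hausdorff_dist A B \<le> e"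
proof -
  have "0 \<le> Inf {e. e > 0 \<and> A \<subseteq> eps_nbhd B e}" by (rule cInf_greatest) (use assms in auto)
  then show "0 \<le> hausdorff_dist A B" unfolding hausdorff_dist_def by (simp add: max.coboundedI1)
  have "Inf {e. e > 0 \<and> A \<subseteq> eps_nbhd B e} \<le> e"
    by (rule cInf_lower) (use assms in \<open>auto intro: bdd_belowI[of _ 0]\<close>)
  moreover have "Inf {e. e > 0 \<and> B \<subseteq> eps_nbhd A e} \<le> e"
    by (rule cInf_lower) (use assms in \<open>auto intro: bdd_belowI[of _ 0]\<close>)
  ultimately show "hausdorff_dist A B \<le> e" unfolding hausdorff_dist_def by simp
qed

lemma bounded_linear_le_on_hull:
  fixes f :: "'b::real_normed_vector \<Rightarrow> real"
  assumes "bounded_linear f" "\<And>v. v \<in> V \<Longrightarrow> f v \<le> c" "x \<in> convex hull V"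
  shows "f x \<le> c"
proof -
  have "convex {x. f x \<le> c}"
  proof (rule convexI)
    fix x y and u v :: real assume a: "x \<in> {x. f x \<le> c}" "y \<in> {x. f x \<le> c}" "0 \<le> u" "0 \<le> v" "u + v = 1"
    have "u * f x + v * f y \<le> u * c + v * c" using a by (intro add_mono mult_left_mono) auto
    also have "\<dots> = c" using a by (simp add: distrib_right[symmetric])
    finally show "u *\<^sub>R x + v *\<^sub>R y \<in> {x. f x \<le> c}" using linear_simps[OF assms(1)] by simp
  qed
  then have "convex hull V \<subseteq> {x. f x \<le> c}" using assms(2) by (intro hull_minimal) auto
  then show ?thesis using assms(3) by auto
qed

context gaussian_element
begin

text \<open>Both inclusions are statements about support functions; that of the ellipsoid is the
  standard deviation, and total boundedness of the body reduces to finitely many functionals.\<close>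

lemma hull_close_to_ellipsoid:
  assumes e: "e > 0" and C: "C > 0" and \<eta>: "\<eta> > 0" "(C + 2) * \<eta> \<le> e / 4"
    and G: "G \<subseteq> dual_ball" "\<And>f. f \<in> dual_ball \<Longrightarrow> \<exists>g\<in>G. \<forall>y\<in>K. \<bar>f y - g y\<bar> \<le> \<eta>"
    and VK: "\<And>v. v \<in> V \<Longrightarrow> (1 / C) *\<^sub>R v \<in> K"
    and up: "\<And>g v. g \<in> G \<Longrightarrow> v \<in> V \<Longrightarrow> g v \<le> sd law g + e / 4"
    and low: "\<And>g. g \<in> G \<Longrightarrow> \<exists>v\<in>V. sd law g - e / 4 \<le> g v"
  shows "0 \<le> hausdorff_dist (closure (convex hull V)) (conc_ellipsoid law)"
    and "hausdorff_dist (closure (convex hull V)) (conc_ellipsoid law) \<le> 2 * e"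
proof -
  let ?E = "conc_ellipsoid law"
  have hullK: "(1 / C) *\<^sub>R x \<in> K" if "x \<in> convex hull V" for x
  proof -
    have "convex ((\<lambda>x. C *\<^sub>R x) ` K)" by (rule convex_scaling[OF K_convex])
    moreover have "V \<subseteq> (\<lambda>x. C *\<^sub>R x) ` K"
    proof
      fix v assume "v \<in> V"
      then have "C *\<^sub>R ((1 / C) *\<^sub>R v) \<in> (\<lambda>x. C *\<^sub>R x) ` K" using VK by blast
      then show "v \<in> (\<lambda>x. C *\<^sub>R x) ` K" using C by simp
    qed
    ultimately have "convex hull V \<subseteq> (\<lambda>x. C *\<^sub>R x) ` K" by (intro hull_minimal) auto
    then show ?thesis using that C by auto
  qed
  \<comment> \<open>Passing from \<open>f\<close> to the net costs \<open>C * \<eta>\<close> on the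
    hull, which lies in \<open>C\<close> times \<open>K\<close>, and \<open>2 * \<eta>\<close> in
    the standard deviation; the budget \<open>(C + 2) * \<eta> \<le> e / 4\<close> covers
    both.\<close>
  have approx: "\<exists>g\<in>G. bounded_linear g \<and> sd law g \<le> sd law f + 2 * \<eta> \<and> sd law f \<le> sd law g + 2 * \<eta> \<and>
      (\<forall>x\<in>convex hull V. \<bar>f x - g x\<bar> \<le> C * \<eta>)" if f: "f \<in> dual_ball" for f
  proof -
    obtain g where g: "g \<in> G" "\<forall>y\<in>K. \<bar>f y - g y\<bar> \<le> \<eta>" using G(2)[OF f] by blast
    have blf: "bounded_linear f" and blg: "bounded_linear g" using f g(1) G(1) by (auto simp: dual_ball_def)
    have "sd law (\<lambda>x. g x - f x) \<le> 2 * \<eta>"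
      by (rule sd_le_sup_body[OF bounded_linear_sub[OF blg blf] \<eta>(1)]) (use g(2) in \<open>auto simp: abs_minus_commute\<close>)
    then have 1: "sd law g \<le> sd law f + 2 * \<eta>" using sd_triangle[OF blf blg] by linarith
    have "sd law (\<lambda>x. f x - g x) \<le> 2 * \<eta>"
      by (rule sd_le_sup_body[OF bounded_linear_sub[OF blf blg] \<eta>(1)]) (use g(2) in auto)
    then have 2: "sd law f \<le> sd law g + 2 * \<eta>" using sd_triangle[OF blg blf] by linarith
    have "\<bar>f x - g x\<bar> \<le> C * \<eta>" if "x \<in> convex hull V" for x
    proof -
      have "\<bar>f ((1 / C) *\<^sub>R x) - g ((1 / C) *\<^sub>R x)\<bar> \<le> \<eta>" using g(2) hullK[OF that] by blast
      also have "f ((1 / C) *\<^sub>R x) - g ((1 / C) *\<^sub>R x) = (f x - g x) / C"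
        using linear_simps(5)[OF blf] linear_simps(5)[OF blg] by (simp add: diff_divide_distrib)
      finally show ?thesis using C by (simp add: abs_divide field_simps)
    qed
    then show ?thesis using g(1) blg 1 2 by blast
  qed
  have \<eta>': "C * \<eta> + 2 * \<eta> \<le> e / 4" using \<eta>(2) by (simp add: distrib_right)
  have inc1: "convex hull V \<subseteq> eps_nbhd ?E e"
  proof (rule ccontr)
    assume "\<not> convex hull V \<subseteq> eps_nbhd ?E e"
    then obtain x where x: "x \<in> convex hull V" "\<And>h. h \<in> ?E \<Longrightarrow> e \<le> dist x h"
      unfolding eps_nbhd_def by force
    obtain f where f: "f \<in> dual_ball" "\<forall>h\<in>?E. f h + e \<le> f x"
      using dual_separation[OF convex_ellipsoid _ x(2)] zero_in_ellipsoid unfolding dual_ball_def by blast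
    have blf: "bounded_linear f" using f(1) by (simp add: dual_ball_def)
    obtain h where "h \<in> ?E" "f h = sd law f" using ellipsoid_attains_sd[OF blf] by blast
    then have fx: "sd law f + e \<le> f x" using f(2) by auto
    obtain g where g: "g \<in> G" "bounded_linear g" "sd law g \<le> sd law f + 2 * \<eta>"
        "\<forall>x\<in>convex hull V. \<bar>f x - g x\<bar> \<le> C * \<eta>" using approx[OF f(1)] by blast
    have "g x \<le> sd law g + e / 4"
      by (rule bounded_linear_le_on_hull[OF g(2) up[OF g(1)] x(1)])
    moreover have "\<bar>f x - g x\<bar> \<le> C * \<eta>" using g(4) x(1) by blast
    \<comment> \<open>The chain gives \<open>f x\<close> at most the standard deviation of
      \<open>f\<close> plus \<open>e / 4 + (C + 2) * \<eta>\<close>, hence plus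
      \<open>e / 2\<close>, against a separation by \<open>e\<close>.\<close>
    ultimately show False using fx g(3) \<eta>' e by linarith
  qed
  \<comment> \<open>Passing to the closure costs a second \<open>e\<close>.\<close>
  have A: "closure (convex hull V) \<subseteq> eps_nbhd ?E (2 * e)"
  proof
    fix x assume "x \<in> closure (convex hull V)"
    then obtain y where y: "y \<in> convex hull V" "dist y x < e" using e unfolding closure_approachable by blast
    then obtain h where h: "h \<in> ?E" "dist y h < e" using inc1 unfolding eps_nbhd_def by blast
    have "dist x h < 2 * e" using dist_triangle[of x h y] y(2) h(2) by (simp add: dist_commute)
    then show "x \<in> eps_nbhd ?E (2 * e)" using h(1) unfolding eps_nbhd_def by blast
  qed
  have neV: "convex hull V \<noteq> {}"
  proof -
    \<comment> \<open>The zero functional has an approximant in \<open>G\<close>, for which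
      \<open>low\<close> exhibits a point of \<open>V\<close>.\<close>
    have "(\<lambda>_. 0) \<in> dual_ball" by (simp add: dual_ball_def)
    then obtain g where "g \<in> G" using G(2) by blast
    then show ?thesis using low by auto
  qed
  have B: "?E \<subseteq> eps_nbhd (closure (convex hull V)) (2 * e)"
  proof (rule ccontr)
    assume "\<not> ?E \<subseteq> eps_nbhd (closure (convex hull V)) (2 * e)"
    then obtain x where x: "x \<in> ?E" "\<And>a. a \<in> closure (convex hull V) \<Longrightarrow> 2 * e \<le> dist x a"
      unfolding eps_nbhd_def by force
    have x': "2 * e \<le> dist x a" if "a \<in> convex hull V" for a
      using x(2) closure_subset that by blast
    obtain f where f: "f \<in> dual_ball" "\<forall>a\<in>convex hull V. f a + 2 * e \<le> f x"
      using dual_separation[OF convex_convex_hull neV x'] unfolding dual_ball_def by blast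
    have blf: "bounded_linear f" using f(1) by (simp add: dual_ball_def)
    have fx: "f x \<le> sd law f" by (rule ellipsoid_le_sd[OF blf x(1)])
    obtain g where g: "g \<in> G" "sd law f \<le> sd law g + 2 * \<eta>"
        "\<forall>x\<in>convex hull V. \<bar>f x - g x\<bar> \<le> C * \<eta>" using approx[OF f(1)] by blast
    obtain v where v: "v \<in> V" "sd law g - e / 4 \<le> g v" using low[OF g(1)] by blast
    have vh: "v \<in> convex hull V" using v(1) by (rule hull_inc)
    have "f v + 2 * e \<le> f x" "\<bar>f v - g v\<bar> \<le> C * \<eta>" using f(2) g(3) vh by auto
    then show False using fx g(2) v(2) \<eta>' e by linarith
  qed
  show "0 \<le> hausdorff_dist (closure (convex hull V)) ?E" "hausdorff_dist (closure (convex hull V)) ?E \<le> 2 * e"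
    using hausdorff_dist_bounds[OF _ A B] e by auto
qed

end

section \<open>Almost sure convergence along dyadic blocks\<close>

lemma finite_box:
  fixes R :: int
  shows "finite {d :: int ^ 'm. \<forall>k. \<bar>d $ k\<bar> \<le> R}"
proof (rule finite_imageD[where f = "\<lambda>d. vec_nth d"])
  have "vec_nth ` {d :: int ^ 'm. \<forall>k. \<bar>d $ k\<bar> \<le> R} \<subseteq> (\<Pi>\<^sub>E k\<in>UNIV. {- R .. R})"
    by (auto simp: PiE_UNIV_domain Pi_def abs_le_iff) (metis minus_le_iff)
  then show "finite (vec_nth ` {d :: int ^ 'm. \<forall>k. \<bar>d $ k\<bar> \<le> R})"
    by (rule finite_subset) (intro finite_PiE; simp)
  show "inj_on vec_nth {d :: int ^ 'm. \<forall>k. \<bar>d $ k\<bar> \<le> R}" by (auto simp: inj_on_def vec_eq_iff)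
qed

text \<open>Every ball is contained in a reflected translate of one box, so the cardinality bound is
  uniform in the centre.\<close>

lemma maxdist_ball:
  fixes t :: "int ^ 'm"
  shows "finite {s. maxdist t s \<le> R}"
    and "card {s. maxdist t s \<le> R} \<le> card {d :: int ^ 'm. \<forall>k. \<bar>d $ k\<bar> \<le> R}"
proof -
  have sub: "{s. maxdist t s \<le> R} \<subseteq> (\<lambda>d. t - d) ` {d. \<forall>k. \<bar>d $ k\<bar> \<le> R}"
  proof
    fix s assume s: "s \<in> {s. maxdist t s \<le> R}"
    have "\<bar>(t - s) $ k\<bar> \<le> R" for k
    proof -
      have "\<bar>t $ k - s $ k\<bar> \<le> maxdist t s" unfolding maxdist_def by (rule Max_ge) auto
      then show ?thesis using s by simp
    qed
    then show "s \<in> (\<lambda>d. t - d) ` {d. \<forall>k. \<bar>d $ k\<bar> \<le> R}" by (intro image_eqI[of _ _ "t - s"]) auto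
  qed
  show "finite {s. maxdist t s \<le> R}" by (rule finite_subset[OF sub]) (simp add: finite_box)
  have "card {s. maxdist t s \<le> R} \<le> card ((\<lambda>d. t - d) ` {d. \<forall>k. \<bar>d $ k\<bar> \<le> R})"
    by (rule card_mono[OF _ sub]) (simp add: finite_box)
  also have "\<dots> \<le> card {d :: int ^ 'm. \<forall>k. \<bar>d $ k\<bar> \<le> R}" by (rule card_image_le[OF finite_box])
  finally show "card {s. maxdist t s \<le> R} \<le> card {d :: int ^ 'm. \<forall>k. \<bar>d $ k\<bar> \<le> R}" .
qed

lemma bfun_pos: "bfun x > 0"
  unfolding bfun_def by (intro real_sqrt_gt_zero mult_pos_pos) auto

lemma bfun_mono: "x \<le> y \<Longrightarrow> bfun x \<le> bfun y"
  unfolding bfun_def by (intro real_sqrt_le_mono mult_left_mono) auto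

text \<open>At \<open>j = 0\<close> the formula fails, since the maximum with \<open>2\<close> in
  \<open>bfun\<close> takes over.\<close>

lemma bfun_two_power_square:
  assumes "j \<ge> 1" shows "(bfun (2 ^ j))\<^sup>2 = 2 * (real j * ln 2)"
proof -
  have "(2::real) ^ 1 \<le> 2 ^ j" using assms by (intro power_increasing) auto
  then show ?thesis unfolding bfun_def by (simp add: max_absorb1 ln_realpow)
qed

text \<open>Across a dyadic block the normalisation changes by a factor tending to one, so a lower
  bound obtained for the block passes to each of its \<open>n\<close> without loss in the
  limit.\<close>

lemma bfun_ratio: "(\<lambda>j::nat. bfun (2 ^ j) / bfun (2 ^ Suc j)) \<longlonglongrightarrow> 1"
proof -
  have "(\<lambda>j::nat. sqrt (real j / (real j + 1))) \<longlonglongrightarrow> 1" by real_asymp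
  moreover have "eventually (\<lambda>j. sqrt (real j / (real j + 1)) = bfun (2 ^ j) / bfun (2 ^ Suc j)) sequentially"
    using eventually_ge_at_top[of 1]
  proof eventually_elim
    case (elim j)
    have b: "bfun (2 ^ i) = sqrt (2 * (real i * ln 2))" if "i \<ge> 1" for i :: nat
      using bfun_two_power_square[OF that] bfun_pos[of "2 ^ i"] by (metis less_imp_le real_sqrt_unique)
    have "bfun (2 ^ Suc j) = sqrt (2 * (real (Suc j) * ln 2))" by (rule b) simp
    then have "bfun (2 ^ j) / bfun (2 ^ Suc j) = sqrt ((2 * (real j * ln 2)) / (2 * (real (Suc j) * ln 2)))"
      using b[OF elim] by (simp only: real_sqrt_divide)
    also have "(2 * (real j * ln 2)) / (2 * (real (Suc j) * ln 2)) = real j / (real j + 1)"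
    proof -
      have "(2 * (real j * c)) / (2 * (real (Suc j) * c)) = real j / (real j + 1)" if "c > 0" for c :: real
        using that by (simp add: divide_simps)
      then show ?thesis by simp
    qed
    finally show ?case by simp
  qed
  ultimately show ?thesis by (rule Lim_transform_eventually)
qed

lemma (in prob_space) borel_cantelli_eventually:
  assumes A: "\<And>j. A j \<in> sets M" and le: "eventually (\<lambda>j. prob (A j) \<le> a j) sequentially" and a: "summable a"
  shows "AE \<omega> in M. eventually (\<lambda>j. \<omega> \<notin> A j) sequentially"
proof -
  have "summable (\<lambda>j. prob (A j))"
    by (rule summable_comparison_test_ev[OF _ a]) (use le in auto)
  then have "AE \<omega> in M. eventually (\<lambda>j. \<omega> \<in> space M - A j) sequentially"
    using A by (intro borel_cantelli_AE1) (auto simp: emeasure_eq_measure)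
  then show ?thesis by (auto elim!: eventually_mono)
qed

lemma summable_exp_neg:
  assumes "c > (0::real)" shows "summable (\<lambda>j::nat. C * exp (- c * real j))"
proof -
  have "summable (\<lambda>j. C * exp (- c) ^ j)" by (intro summable_mult summable_geometric) (use assms in simp)
  then show ?thesis by (simp add: exp_of_nat_mult[symmetric] mult.commute)
qed

section \<open>Dyadic blocks of an increasing sequence of finite sets\<close>

locale increasing_sets =
  fixes T :: "nat \<Rightarrow> 't set"
  assumes T_finite: "\<And>n. finite (T n)" and T_incr: "\<And>n. T n \<subseteq> T (Suc n)"
    and T_card: "filterlim (\<lambda>n. card (T n)) at_top sequentially"
begin

lemma T_mono: "m \<le> n \<Longrightarrow> T m \<subseteq> T n"
  using lift_Suc_mono_le[of T] T_incr by blast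

text \<open>A union of a finite chain: the largest set with fewer than \<open>2 ^ Suc j\<close>
  elements, or the empty set if there is none. Upper bounds are proved over it.\<close>

definition upper :: "nat \<Rightarrow> 't set" where
  "upper j = (\<Union>n\<in>{n. card (T n) < 2 ^ Suc j}. T n)"

text \<open>The first set with at least \<open>2 ^ j\<close> elements. Cardinalities may jump, so it
  can be much larger than that; the lower bound for maxima is therefore taken at its actual
  cardinality.\<close>

definition lower :: "nat \<Rightarrow> 't set" where
  "lower j = T (LEAST n. 2 ^ j \<le> card (T n))"

definition block :: "nat \<Rightarrow> nat" where
  "block n = (SOME j. 2 ^ j \<le> card (T n) \<and> card (T n) < 2 ^ Suc j)"

lemma card_large: "eventually (\<lambda>n. N \<le> card (T n)) sequentially"
  using T_card unfolding filterlim_at_top by blast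

lemma upper_card: "finite (upper j)" "card (upper j) \<le> 2 ^ Suc j"
proof -
  let ?S = "{n. card (T n) < 2 ^ Suc j}"
  obtain N where N: "\<And>n. n \<ge> N \<Longrightarrow> 2 ^ Suc j \<le> card (T n)"
    using card_large[of "2 ^ Suc j"] unfolding eventually_sequentially by blast
  have "?S \<subseteq> {..<N}" using N by (auto simp: not_le[symmetric])
  then have fS: "finite ?S" by (rule finite_subset) simp
  show "finite (upper j)" unfolding upper_def using fS T_finite by simp
  show "card (upper j) \<le> 2 ^ Suc j"
  proof (cases "?S = {}")
    case True then show ?thesis unfolding upper_def by simp
  next
    case False
    have "upper j \<subseteq> T (Max ?S)" unfolding upper_def using T_mono Max_ge[OF fS] by blast
    then have "card (upper j) \<le> card (T (Max ?S))" by (rule card_mono[OF T_finite])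
    then show ?thesis using Max_in[OF fS False] by simp
  qed
qed

lemma lower_card: "finite (lower j)" "2 ^ j \<le> card (lower j)"
proof -
  show "finite (lower j)" unfolding lower_def by (rule T_finite)
  have "\<exists>n. 2 ^ j \<le> card (T n)" using card_large[of "2 ^ j"] unfolding eventually_sequentially by blast
  then show "2 ^ j \<le> card (lower j)" unfolding lower_def by (rule LeastI_ex)
qed

lemma block_bounds:
  assumes "card (T n) \<ge> 1"
  shows "2 ^ block n \<le> card (T n)" "card (T n) < 2 ^ Suc (block n)"
    "T n \<subseteq> upper (block n)" "lower (block n) \<subseteq> T n"
proof -
  have "\<exists>j. 2 ^ j \<le> card (T n) \<and> card (T n) < 2 ^ Suc j"
    using ex_power_ivl1[of 2 "card (T n)"] assms by auto
  then have b: "2 ^ block n \<le> card (T n) \<and> card (T n) < 2 ^ Suc (block n)"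
    unfolding block_def by (rule someI_ex)
  then show "2 ^ block n \<le> card (T n)" "card (T n) < 2 ^ Suc (block n)" by auto
  show "T n \<subseteq> upper (block n)" unfolding upper_def using b by blast
  show "lower (block n) \<subseteq> T n" unfolding lower_def by (rule T_mono, rule Least_le) (use b in blast)
qed

lemma block_at_top: "filterlim block at_top sequentially"
  unfolding filterlim_at_top
proof
  fix Z
  show "eventually (\<lambda>n. Z \<le> block n) sequentially"
    using card_large[of "2 ^ Z"] card_large[of 1]
  proof eventually_elim
    case (elim n)
    have "(2::nat) ^ Z < 2 ^ Suc (block n)" using elim(1) block_bounds(2)[OF elim(2)] by linarith
    then have "Z < Suc (block n)" by (rule power_less_imp_less_exp[rotated]) simp
    then show ?case by simp
  qed
qed

lemma eventually_block:
  assumes "eventually Q sequentially"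
  shows "eventually (\<lambda>n. Q (block n)) sequentially"
  using assms block_at_top by (rule eventually_compose_filterlim)

lemma bfun_block:
  assumes "card (T n) \<ge> 1"
  shows "bfun (2 ^ block n) \<le> bfun (card (T n))" "bfun (card (T n)) \<le> bfun (2 ^ Suc (block n))"
proof -
  have "real (2 ^ block n) \<le> real (card (T n))" "real (card (T n)) \<le> real (2 ^ Suc (block n))"
    using block_bounds(1,2)[OF assms] by (simp_all only: of_nat_le_iff less_imp_le)
  then show "bfun (2 ^ block n) \<le> bfun (card (T n))" "bfun (card (T n)) \<le> bfun (2 ^ Suc (block n))"
    by (auto intro!: bfun_mono)
qed

end

section \<open>Almost sure bounds for the normalised field\<close>

locale gaussian_field = prob_space M + increasing_sets T
  for M :: "'a measure" and T :: "nat \<Rightarrow> 't set" +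
  fixes X :: "'t \<Rightarrow> 'a \<Rightarrow> 'b::{banach, second_countable_topology}" and P :: "'b measure" and K :: "'b set"
  assumes elem: "\<And>t. gaussian_element M (X t) K" and law: "\<And>t. distr M borel (X t) = P"
    and joint: "\<And>F c. finite F \<Longrightarrow> (\<And>t. bounded_linear (c t)) \<Longrightarrow> centered_gaussian_rv M (\<lambda>\<omega>. \<Sum>t\<in>F. c t (X t \<omega>))"
    and near: "\<And>(f :: 'b \<Rightarrow> real) e. bounded_linear f \<Longrightarrow> e > 0 \<Longrightarrow> \<exists>D. \<forall>t. finite {s. \<not> \<bar>\<integral>\<omega>. f (X t \<omega>) * f (X s \<omega>) \<partial>M\<bar> < e} \<and>
        card {s. \<not> \<bar>\<integral>\<omega>. f (X t \<omega>) * f (X s \<omega>) \<partial>M\<bar> < e} \<le> D"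
begin

abbreviation Xb :: "nat \<Rightarrow> 't \<Rightarrow> 'a \<Rightarrow> 'b" where
  "Xb n t \<omega> \<equiv> (1 / bfun (card (T n))) *\<^sub>R X t \<omega>"

lemma X_measurable[measurable]: "X t \<in> borel_measurable M"
  using gaussian_element.X_meas[OF elem] .

lemma fX_gauss:
  fixes f :: "'b \<Rightarrow> real"
  shows "bounded_linear f \<Longrightarrow> centered_gaussian_rv M (\<lambda>\<omega>. f (X t \<omega>))"
  using gaussian_element.X_gauss[OF elem] .

lemma fX_measurable:
  fixes f :: "'b \<Rightarrow> real"
  shows "bounded_linear f \<Longrightarrow> (\<lambda>\<omega>. f (X t \<omega>)) \<in> borel_measurable M"
  using fX_gauss by (auto simp: centered_gaussian_rv_def)

lemma fX_var:
  fixes f :: "'b \<Rightarrow> real"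
  shows "bounded_linear f \<Longrightarrow> (\<integral>\<omega>. (f (X t \<omega>))\<^sup>2 \<partial>M) = (sd P f)\<^sup>2"
  using gaussian_element.sd_law[OF elem, of f t] by (simp add: law)

lemma prob_ex_upper_le:
  assumes "\<And>t. A t \<in> sets M" "\<And>t. prob (A t) \<le> p"
  shows "prob (\<Union>t\<in>upper j. A t) \<le> 2 ^ Suc j * p"
proof -
  have p0: "0 \<le> p" using assms(2) measure_nonneg order_trans by blast
  have "prob (\<Union>t\<in>upper j. A t) \<le> (\<Sum>t\<in>upper j. prob (A t))"
    by (rule finite_measure_subadditive_finite) (use upper_card assms in auto)
  also have "\<dots> \<le> card (upper j) * p" using sum_mono[of "upper j" "\<lambda>t. prob (A t)" "\<lambda>_. p"] assms(2) by simp
  also have "\<dots> \<le> real (2 ^ Suc j) * p"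
    using upper_card(2)[of j] p0 by (intro mult_right_mono) (simp_all only: of_nat_le_iff)
  finally show ?thesis by simp
qed

lemma exp_two_power: "(2::real) ^ j = exp (real j * ln 2)"
  by (simp add: exp_of_nat_mult)

text \<open>The body tail has to beat a union over at most \<open>2 ^ Suc j\<close> indices. At
  level \<open>20 * b\<close> its exponent is at least \<open>b\<^sup>2 = 2 * (j * ln 2)\<close>,
  twice the cost of counting; \<open>20\<close> is merely large enough, since
  \<open>2 * pi\<^sup>2 \<le> 32 \<le> 19\<^sup>2\<close>.\<close>

lemma body_eventually:
  "AE \<omega> in M. eventually (\<lambda>n. \<forall>t\<in>T n. (1 / 20) *\<^sub>R (Xb n t \<omega>) \<in> K) sequentially"
proof -
  have Kb[measurable]: "K \<in> sets borel" using gaussian_element.K_meas[OF elem] .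
  define A where "A j t = {\<omega>\<in>space M. (1 / (20 * bfun (2 ^ j))) *\<^sub>R X t \<omega> \<notin> K}" for j t
  have Am: "A j t \<in> sets M" for j t unfolding A_def by measurable
  have "eventually (\<lambda>j. prob (\<Union>t\<in>upper j. A j t) \<le> 4 * exp (- ln 2 * real j)) sequentially"
    using eventually_ge_at_top[of 1]
  proof eventually_elim
    case (elim j)
    define b where "b = bfun (2 ^ j)"
    have b2: "b\<^sup>2 = 2 * (real j * ln 2)" unfolding b_def by (rule bfun_two_power_square[OF elim])
    have "1 * ln 2 \<le> real j * ln 2" using elim by (intro mult_right_mono) auto
    moreover have "(2/3 :: real) \<le> ln 2" by (rule ln2_ge_two_thirds)
    ultimately have "1 \<le> 2 * (real j * ln 2)" by linarith
    then have "1\<^sup>2 \<le> b\<^sup>2" unfolding b2 by simp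
    then have b1: "1 \<le> b" by (rule power2_le_imp_le) (simp add: b_def bfun_pos less_imp_le)
    have pA: "prob (A j t) \<le> 2 * exp (- (20 * b - 1)\<^sup>2 / (2 * pi\<^sup>2))" for t
      unfolding A_def b_def[symmetric] by (rule gaussian_element.body_tail[OF elem]) (use b1 in auto)
    have "prob (\<Union>t\<in>upper j. A j t) \<le> 2 ^ Suc j * (2 * exp (- (20 * b - 1)\<^sup>2 / (2 * pi\<^sup>2)))"
      by (rule prob_ex_upper_le[OF Am pA])
    also have "\<dots> = 4 * exp (real j * ln 2 + - (20 * b - 1)\<^sup>2 / (2 * pi\<^sup>2))"
      unfolding exp_add exp_two_power[symmetric] by simp
    also have "\<dots> \<le> 4 * exp (- ln 2 * real j)"
    proof -
      have "pi\<^sup>2 \<le> 4\<^sup>2" using pi_less_4 pi_gt_zero by (intro power_mono) auto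
      then have "2 * pi\<^sup>2 * b\<^sup>2 \<le> 32 * b\<^sup>2" by (intro mult_right_mono) auto
      also have "\<dots> \<le> (19 * b)\<^sup>2" by (simp add: power_mult_distrib)
      also have "\<dots> \<le> (20 * b - 1)\<^sup>2" using b1 by (intro power_mono) auto
      finally have "b\<^sup>2 \<le> (20 * b - 1)\<^sup>2 / (2 * pi\<^sup>2)" by (simp add: field_simps)
      then show ?thesis unfolding b2 by simp
    qed
    finally show ?case .
  qed
  then have "AE \<omega> in M. eventually (\<lambda>j. \<omega> \<notin> (\<Union>t\<in>upper j. A j t)) sequentially"
    by (intro borel_cantelli_eventually[where a = "\<lambda>j. 4 * exp (- ln 2 * real j)"] sets.finite_UN upper_card(1) Am
        summable_exp_neg) simp_all
  then show ?thesis using AE_space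
  proof eventually_elim
    case (elim \<omega>)
    have ev: "eventually (\<lambda>n. \<omega> \<notin> (\<Union>t\<in>upper (block n). A (block n) t)) sequentially"
      by (rule eventually_block[OF elim(1)])
    have w: "\<omega> \<in> space M" by (rule elim(2))
    show ?case using ev card_large[of 1]
    proof eventually_elim
      case (elim n)
      show ?case
      proof
        fix t assume t: "t \<in> T n"
        define b where "b = bfun (card (T n))"
        define b0 where "b0 = bfun (2 ^ block n)"
        have b: "0 < b0" "b0 \<le> b" "0 < b" unfolding b_def b0_def using bfun_pos bfun_block(1)[OF elim(2)] by auto
        have "\<omega> \<notin> A (block n) t" using elim(1) block_bounds(3)[OF elim(2)] t by blast
        then have "(1 / (20 * b0)) *\<^sub>R X t \<omega> \<in> K" using w by (simp add: A_def b0_def)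
        \<comment> \<open>Enlarging the divisor from \<open>b0\<close> to \<open>b\<close> moves the
          point towards the origin, and \<open>K\<close> is convex and contains the origin.\<close>
        then have "(b0 / b) *\<^sub>R ((1 / (20 * b0)) *\<^sub>R X t \<omega>) + (1 - b0 / b) *\<^sub>R 0 \<in> K"
          using gaussian_element.K_convex[OF elem] gaussian_element.K_zero[OF elem] b
          by (intro convexD) auto
        then show "(1 / 20) *\<^sub>R (Xb n t \<omega>) \<in> K"
          using b by (simp add: b_def[symmetric] mult.commute)
      qed
    qed
  qed
qed

lemma functional_upper:
  fixes f :: "'b \<Rightarrow> real"
  assumes f: "bounded_linear f" and d: "d > 0"
  shows "AE \<omega> in M. eventually (\<lambda>n. \<forall>t\<in>T n. f (Xb n t \<omega>) \<le> sd P f + d) sequentially"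
proof -
  note fX_measurable[OF f, measurable]
  define s where "s = sd P f"
  have s0: "s \<ge> 0" unfolding s_def by (rule sd_nonneg)
  define A where "A j t = {\<omega>\<in>space M. (s + d) * bfun (2 ^ j) < f (X t \<omega>)}" for j t
  have Am: "A j t \<in> sets M" for j t unfolding A_def by measurable
  \<comment> \<open>The tail is applied with \<open>(s + d / 2)\<^sup>2\<close> in place of the
    variance: this is positive even for \<open>s = 0\<close> and leaves a rate \<open>r > 1\<close>
    against the \<open>2 ^ Suc j\<close> indices.\<close>
  define r where "r = ((s + d) / (s + d / 2))\<^sup>2"
  have r: "r > 1"
  proof -
    have "1 < (s + d) / (s + d / 2)" using s0 d by (simp add: field_simps)
    then show ?thesis unfolding r_def by (simp add: one_less_power)
  qed
  have "eventually (\<lambda>j. prob (\<Union>t\<in>upper j. A j t) \<le> 2 * exp (- ((r - 1) * ln 2) * real j)) sequentially"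
    using eventually_ge_at_top[of 1]
  proof eventually_elim
    case (elim j)
    define b where "b = bfun (2 ^ j)"
    have b2: "b\<^sup>2 = 2 * (real j * ln 2)" unfolding b_def by (rule bfun_two_power_square[OF elim])
    have b0: "b > 0" unfolding b_def by (rule bfun_pos)
    have pA: "prob (A j t) \<le> exp (- ((s + d) * b)\<^sup>2 / (2 * (s + d / 2)\<^sup>2))" for t
      unfolding A_def b_def[symmetric]
    proof (rule gaussian_tail[OF fX_gauss[OF f]])
      show "(\<integral>\<omega>. (f (X t \<omega>))\<^sup>2 \<partial>M) \<le> (s + d / 2)\<^sup>2"
        unfolding fX_var[OF f] s_def[symmetric] using s0 d by (intro power_mono) auto
    qed (use s0 d b0 in auto)
    have "prob (\<Union>t\<in>upper j. A j t) \<le> 2 ^ Suc j * exp (- ((s + d) * b)\<^sup>2 / (2 * (s + d / 2)\<^sup>2))"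
      by (rule prob_ex_upper_le[OF Am pA])
    also have "- ((s + d) * b)\<^sup>2 / (2 * (s + d / 2)\<^sup>2) = - r * (real j * ln 2)"
      unfolding r_def power_mult_distrib b2 by (simp add: power_divide)
    also have "2 ^ Suc j * exp (- r * (real j * ln 2)) = 2 * exp (real j * ln 2 + - r * (real j * ln 2))"
      unfolding exp_add exp_two_power[symmetric] by simp
    also have "real j * ln 2 + - r * (real j * ln 2) = - ((r - 1) * ln 2) * real j" by (simp add: algebra_simps)
    finally show ?case .
  qed
  moreover have "summable (\<lambda>j. 2 * exp (- ((r - 1) * ln 2) * real j))"
    by (rule summable_exp_neg) (use r in simp)
  ultimately have "AE \<omega> in M. eventually (\<lambda>j. \<omega> \<notin> (\<Union>t\<in>upper j. A j t)) sequentially"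
    by (intro borel_cantelli_eventually[where a = "\<lambda>j. 2 * exp (- ((r - 1) * ln 2) * real j)"] sets.finite_UN upper_card(1) Am)
  then show ?thesis using AE_space
  proof eventually_elim
    case (elim \<omega>)
    have ev: "eventually (\<lambda>n. \<omega> \<notin> (\<Union>t\<in>upper (block n). A (block n) t)) sequentially"
      by (rule eventually_block[OF elim(1)])
    have w: "\<omega> \<in> space M" by (rule elim(2))
    show ?case using ev card_large[of 1]
    proof eventually_elim
      case (elim n)
      show ?case
      proof
        fix t assume t: "t \<in> T n"
        define b where "b = bfun (card (T n))"
        have b: "bfun (2 ^ block n) \<le> b" "0 < b" unfolding b_def using bfun_pos bfun_block(1)[OF elim(2)] by auto
        have "\<omega> \<notin> A (block n) t" using elim(1) block_bounds(3)[OF elim(2)] t by blast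
        then have "f (X t \<omega>) \<le> (s + d) * bfun (2 ^ block n)" using w by (simp add: A_def)
        also have "\<dots> \<le> (s + d) * b" using b s0 d by (intro mult_left_mono) auto
        finally have "f (X t \<omega>) / b \<le> s + d" using b by (simp add: field_simps)
        moreover have "f ((1 / b) *\<^sub>R X t \<omega>) = f (X t \<omega>) / b" using linear_simps(5)[OF f] by simp
        ultimately show "f (Xb n t \<omega>) \<le> sd P f + d"
          by (simp add: b_def s_def)
      qed
    qed
  qed
qed

lemma functional_lower:
  fixes f :: "'b \<Rightarrow> real"
  assumes f: "bounded_linear f" and d: "d > 0"
  shows "AE \<omega> in M. eventually (\<lambda>n. \<exists>t\<in>T n. sd P f - d \<le> f (Xb n t \<omega>)) sequentially"
proof (cases "sd P f = 0")
  case True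
  \<comment> \<open>In the degenerate case the upper bound for \<open>- f\<close> already keeps all
    values of \<open>f\<close> above \<open>- d\<close>; it remains that \<open>T n\<close> is
    eventually nonempty.\<close>
  have "sd P (\<lambda>x. - f x) = 0" using True by (simp add: sd_def)
  with functional_upper[OF bounded_linear_minus[OF f] d]
  have "AE \<omega> in M. eventually (\<lambda>n. \<forall>t\<in>T n. - f (Xb n t \<omega>) \<le> 0 + d) sequentially"
    by (simp only:)
  then show ?thesis
  proof eventually_elim
    case (elim \<omega>)
    then show ?case using card_large[of 1]
    proof eventually_elim
      case (elim n)
      then obtain t where "t \<in> T n" by fastforce
      then show ?case using elim True by force
    qed
  qed
next
  case False
  define s where "s = sd P f"
  have s: "s > 0" using False sd_nonneg[of P f] by (simp add: s_def)
  \<comment> \<open>The factor \<open>1 - 2 * e\<close> is lost twice, in the maximum and in the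
    ratio of normalisations across a block, and \<open>(1 - 2 * e)\<^sup>2 * s\<close> is at least
    \<open>s - 4 * e * s\<close>, hence at least \<open>s - d\<close>. The cap \<open>1/4\<close>
    keeps \<open>e\<close> below \<open>1/2\<close>.\<close>
  define e where "e = min (1/4) (d / (4 * s))"
  have e: "0 < e" "e < 1/2" "4 * e * s \<le> d"
  proof -
    have "e \<le> d / (4 * s)" unfolding e_def by simp
    then show "4 * e * s \<le> d" using s by (simp add: field_simps)
  qed (use s d in \<open>auto simp: e_def\<close>)
  define Y where "Y t \<omega> = f (X t \<omega>) / s" for t \<omega>
  have Ym[measurable]: "Y t \<in> borel_measurable M" for t
    unfolding Y_def using fX_measurable[OF f, of t] by measurable
  define Q where "Q k N \<longleftrightarrow> (\<forall>L. finite L \<longrightarrow> N \<le> card L \<longrightarrow>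
    prob {\<omega>\<in>space M. \<forall>t\<in>L. Y t \<omega> \<le> (1 - 2 * e) * bfun (card L)} \<le> exp (- k * ln (card L)))" for k :: real and N
  have "\<exists>k>0. \<exists>N. Q k N"
    unfolding Q_def
  proof (rule maximum_lower_bound[OF _ _ _ e(1,2)])
    show "jointly_gaussian M L Y" if "finite L" for L
      unfolding jointly_gaussian_def
    proof
      fix c :: "'t \<Rightarrow> real"
      have "centered_gaussian_rv M (\<lambda>\<omega>. \<Sum>t\<in>L. (\<lambda>x. (c t / s) * f x) (X t \<omega>))"
        by (rule joint[OF that]) (intro bounded_linear_const_mult f)
      then show "centered_gaussian_rv M (\<lambda>\<omega>. \<Sum>t\<in>L. c t * Y t \<omega>)" by (simp add: Y_def)
    qed
    show "(\<integral>\<omega>. (Y t \<omega>)\<^sup>2 \<partial>M) = 1" for t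
      unfolding Y_def using fX_var[OF f, of t] s by (simp add: power_divide s_def)
    fix r :: real assume "r > 0"
    then have "r * s\<^sup>2 > 0" using s by simp
    moreover have "(\<bar>cov M Y t u\<bar> < r) \<longleftrightarrow> (\<bar>\<integral>\<omega>. f (X t \<omega>) * f (X u \<omega>) \<partial>M\<bar> < r * s\<^sup>2)" for t u
    proof -
      have "cov M Y t u = (\<integral>\<omega>. (f (X t \<omega>) * f (X u \<omega>)) / s\<^sup>2 \<partial>M)"
        unfolding Y_def by (simp add: power2_eq_square)
      also have "\<dots> = (\<integral>\<omega>. f (X t \<omega>) * f (X u \<omega>) \<partial>M) / s\<^sup>2" by simp
      finally have "\<bar>cov M Y t u\<bar> = \<bar>\<integral>\<omega>. f (X t \<omega>) * f (X u \<omega>) \<partial>M\<bar> / s\<^sup>2"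
        using s by (simp only: abs_divide abs_power2)
      then show ?thesis using s by (simp only: pos_divide_less_eq zero_less_power)
    qed
    ultimately show "\<exists>D. \<forall>t. finite {u. \<not> \<bar>cov M Y t u\<bar> < r} \<and> card {u. \<not> \<bar>cov M Y t u\<bar> < r} \<le> D"
      using near[OF f, of "r * s\<^sup>2"] by (simp only:)
  qed
  then obtain k N where k: "k > 0" and N: "Q k N" by blast
  define A where "A j = {\<omega>\<in>space M. \<forall>t\<in>lower j. Y t \<omega> \<le> (1 - 2 * e) * bfun (card (lower j))}" for j
  have Am: "A j \<in> sets M" for j unfolding A_def using lower_card(1)[of j] by measurable
  have "eventually (\<lambda>j. prob (A j) \<le> 1 * exp (- (k * ln 2) * real j)) sequentially"
    using eventually_ge_at_top[of N]
  proof eventually_elim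
    case (elim j)
    have "N \<le> card (lower j)" using elim lower_card(2)[of j] less_exp[of j] by linarith
    then have "prob (A j) \<le> exp (- k * ln (card (lower j)))" 
      using N lower_card(1)[of j] unfolding A_def Q_def by blast
    also have "\<dots> \<le> exp (- k * ln (2 ^ j))"
    proof -
      have "real (2 ^ j) \<le> real (card (lower j))" using lower_card(2) by (simp only: of_nat_le_iff)
      then have "ln (2 ^ j) \<le> ln (real (card (lower j)))" by (intro ln_mono) auto
      then show ?thesis using k by simp
    qed
    also have "- k * ln (2 ^ j) = - (k * ln 2) * real j" by (simp add: ln_realpow)
    finally show ?case by simp
  qed
  then have "AE \<omega> in M. eventually (\<lambda>j. \<omega> \<notin> A j) sequentially"
    by (rule borel_cantelli_eventually[OF Am]) (rule summable_exp_neg, use k in simp)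
  then show ?thesis using AE_space
  proof eventually_elim
    case (elim \<omega>)
    have w: "\<omega> \<in> space M" by (rule elim(2))
    have "eventually (\<lambda>j. 1 - 2 * e < bfun (2 ^ j) / bfun (2 ^ Suc j)) sequentially"
      by (rule order_tendstoD(1)[OF bfun_ratio]) (use e in simp)
    from eventually_block[OF this] eventually_block[OF elim(1)] card_large[of 1]
    show ?case
    proof eventually_elim
      case (elim n)
      define j where "j = block n"
      define b where "b = bfun (card (T n))"
      have b: "0 < b" "b \<le> bfun (2 ^ Suc j)"
        unfolding b_def j_def using bfun_pos bfun_block(2)[OF elim(3)] by auto
      obtain t where t: "t \<in> lower j" "(1 - 2 * e) * bfun (card (lower j)) < Y t \<omega>"
        using elim(2) w unfolding A_def j_def by (auto simp: not_le)
      have "(1 - 2 * e) * b \<le> (1 - 2 * e) * bfun (2 ^ Suc j)" using b e by (intro mult_left_mono) auto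
      also have "\<dots> \<le> bfun (2 ^ j)" using elim(1) bfun_pos[of "2 ^ Suc j"] by (simp add: j_def field_simps)
      also have "\<dots> \<le> bfun (card (lower j))"
      proof (rule bfun_mono)
        have "real (2 ^ j) \<le> real (card (lower j))" using lower_card(2) by (simp only: of_nat_le_iff)
        then show "2 ^ j \<le> real (card (lower j))" by simp
      qed
      finally have "(1 - 2 * e) * ((1 - 2 * e) * b) \<le> (1 - 2 * e) * bfun (card (lower j))"
        using e by (intro mult_left_mono) auto
      with t(2) have "(1 - 2 * e) * ((1 - 2 * e) * b) \<le> Y t \<omega>" by linarith
      then have "s * ((1 - 2 * e) * ((1 - 2 * e) * b)) \<le> f (X t \<omega>)" using s by (simp add: Y_def field_simps)
      moreover have "(s - d) * b \<le> s * ((1 - 2 * e) * ((1 - 2 * e) * b))"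
      proof -
        have "s - d \<le> s - 4 * e * s + 4 * e\<^sup>2 * s" using e(3) s by (simp add: add_increasing2)
        also have "\<dots> = s * ((1 - 2 * e) * (1 - 2 * e))" by (simp add: power2_eq_square algebra_simps)
        finally have "(s - d) * b \<le> s * ((1 - 2 * e) * (1 - 2 * e)) * b" using b by (intro mult_right_mono) auto
        then show ?thesis by (simp only: mult.assoc)
      qed
      ultimately have "(s - d) * b \<le> f (X t \<omega>)" by linarith
      then have "s - d \<le> f (X t \<omega>) / b" using b by (simp add: field_simps)
      moreover have "f ((1 / b) *\<^sub>R X t \<omega>) = f (X t \<omega>) / b" using linear_simps(5)[OF f] by simp
      ultimately have "s - d \<le> f ((1 / b) *\<^sub>R X t \<omega>)" by simp
      moreover have "t \<in> T n" using t(1) block_bounds(4)[OF elim(3)] unfolding j_def by blast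
      ultimately show ?case unfolding s_def b_def by blast
    qed
  qed
qed

text \<open>Only countably many functionals occur, finitely many for each accuracy
  \<open>e k\<close>, so all almost sure statements hold off one null set.\<close>

lemma hausdorff_limit:
  "AE \<omega> in M. (\<lambda>n. hausdorff_dist
      ((\<lambda>x. (1 / bfun (card (T n))) *\<^sub>R x) ` closure (convex hull ((\<lambda>t. X t \<omega>) ` T n))) (conc_ellipsoid P)) \<longlonglongrightarrow> 0"
proof -
  define e where "e k = 1 / (real k + 1)" for k :: nat
  have e: "e k > 0" for k unfolding e_def by simp
  have tb: "\<And>r. r > 0 \<Longrightarrow> \<exists>A. finite A \<and> K \<subseteq> (\<Union>a\<in>A. ball a r)"
    using gaussian_element.K_tb[OF elem] .
  \<comment> \<open>With \<open>C = 20\<close> the choice \<open>\<eta> = e k / 88\<close> meets the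
    budget \<open>(C + 2) * \<eta> \<le> e k / 4\<close> with equality.\<close>
  have "\<forall>k. \<exists>G. finite G \<and> G \<subseteq> dual_ball \<and> (\<forall>f\<in>dual_ball. \<exists>g\<in>G. \<forall>y\<in>K. \<bar>f y - g y\<bar> \<le> e k / 88)"
    using e by (intro allI dual_ball_net[OF tb]) simp_all
  then obtain G where G: "\<And>k. finite (G k)" "\<And>k. G k \<subseteq> dual_ball"
      "\<And>k f. f \<in> dual_ball \<Longrightarrow> \<exists>g\<in>G k. \<forall>y\<in>K. \<bar>f y - g y\<bar> \<le> e k / 88" by metis
  have bl: "bounded_linear g" if "g \<in> G k" for g k using that G(2)[of k] by (auto simp: dual_ball_def)
  have "AE \<omega> in M. \<forall>k. \<forall>g\<in>G k. eventually (\<lambda>n. \<forall>t\<in>T n. g (Xb n t \<omega>) \<le> sd P g + e k / 4) sequentially"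
    unfolding AE_all_countable
    by (intro allI AE_ball_countable'[OF _ countable_finite[OF G(1)]] functional_upper bl) (use e in auto)
  moreover have "AE \<omega> in M. \<forall>k. \<forall>g\<in>G k. eventually (\<lambda>n. \<exists>t\<in>T n. sd P g - e k / 4 \<le> g (Xb n t \<omega>)) sequentially"
    unfolding AE_all_countable
    by (intro allI AE_ball_countable'[OF _ countable_finite[OF G(1)]] functional_lower bl) (use e in auto)
  ultimately show ?thesis using body_eventually
  proof eventually_elim
    case (elim \<omega>)
    define W where "W n = (\<lambda>x. (1 / bfun (card (T n))) *\<^sub>R x) ` closure (convex hull ((\<lambda>t. X t \<omega>) ` T n))" for n
    define V where "V n = (\<lambda>t. Xb n t \<omega>) ` T n" for n
    have WV: "W n = closure (convex hull (V n))" for n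
      unfolding W_def V_def closure_scaleR convex_hull_scaling[symmetric] image_image ..
    have bound: "eventually (\<lambda>n. \<bar>hausdorff_dist (W n) (conc_ellipsoid P)\<bar> \<le> 2 * e k) sequentially" for k
    proof -
      have "eventually (\<lambda>n. \<forall>g\<in>G k. \<forall>t\<in>T n. g (Xb n t \<omega>) \<le> sd P g + e k / 4) sequentially"
        using elim(1) G(1) by (intro eventually_ball_finite) auto
      moreover have "eventually (\<lambda>n. \<forall>g\<in>G k. \<exists>t\<in>T n. sd P g - e k / 4 \<le> g (Xb n t \<omega>)) sequentially"
        using elim(2) G(1) by (intro eventually_ball_finite) auto
      ultimately show ?thesis using elim(3)
      proof eventually_elim
        case (elim n)
        \<comment> \<open>All \<open>X t\<close> have law \<open>P\<close>, so any index serves to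
          speak about the ellipsoid.\<close>
        interpret ge: gaussian_element M "X undefined" K by (rule elem)
        have "0 \<le> hausdorff_dist (closure (convex hull (V n))) (conc_ellipsoid ge.law) \<and>
            hausdorff_dist (closure (convex hull (V n))) (conc_ellipsoid ge.law) \<le> 2 * e k"
        proof (intro conjI ge.hull_close_to_ellipsoid[where C = 20 and \<eta> = "e k / 88" and G = "G k"])
          show "(20 + 2) * (e k / 88) \<le> e k / 4" "(20 + 2) * (e k / 88) \<le> e k / 4" by auto
          show "\<exists>v\<in>V n. sd ge.law g - e k / 4 \<le> g v" "\<exists>v\<in>V n. sd ge.law g - e k / 4 \<le> g v" if "g \<in> G k" for g
            using elim(2) that unfolding V_def law by auto
          show "g v \<le> sd ge.law g + e k / 4" "g v \<le> sd ge.law g + e k / 4" if "g \<in> G k" "v \<in> V n" for g v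
            using elim(1) that unfolding V_def law by auto
          show "(1 / 20) *\<^sub>R v \<in> K" "(1 / 20) *\<^sub>R v \<in> K" if "v \<in> V n" for v
            using elim(3) that unfolding V_def by auto
        qed (use e G in auto)
        then show ?case unfolding WV law by auto
      qed
    qed
    have "(\<lambda>n. hausdorff_dist (W n) (conc_ellipsoid P)) \<longlonglongrightarrow> 0"
    proof (rule tendstoI)
      fix r :: real assume r: "r > 0"
      have "(\<lambda>k. 2 * e k) \<longlonglongrightarrow> 0" unfolding e_def by real_asymp
      from order_tendstoD(2)[OF this r] obtain k where k: "2 * e k < r"
        unfolding eventually_sequentially by blast
      show "eventually (\<lambda>n. dist (hausdorff_dist (W n) (conc_ellipsoid P)) 0 < r) sequentially"
        using bound[of k] by eventually_elim (use k in auto)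
    qed
    then show ?case unfolding W_def .
  qed
qed

end

section \<open>Specialisation to the integer lattice\<close>

theorem theorem1:
  fixes M :: "'a measure"
    and X :: "int ^ 'm \<Rightarrow> 'a \<Rightarrow> 'b::{banach, second_countable_topology}"
    and P :: "'b measure"
    and T :: "nat \<Rightarrow> (int ^ 'm) set"
  assumes gauss: "centered_gaussian_process M X"
    and same_distr: "\<And>t. distr M borel (X t) = P"
    and T_finite: "\<And>n. finite (T n)"
    and T_incr: "\<And>n. T n \<subseteq> T (Suc n)"
    and T_card: "filterlim (\<lambda>n. card (T n)) at_top sequentially"
    and decorr: "\<And>f. dual_elem f \<Longrightarrow>
        (\<forall>\<epsilon>>0. \<exists>R. \<forall>t s. maxdist t s > R \<longrightarrow>
           \<bar>\<integral>\<omega>. f (X t \<omega>) * f (X s \<omega>) \<partial>M\<bar> < \<epsilon>)"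
  shows "AE \<omega> in M.
    (\<lambda>n. hausdorff_dist
          ((\<lambda>x. (1 / bfun (real (card (T n)))) *\<^sub>R x) ` closure (convex hull ((\<lambda>t. X t \<omega>) ` T n)))
          (conc_ellipsoid P)) \<longlonglongrightarrow> 0"
proof -
  interpret prob_space M using gauss by (simp add: centered_gaussian_process_def)
  have X[measurable]: "X t \<in> borel_measurable M" for t
    using gauss by (simp add: centered_gaussian_process_def)
  have joint: "centered_gaussian_rv M (\<lambda>\<omega>. \<Sum>t\<in>F. c t (X t \<omega>))"
    if "finite F" "\<And>t. bounded_linear (c t)" for F c
    using gauss that by (simp add: centered_gaussian_process_def dual_elem_def)
  have P: "prob_space P" "sets P = sets borel"
    unfolding same_distr[of undefined, symmetric] by (auto intro!: prob_space_distr)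
  \<comment> \<open>The body is built from the common law alone, so one \<open>K\<close> serves
    every \<open>X t\<close>.\<close>
  obtain K where K: "closed K" "convex K" "\<forall>x\<in>K. - x \<in> K" "0 \<in> K"
      "\<forall>e>0. \<exists>A. finite A \<and> K \<subseteq> (\<Union>a\<in>A. ball a e)" "1/2 \<le> measure P K"
    using exists_symmetric_body[OF P] by blast
  have elem: "gaussian_element M (X t) K" for t
  proof
    show "X t \<in> borel_measurable M" by (rule X)
    show "centered_gaussian_rv M (\<lambda>\<omega>. f (X t \<omega>))" if "bounded_linear f" for f :: "'b \<Rightarrow> real"
      using joint[of "{t}" "\<lambda>_. f"] that by simp
    have "measure P K = prob (X t -` K \<inter> space M)"
      unfolding same_distr[of t, symmetric] by (rule measure_distr) (use K(1) in auto)
    also have "X t -` K \<inter> space M = {\<omega>\<in>space M. X t \<omega> \<in> K}" by auto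
    finally show "1/2 \<le> prob {\<omega>\<in>space M. X t \<omega> \<in> K}" using K(6) by simp
  qed (use K in auto)
  \<comment> \<open>Decorrelation gives a radius beyond which covariances are small, so the strongly
    correlated partners of \<open>t\<close> lie in a lattice ball whose size is bounded
    independently of \<open>t\<close>.\<close>
  have near: "\<exists>D. \<forall>t. finite {s. \<not> \<bar>\<integral>\<omega>. f (X t \<omega>) * f (X s \<omega>) \<partial>M\<bar> < e} \<and>
      card {s. \<not> \<bar>\<integral>\<omega>. f (X t \<omega>) * f (X s \<omega>) \<partial>M\<bar> < e} \<le> D"
    if f: "bounded_linear f" and e: "e > 0" for f :: "'b \<Rightarrow> real" and e
  proof -
    obtain R where R: "\<forall>t s. maxdist t s > R \<longrightarrow> \<bar>\<integral>\<omega>. f (X t \<omega>) * f (X s \<omega>) \<partial>M\<bar> < e"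
      using decorr[of f] f e by (auto simp: dual_elem_def)
    have sub: "{s. \<not> \<bar>\<integral>\<omega>. f (X t \<omega>) * f (X s \<omega>) \<partial>M\<bar> < e} \<subseteq> {s. maxdist t s \<le> R}" for t
      using R by (intro Collect_mono) (meson not_le)
    show ?thesis
    proof (intro exI allI conjI)
      fix t
      show "finite {s. \<not> \<bar>\<integral>\<omega>. f (X t \<omega>) * f (X s \<omega>) \<partial>M\<bar> < e}"
        by (rule finite_subset[OF sub maxdist_ball(1)])
      show "card {s. \<not> \<bar>\<integral>\<omega>. f (X t \<omega>) * f (X s \<omega>) \<partial>M\<bar> < e} \<le> card {d :: int ^ 'm. \<forall>k. \<bar>d $ k\<bar> \<le> R}"
        by (rule order_trans[OF card_mono[OF maxdist_ball(1) sub] maxdist_ball(2)])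
    qed
  qed
  interpret gaussian_field M T X P K
    by (intro gaussian_field.intro increasing_sets.intro gaussian_field_axioms.intro prob_space_axioms
        T_finite T_incr T_card same_distr elem joint near)
  show ?thesis by (rule hausdorff_limit)
qed

end
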